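(* Let $q,m,n,a,b\in\mathbb{N}$ with $(a,q)=(b,q)=1$. Then \[ V_{\chi,q}(m,n;a,b)=\frac{(-1)^{\frac{m-n}{2}}(2\pi)^{m+n}\phi(q)}{4q^{m+n}m!\,n!}\bigl(R(m,n,q;a,b)+R(n,m,q;b,a)+C_{1}\bigr), \] where \[ R(m,n,q;a,b)=nb^{n-1}\sum_{j=0}^{m}\binom{m}{j}\frac{(-1)^{j}a^{m-j}}{m+n-j}\sum_{l=1}^{b}\overline{B}_{j}\Bigl(\frac{al}{b}\Bigr)\sum_{d\mid q}\mu\Bigl(\frac{q}{d}\Bigr)d^{j}\,\overline{B}_{m+n-j}\Bigl(\frac{dl}{b}\Bigr) \] (and $R(n,m,q;b,a)$ is the same expression with $(m,n,a,b)$ replaced by $(n,m,b,a)$), and \[ C_{1}=\frac{(-1)^{n-1}m!\,n!\,(a,b)^{m+n}B_{m+n}J_{m+n}(q)}{a^{n}b^{m}(m+n)!}-\delta_{1,m}\delta_{1,n}\frac{\phi(q)}{4}. \]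
   Context: For $q\in\mathbb{N}$ and a Dirichlet character $\chi$ modulo $q$, $L(s,\chi)=\sum_{n\ge1}\chi(n)n^{-s}$ (for $\Re s>1$, and for $s=1$ when $\chi$ is non-principal), and $\overline{\chi}$ is the complex conjugate character. For $m,n\in\mathbb{N}$ and integers $a,b$, \[V_{\chi,q}(m,n;a,b)=\sum_{\substack{\chi \bmod q\\ \chi(-1)=(-1)^{m}=(-1)^{n}}}\chi(a)\overline{\chi}(b)L(m,\chi)L(n,\overline{\chi}).\] $\phi$ is Euler's totient function, $\mu$ the Möbius function, $(a,b)$ the greatest common divisor, and for $\alpha\in\mathbb{C}$, $J_{\alpha}(q)=q^{\alpha}\prod_{p\mid q,\ p\text{ prime}}(1-p^{-\alpha})$. $\delta_{m,n}$ is the Kronecker delta. $B_n(x)$ is the $n$-th Bernoulli polynomial and $B_n=B_n(0)$ the $n$-th Bernoulli number. The Bernoulli functions are $\overline{B}_0(x)=1$; $\overline{B}_1(x)=0$ if $x\in\mathbb{Z}$ and $\overline{B}_1(x)=B_1(\{x\})$ if $x\notin\mathbb{Z}$; $\overline{B}_n(x)=B_n(\{x\})$ for $n\ge2$, where $\{x\}$ is the fractional part of $x$. *)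

theory Defs
  imports
    "HOL-Analysis.Analysis"
    "HOL-Computational_Algebra.Computational_Algebra"
    "HOL-Number_Theory.Number_Theory"
begin

definition dirichlet_character :: "nat \<Rightarrow> (int \<Rightarrow> complex) \<Rightarrow> bool" where
  "dirichlet_character q \<psi> \<longleftrightarrow>
     (\<forall>x y. \<psi> (x * y) = \<psi> x * \<psi> y) \<and>
     (\<forall>x. \<psi> (x + int q) = \<psi> x) \<and>
     (\<forall>x. \<psi> x \<noteq> 0 \<longleftrightarrow> coprime x (int q))"

lemma finite_dirichlet_characters:
  assumes "q > 0" shows "finite {\<psi>. dirichlet_character q \<psi>}"
proof -
  let ?R = "insert 0 {z::complex. z ^ totient q = 1}"
  let ?C = "{\<psi>. dirichlet_character q \<psi>}"
  have fin: "finite (Pi\<^sub>E {0..<int q} (\<lambda>_. ?R))"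
    using assms by (intro finite_PiE) (auto intro!: finite_roots_unity simp: Suc_le_eq)
  have per: "\<psi> x = \<psi> (x mod int q)" if "dirichlet_character q \<psi>" for \<psi> x
  proof -
    have p: "\<psi> (y + int q) = \<psi> y" for y using that by (auto simp: dirichlet_character_def)
    have pn: "\<psi> (y + int k * int q) = \<psi> y" for y k
      by (induction k) (simp_all add: algebra_simps, metis p add.assoc add.commute)
    show ?thesis
    proof (cases "x div int q \<ge> 0")
      case True
      then show ?thesis using pn[of "x mod int q" "nat (x div int q)"] by (simp add: mult.commute)
    next
      case False
      then show ?thesis using pn[of x "nat (- (x div int q))"] by (simp add: minus_div_mult_eq_mod)
    qed
  qed
  have rng: "\<psi> x \<in> ?R" if d: "dirichlet_character q \<psi>" for \<psi> x
  proof (cases "\<psi> x = 0")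
    case False
    have mult: "\<psi> (y * z) = \<psi> y * \<psi> z" for y z using d by (auto simp: dirichlet_character_def)
    have nz: "\<psi> y \<noteq> 0 \<longleftrightarrow> coprime y (int q)" for y using d by (auto simp: dirichlet_character_def)
    have one: "\<psi> 1 = 1" using mult[of 1 1] nz[of 1] by simp
    have pow: "\<psi> (x ^ k) = \<psi> x ^ k" for k by (induction k) (simp_all add: one mult)
    have "coprime x (int q)" using False nz by blast
    then have "[x ^ totient q = 1] (mod int q)"
    proof -
      define y where "y = nat (x mod int q)"
      have y: "int y = x mod int q" using assms by (simp add: y_def)
      have "coprime y q" using \<open>coprime x (int q)\<close> assms by (metis y coprime_int_iff coprime_mod_left_iff of_nat_0_less_iff less_irrefl)
      then have "[y ^ totient q = 1] (mod q)" by (rule euler_theorem)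
      then have "[int y ^ totient q = 1] (mod int q)" by (metis cong_int_iff of_nat_1 of_nat_power)
      then show ?thesis unfolding y by (simp add: cong_def power_mod)
    qed
    then have "\<psi> (x ^ totient q) = \<psi> 1" using per[OF d] by (metis cong_def)
    then show ?thesis by (simp add: pow one)
  qed simp
  have "inj_on (\<lambda>\<psi>. restrict \<psi> {0..<int q}) ?C"
  proof (rule inj_onI, rule ext)
    fix f g x assume f: "f \<in> ?C" and g: "g \<in> ?C" and e: "restrict f {0..<int q} = restrict g {0..<int q}"
    have "x mod int q \<in> {0..<int q}" using assms by simp
    then have "f (x mod int q) = g (x mod int q)" using e by (metis restrict_apply')
    then show "f x = g x" using per[of f x] per[of g x] f g by simp
  qed
  moreover have "(\<lambda>\<psi>. restrict \<psi> {0..<int q}) ` ?C \<subseteq> Pi\<^sub>E {0..<int q} (\<lambda>_. ?R)"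
    by (rule image_subsetI, rule restrict_PiE_iff[THEN iffD2]) (use rng in blast)
  ultimately show ?thesis using fin by (meson finite_subset inj_on_finite)
qed

text \<open>
  The series is summed in its natural order, so that \<open>suminf\<close> also gives the conditionally
  convergent value at \<open>s = 1\<close> for a non-principal character. Outside the region of convergence
  the definition carries no meaning; no analytic continuation is intended.
\<close>
definition dirichlet_L :: "complex \<Rightarrow> (int \<Rightarrow> complex) \<Rightarrow> complex" where
  "dirichlet_L s \<psi> = (\<Sum>k. \<psi> (int (Suc k)) * of_nat (Suc k) powr (- s))"

definition dirichlet_V :: "nat \<Rightarrow> nat \<Rightarrow> nat \<Rightarrow> int \<Rightarrow> int \<Rightarrow> complex" where
  "dirichlet_V q m n a b =
     (\<Sum>\<psi> | dirichlet_character q \<psi> \<and> \<psi> (-1) = (-1) ^ m \<and> (-1) ^ m = ((-1) ^ n :: complex).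
        \<psi> a * cnj (\<psi> b) * dirichlet_L (of_nat m) \<psi> * dirichlet_L (of_nat n) (\<lambda>k. cnj (\<psi> k)))"

definition moebius_mu :: "nat \<Rightarrow> real" where
  "moebius_mu n = (if squarefree n then (-1) ^ card (prime_factors n) else 0)"

definition jordan_J :: "complex \<Rightarrow> nat \<Rightarrow> complex" where
  "jordan_J \<alpha> q = of_nat q powr \<alpha> * (\<Prod>p | prime p \<and> p dvd q. 1 - of_nat p powr (- \<alpha>))"

text \<open>
  Exponential generating function: \<open>t e\<^sup>x\<^sup>t / (e\<^sup>t - 1) = (\<Sum>n. B\<^sub>n(x) t\<^sup>n / n!)\<close>, read as an identity of
  formal power series in \<open>t\<close>. The division is exact, since numerator and denominator both
  have subdegree 1. In particular \<open>B\<^sub>1 = -1/2\<close>.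
\<close>
definition bernoulli_poly :: "nat \<Rightarrow> real \<Rightarrow> real" where
  "bernoulli_poly n x = fact n * fps_nth (fps_X * fps_exp x / (fps_exp 1 - 1)) n"

lemma bernoulli_poly_egf:
  "Abs_fps (\<lambda>n. bernoulli_poly n x / fact n) * (fps_exp 1 - 1) = fps_X * fps_exp x"
proof -
  let ?g = "fps_exp (1::real) - 1"
  let ?h = "Abs_fps (\<lambda>n. 1 / fact (Suc n)) :: real fps"
  have g: "?g = fps_X * ?h"
    by (rule fps_ext) (auto simp: gr0_conv_Suc)
  have h: "fps_nth ?h 0 \<noteq> 0"
    by simp
  have "Abs_fps (\<lambda>n. bernoulli_poly n x / fact n) = fps_X * fps_exp x / ?g"
    by (rule fps_ext) (simp add: bernoulli_poly_def)
  also have "\<dots> = fps_exp x / ?h"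
    unfolding g by (rule div_mult_mult1) simp
  finally show ?thesis
    using h unfolding g by (simp add: fps_divide_unit mult.assoc mult.left_commute inverse_mult_eq_1)
qed

definition bernoulli_number :: "nat \<Rightarrow> real" where
  "bernoulli_number n = bernoulli_poly n 0"

definition bernoulli_fun :: "nat \<Rightarrow> real \<Rightarrow> real" where
  "bernoulli_fun n x =
     (if n = 0 then 1
      else if n = 1 \<and> x \<in> \<int> then 0
      else bernoulli_poly n (frac x))"

definition bernoulli_R :: "nat \<Rightarrow> nat \<Rightarrow> nat \<Rightarrow> nat \<Rightarrow> nat \<Rightarrow> real" where
  "bernoulli_R m n q a b =
     real n * real b ^ (n - 1) *
     (\<Sum>j = 0..m. real (m choose j) * ((-1) ^ j * real a ^ (m - j) / real (m + n - j)) *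
        (\<Sum>l = 1..b. bernoulli_fun j (real (a * l) / real b) *
           (\<Sum>d | d dvd q. moebius_mu (q div d) * real d ^ j *
              bernoulli_fun (m + n - j) (real (d * l) / real b))))"

definition const_C1 :: "nat \<Rightarrow> nat \<Rightarrow> nat \<Rightarrow> nat \<Rightarrow> nat \<Rightarrow> complex" where
  "const_C1 m n q a b =
     (-1) ^ (n - 1) * fact m * fact n * of_nat (gcd a b) ^ (m + n) *
       of_real (bernoulli_number (m + n)) * jordan_J (of_nat (m + n)) q /
       (of_nat a ^ n * of_nat b ^ m * fact (m + n))
     - (if m = 1 \<and> n = 1 then of_nat (totient q) / 4 else 0)"

end

theory Submission imports Defs begin

text \<open>
  The Fourier series of the Bernoulli functions turn \<open>2 L(m, \<psi>)\<close>, for a character \<open>\<psi>\<close> of the parity of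
  \<open>m\<close>, into a finite sum over residues; for the opposite parity that finite sum vanishes, so the sum
  over characters may be taken over all of them. Orthogonality of characters and Moebius inversion then
  leave, for every divisor \<open>d\<close> of \<open>q\<close>, the generalized Dedekind sum
  \<open>\<Sum>w<d. B\<^sub>m(aw/d) B\<^sub>n(bw/d)\<close> of periodic Bernoulli functions. Its reciprocity law comes from a pointwise
  identity expressing \<open>B\<^sub>m(u) B\<^sub>n(v)\<close> linearly in the functions \<open>B\<^sub>k(u)\<close> and \<open>B\<^sub>k(v)\<close> with coefficients
  depending on \<open>u - v\<close> only: by the multiplication theorem, summing it over \<open>u = w/d - k/a\<close>,
  \<open>v = w/d - l/b\<close> gives the two sums \<open>R\<close>, the term in \<open>B\<^sub>m\<^sub>+\<^sub>n\<close>, and the correction at the single common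
  jump for \<open>m = n = 1\<close>.
\<close>

section \<open>Bernoulli polynomials and Bernoulli functions\<close>

text \<open>Dividing the Bernoulli polynomials by \<open>n!\<close> makes differentiation lower the
  index with factor 1; factorials return only when \<open>bernoulli_R\<close> and
  \<open>const_C1\<close> are matched. In this normalization the pointwise product identity is the
  coefficient form of 1/((e^s-1)(e^t-1)) = (1 + 1/(e^s-1) + 1/(e^t-1)) / (e^(s+t)-1), multiplied by
  e^(us+vt); the polar part 1/(s+t) yields the \<open>B\<^sub>m\<^sub>+\<^sub>n\<close> term. The
  delicate index is 1, where the Bernoulli function jumps and both its Fourier series and the
  L-series converge only conditionally. Its value 0 at integers, the mean of the one-sided limits,
  keeps parity, multiplication theorem and Fourier expansion valid there; only the product identity
  needs a correction. Finite Fourier inversion avoids any rearrangement of conditionally convergent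
  series. The sign (-1)^((m-n)/2) is a principal power, so the formula also speaks about m - n odd.
  Then V is an empty sum and every Dedekind sum vanishes because its summand is odd in w.\<close>

definition bern :: "nat \<Rightarrow> real \<Rightarrow> real" where
  "bern n x = bernoulli_poly n x / fact n"

definition bernf :: "nat \<Rightarrow> real \<Rightarrow> real" where
  "bernf n x = bernoulli_fun n x / fact n"

lemma bern_egf: "Abs_fps (\<lambda>n. bern n x) * (fps_exp 1 - 1) = fps_X * fps_exp x"
  unfolding bern_def by (rule bernoulli_poly_egf)

lemma fps_exp_minus_1_nonzero: "fps_exp (1::real) - 1 \<noteq> 0"
proof
  assume "fps_exp (1::real) - 1 = 0"
  then have "fps_nth (fps_exp (1::real) - 1) 1 = 0" by simp
  then show False by simp
qed

lemma bern_fps_expand: "Abs_fps (\<lambda>n. bern n x) = Abs_fps (\<lambda>n. bern n 0) * fps_exp x"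
proof -
  have "Abs_fps (\<lambda>n. bern n x) * (fps_exp 1 - 1) =
      (Abs_fps (\<lambda>n. bern n 0) * fps_exp x) * (fps_exp 1 - 1)"
    using bern_egf[of x] bern_egf[of 0] by (simp add: mult_ac)
  then show ?thesis using fps_exp_minus_1_nonzero by simp
qed

lemma bern_expand: "bern n x = (\<Sum>k\<le>n. bern k 0 * (x ^ (n - k) / fact (n - k)))"
proof -
  have "bern n x = fps_nth (Abs_fps (\<lambda>n. bern n 0) * fps_exp x) n"
    using arg_cong[OF bern_fps_expand[of x], of "\<lambda>f. fps_nth f n"] by simp
  then show ?thesis by (simp add: fps_mult_nth atLeast0AtMost)
qed

text \<open>Passing from x to x + 1 multiplies the generating function by e^t, so the difference is
  the series times e^t - 1, which is t e^(xt).\<close>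

lemma bern_add_1: "bern (Suc n) (x + 1) - bern (Suc n) x = x ^ n / fact n"
proof -
  have "Abs_fps (\<lambda>n. bern n (x + 1)) = Abs_fps (\<lambda>n. bern n x) * fps_exp 1"
    using bern_fps_expand[of x] bern_fps_expand[of "x + 1"] by (simp add: fps_exp_add_mult mult_ac)
  then have "Abs_fps (\<lambda>n. bern n (x + 1)) - Abs_fps (\<lambda>n. bern n x) = fps_X * fps_exp x"
    using bern_egf[of x] by (simp add: algebra_simps)
  then have "fps_nth (Abs_fps (\<lambda>n. bern n (x + 1)) - Abs_fps (\<lambda>n. bern n x)) (Suc n) =
      fps_nth (fps_X * fps_exp x) (Suc n)" by simp
  then show ?thesis by simp
qed

lemma bern_0 [simp]: "bern 0 x = 1"
proof -
  have "fps_nth (Abs_fps (\<lambda>n. bern n x) * (fps_exp 1 - 1)) 1 = 1"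
    by (subst bern_egf) simp
  then show ?thesis by (simp add: fps_mult_nth)
qed

lemma bern_has_deriv:
  "(bern (Suc n) has_real_derivative bern n x) (at x)"
proof -
  have eq: "bern (Suc n) = (\<lambda>x. (\<Sum>k\<le>n. bern k 0 * (x ^ (Suc n - k) / fact (Suc n - k))) + bern (Suc n) 0)"
    by (rule ext, subst bern_expand) simp
  have "((\<lambda>x::real. x ^ (Suc n - k) / fact (Suc n - k)) has_real_derivative
      x ^ (n - k) / fact (n - k)) (at x)" if "k \<le> n" for k
  proof -
    have "((\<lambda>x::real. x ^ Suc (n - k) / fact (Suc (n - k))) has_real_derivative
      x ^ (n - k) / fact (n - k)) (at x)"
      using DERIV_cdivide[OF DERIV_pow[of "Suc (n - k)" x UNIV], of "fact (Suc (n - k))"]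
      by (simp add: fact_Suc del: power_Suc of_nat_Suc)
    then show ?thesis using that by (simp add: Suc_diff_le)
  qed
  then have "((\<lambda>x. (\<Sum>k\<le>n. bern k 0 * (x ^ (Suc n - k) / fact (Suc n - k))) + bern (Suc n) 0)
      has_real_derivative (\<Sum>k\<le>n. bern k 0 * (x ^ (n - k) / fact (n - k))) + 0) (at x)"
    by (intro DERIV_add DERIV_sum DERIV_cmult DERIV_const) auto
  then show ?thesis by (subst eq, subst bern_expand) simp
qed

lemma bern_deriv [derivative_intros]:
  assumes "(f has_real_derivative f') (at x within S)"
  shows "((\<lambda>x. bern n (f x)) has_real_derivative (if n = 0 then 0 else bern (n - 1) (f x)) * f') (at x within S)"
proof (cases n)
  case (Suc k)
  show ?thesis unfolding Suc using DERIV_chain2[OF bern_has_deriv assms, of k] by simp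
qed simp

lemma continuous_on_bern [continuous_intros]:
  assumes "continuous_on S f" shows "continuous_on S (\<lambda>x. bern n (f x))"
proof -
  have "continuous_on UNIV (bern n)"
    by (rule DERIV_continuous_on) (rule bern_deriv[where f="\<lambda>x. x", OF DERIV_ident])
  then show ?thesis using continuous_on_compose2[OF _ assms, of UNIV] by auto
qed

lemma zero_deriv_imp_const:
  assumes "\<And>x. (f has_real_derivative 0) (at x)"
  shows "f x = f (y::real)"
  using DERIV_isconst_all[of f] assms by blast

text \<open>The constant of integration at each level vanishes because the next level is periodic.\<close>

lemma appell_periodic_zero:
  fixes D :: "nat \<Rightarrow> real \<Rightarrow> real"
  assumes "\<And>x. D 0 x = 0" and "c \<noteq> 0" and "h \<noteq> 0"
    and deriv: "\<And>n x. (D (Suc n) has_real_derivative c * D n x) (at x)"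
    and per: "\<And>n x. D n (x + h) = D n x"
  shows "D n x = 0"
proof (induction n arbitrary: x)
  case (Suc n)
  have const: "D (Suc n) x = D (Suc n) 0" for x
    by (rule zero_deriv_imp_const) (use deriv[of n] Suc in simp)
  let ?k = "c * D (Suc n) 0"
  have "D (Suc (Suc n)) x - ?k * x = D (Suc (Suc n)) 0 - ?k * 0" for x
    by (rule zero_deriv_imp_const[where f="\<lambda>x. D (Suc (Suc n)) x - ?k * x"])
       (use deriv[of "Suc n"] const in \<open>auto intro!: derivative_eq_intros\<close>)
  from this[of h] have "?k * h = 0" using per[of "Suc (Suc n)" 0] by simp
  then show ?case using const[of x] assms by simp
qed (use assms in auto)

text \<open>The difference of the two sides is a sequence with derivative factor -1. It has period 1
  because \<open>bern_add_1\<close> gives both sides the same increment.\<close>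

lemma bern_reflect: "bern n (1 - x) = (-1) ^ n * bern n x"
proof -
  have "bern n (1 - x) - (-1) ^ n * bern n x = 0"
  proof (rule appell_periodic_zero[where D = "\<lambda>n x. bern n (1 - x) - (-1) ^ n * bern n x" and c = "-1" and h = 1])
    fix n x
    show "((\<lambda>x. bern (Suc n) (1 - x) - (- 1) ^ Suc n * bern (Suc n) x) has_real_derivative
       - 1 * (bern n (1 - x) - (- 1) ^ n * bern n x)) (at x)"
      by (auto intro!: derivative_eq_intros simp: algebra_simps)
  next
    fix n x
    show "bern n (1 - (x + 1)) - (- 1) ^ n * bern n (x + 1) = bern n (1 - x) - (- 1) ^ n * bern n x"
    proof (cases n)
      case (Suc k)
      have 1: "bern n (- x + 1) = bern n (-x) + (-x) ^ k / fact k"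
        using bern_add_1[of k "-x"] Suc by simp
      have 2: "bern n (x + 1) = bern n x + x ^ k / fact k"
        using bern_add_1[of k "x"] Suc by simp
      have 3: "(-x) ^ k = (-1) ^ k * x ^ k" by (simp add: power_minus')
      have "1 - (x + 1) = -x" "1 - x = -x + 1" by simp_all
      then show ?thesis using 1 2 3 Suc by (simp add: algebra_simps)
    qed simp
  qed auto
  then show ?thesis by simp
qed

text \<open>The difference of the two sides is a sequence with derivative factor N and period 1/N: a
  shift by 1/N makes the sum telescope to \<open>bern n (x + 1) - bern n x\<close>, and it moves the
  argument N x by 1.\<close>

lemma bern_mult:
  assumes "N > 0"
  shows "real N ^ n * (\<Sum>k<N. bern n (x + real k / real N)) = real N * bern n (real N * x)"
proof -
  have "real N ^ n * (\<Sum>k<N. bern n (x + real k / real N)) - real N * bern n (real N * x) = 0"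
  proof (rule appell_periodic_zero[where D = "\<lambda>n x. real N ^ n * (\<Sum>k<N. bern n (x + real k / real N)) - real N * bern n (real N * x)"
        and c = "real N" and h = "1 / N"])
    fix n x
    show "((\<lambda>x. real N ^ Suc n * (\<Sum>k<N. bern (Suc n) (x + real k / real N)) - real N * bern (Suc n) (real N * x)) has_real_derivative
       real N * (real N ^ n * (\<Sum>k<N. bern n (x + real k / real N)) - real N * bern n (real N * x))) (at x)"
      by (auto intro!: derivative_eq_intros simp: algebra_simps sum_distrib_left)
  next
    fix n x
    let ?S = "\<lambda>x. \<Sum>k<N. bern n (x + real k / real N)"
    have "?S (x + 1/N) = (\<Sum>k<N. bern n (x + real (Suc k) / real N))"
      by (simp add: add_divide_distrib algebra_simps)
    also have "\<dots> - ?S x = (\<Sum>k<N. bern n (x + real (Suc k) / real N) - bern n (x + real k / real N))"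
      by (simp add: sum_subtractf)
    also have "\<dots> = bern n (x + 1) - bern n x"
      by (subst sum_lessThan_telescope) (use assms in simp)
    finally have *: "?S (x + 1/N) - ?S x = bern n (x + 1) - bern n x" .
    show "real N ^ n * ?S (x + 1/N) - real N * bern n (real N * (x + 1 / N)) =
       real N ^ n * ?S x - real N * bern n (real N * x)"
    proof (cases n)
      case (Suc k)
      have **: "bern n (real N * x + 1) - bern n (real N * x) = real N ^ k * (x ^ k / fact k)"
        using bern_add_1[of k "real N * x"] Suc by (simp add: power_mult_distrib)
      have "real N ^ n * (?S (x + 1/N) - ?S x) = real N * (bern n (real N * x + 1) - bern n (real N * x))"
        unfolding * ** using bern_add_1[of k x] Suc by simp
      moreover have "real N * (x + 1 / N) = real N * x + 1" using assms by (simp add: field_simps)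
      ultimately show ?thesis by (simp add: algebra_simps)
    qed (use assms in simp)
  qed (use assms in auto)
  then show ?thesis by simp
qed

lemma bern_1: "bern 1 x = x - 1/2"
proof -
  have e: "bern 1 y = bern 1 0 + y" for y
    by (subst bern_expand) simp
  show ?thesis using bern_reflect[of 1 0] e[of 1] e[of x] by simp
qed

lemma bern_at_1: "n \<noteq> 1 \<Longrightarrow> bern n 1 = bern n 0"
  using bern_add_1[of "n - 1" 0] by (cases n) (auto simp: power_0_left)

lemma bern_odd_0: "odd n \<Longrightarrow> n \<noteq> 1 \<Longrightarrow> bern n 0 = 0"
  using bern_reflect[of n 0] bern_at_1[of n] by simp

lemma bernf_0 [simp]: "bernf 0 x = 1"
  by (simp add: bernf_def bernoulli_fun_def)

lemma bernf_eq: "bernf n x = (if n = 1 \<and> x \<in> \<int> then 0 else bern n (frac x))"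
  using bern_0[of "frac x"] by (auto simp: bernf_def bernoulli_fun_def bern_def)

lemma bernf_eq_bern: "0 < x \<Longrightarrow> x < 1 \<Longrightarrow> bernf n x = bern n x"
  using frac_eq[of x] frac_eq_0_iff[of x] by (auto simp: bernf_eq)

lemma bernf_add_int [simp]:
  assumes "k \<in> \<int>" shows "bernf n (x + k) = bernf n x"
proof -
  have "x + k \<in> \<int> \<longleftrightarrow> x \<in> \<int>" using assms by (metis Ints_add Ints_diff add_diff_cancel_right')
  moreover have "frac (x + k) = frac x" using assms by (auto elim!: Ints_cases simp: frac_def)
  ultimately show ?thesis by (simp add: bernf_eq)
qed

lemma bernf_cong: "x - y \<in> \<int> \<Longrightarrow> bernf n x = bernf n y"
  using bernf_add_int[of "x - y" n y] by simp

lemma bernf_frac [simp]: "bernf n (frac x) = bernf n x"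
  by (rule bernf_cong) (auto simp: frac_def)

lemma bernf_int: "x \<in> \<int> \<Longrightarrow> bernf n x = (if n = 1 then 0 else bern n 0)"
  by (auto simp: bernf_eq elim!: Ints_cases)

text \<open>At integers with n = 1 this rests on the value 0 chosen there; for the other odd n the
  polynomial itself vanishes at 0.\<close>

lemma bernf_minus: "bernf n (- x) = (-1) ^ n * bernf n x"
proof (cases "x \<in> \<int>")
  case True
  then show ?thesis by (auto simp: bernf_int bern_odd_0 uminus_power_if)
next
  case False
  then have "frac (-x) = 1 - frac x" by (simp add: frac_neg)
  then show ?thesis using False by (simp add: bernf_eq bern_reflect minus_in_Ints_iff)
qed

section \<open>Sums of periodic functions over complete residue systems\<close>

lemma sum_periodic_shift_one:
  fixes f :: "int \<Rightarrow> 'a::comm_monoid_add"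
  assumes "\<And>x. f (x + int N) = f x"
  shows "(\<Sum>k<N. f (c + 1 + int k)) = (\<Sum>k<N. f (c + int k))"
proof (cases N)
  case (Suc M)
  have "(\<Sum>k<N. f (c + 1 + int k)) = (\<Sum>k<M. f (c + 1 + int k)) + f (c + int N)"
    using Suc by (simp add: add_ac)
  also have "\<dots> = f (c + int 0) + (\<Sum>k<M. f (c + int (Suc k)))" by (simp add: assms add_ac)
  also have "\<dots> = (\<Sum>k<N. f (c + int k))" unfolding Suc by (subst sum.lessThan_Suc_shift) simp
  finally show ?thesis .
qed simp

lemma periodic_mult:
  fixes f :: "int \<Rightarrow> 'a" and j :: int
  assumes "\<And>x. f (x + int N) = f x"
  shows "f (x + int N * j) = f x"
proof (induction j rule: int_induct[of _ 0])
  case (step1 i) then show ?case using assms[of "x + int N * i"] by (simp add: algebra_simps)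
next
  case (step2 i) then show ?case using assms[of "x + int N * (i - 1)"] by (simp add: algebra_simps)
qed simp

lemma periodic_cong:
  fixes f :: "int \<Rightarrow> 'a"
  assumes "\<And>x. f (x + int N) = f x" and "[x = y] (mod int N)"
  shows "f x = f y"
proof -
  obtain j where "x = y + int N * j" using assms(2) by (metis cong_iff_lin cong_sym)
  then show ?thesis using periodic_mult[of f N y j] assms(1) by simp
qed

text \<open>The residues of the \<open>g k\<close> are N distinct elements of a set of size N, so
  they exhaust it.\<close>

lemma sum_periodic_reindex:
  fixes f :: "int \<Rightarrow> 'a::comm_monoid_add" and g :: "nat \<Rightarrow> int"
  assumes per: "\<And>x. f (x + int N) = f x"
    and inj: "\<And>i j. i < N \<Longrightarrow> j < N \<Longrightarrow> [g i = g j] (mod int N) \<Longrightarrow> i = j"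
  shows "(\<Sum>k<N. f (g k)) = (\<Sum>k<N. f (int k))"
proof (cases "N = 0")
  case False
  let ?h = "\<lambda>k. nat (g k mod int N)"
  have inj': "inj_on ?h {..<N}"
    using False inj by (intro inj_onI) (auto simp: cong_def eq_nat_nat_iff)
  have sub: "?h ` {..<N} \<subseteq> {..<N}" using False by (auto simp: nat_less_iff)
  then have img: "?h ` {..<N} = {..<N}" using inj' by (simp add: endo_inj_surj)
  have "(\<Sum>k<N. f (int k)) = (\<Sum>k<N. f (int (?h k)))"
    by (rule sum.reindex_bij_betw[symmetric]) (use inj' img in \<open>simp add: bij_betw_def\<close>)
  also have "\<dots> = (\<Sum>k<N. f (g k))"
    by (rule sum.cong[OF refl], rule periodic_cong[of f N, OF per]) (use False in \<open>simp add: cong_def\<close>)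
  finally show ?thesis ..
qed simp

lemma sum_periodic_affine:
  fixes f :: "int \<Rightarrow> 'a::comm_monoid_add"
  assumes "\<And>x. f (x + int N) = f x" and "coprime c (int N)"
  shows "(\<Sum>k<N. f (e + c * int k)) = (\<Sum>k<N. f (int k))"
proof (rule sum_periodic_reindex[where f = f])
  fix i j assume "i < N" "j < N" "[e + c * int i = e + c * int j] (mod int N)"
  then have "[int i = int j] (mod int N)" using assms(2)
    by (metis cong_add_lcancel cong_mult_lcancel)
  then show "i = j" using \<open>i < N\<close> \<open>j < N\<close> by (simp add: cong_int_iff cong_less_modulus_unique_nat)
qed (rule assms(1))

text \<open>Translating x by a multiple of 1/N permutes the points modulo 1, so x may be taken in
  [0, 1/N). Then all points lie in [0, 1) and the polynomial formula applies, up to the value at the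
  jump.\<close>

lemma bernf_mult:
  assumes "N > 0"
  shows "real N ^ n * (\<Sum>k<N. bernf n (x + real k / real N)) = real N * bernf n (real N * x)"
proof -
  have main: "real N ^ n * (\<Sum>k<N. bernf n (x + real k / real N)) = real N * bernf n (real N * x)"
    if x: "0 \<le> x" "x * N < 1" for x :: real
  proof -
    have bd: "0 \<le> x + real k / N \<and> x + real k / N < 1" if "k < N" for k
    proof -
      have "real k + 1 \<le> real N" using that by linarith
      then have "x * N + real k < N" using x by linarith
      then show ?thesis using x assms by (simp add: field_simps)
    qed
    show ?thesis
    proof (cases "n = 1 \<and> x = 0")
      \<comment> \<open>Here the point k = 0 sits on the jump. Replacing \<open>bern 1 0\<close> by
        0 removes one term from the polynomial sum, and that sum equals
        \<open>bern 1 0\<close>.\<close>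
      case True
      obtain M where M: "N = Suc M" using assms by (cases N) auto
      have "(\<Sum>k<N. bernf 1 (real k / real N)) = (\<Sum>k<N. if k = 0 then 0 else bern 1 (real k / real N))"
        by (rule sum.cong) (use bd True in \<open>auto simp: bernf_int intro!: bernf_eq_bern\<close>)
      also have "\<dots> = (\<Sum>k<N. bern 1 (real k / real N)) - bern 1 0"
        unfolding M by (subst (1 2) sum.lessThan_Suc_shift) simp
      also have "\<dots> = 0" using bern_mult[OF assms, of 1 0] assms by simp
      finally show ?thesis using True by (simp add: bernf_int)
    next
      case False
      have b: "bernf n y = bern n y" if "0 \<le> y" "y < 1" "n \<noteq> 1 \<or> y > 0" for y
        using that bernf_eq_bern[of y n] by (cases "y = 0") (auto simp: bernf_int)
      have "(\<Sum>k<N. bernf n (x + real k / real N)) = (\<Sum>k<N. bern n (x + real k / real N))"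
      proof (rule sum.cong[OF refl], rule b)
        fix k assume "k \<in> {..<N}"
        then show "0 \<le> x + real k / N" "x + real k / N < 1" using bd by auto
        show "n \<noteq> 1 \<or> x + real k / N > 0"
          using False bd[of k] x assms by (cases "x = 0") (auto intro: add_pos_nonneg)
      qed
      moreover have "bernf n (real N * x) = bern n (real N * x)"
        by (rule b) (use False x assms in \<open>auto simp: mult_ac\<close>)
      ultimately show ?thesis using bern_mult[OF assms] by simp
    qed
  qed
  define c where "c = \<lfloor>x * N\<rfloor>"
  define y where "y = x - c / N"
  have "0 \<le> y" "y * N < 1"
  proof -
    have "y * N = x * N - c" using assms by (simp add: y_def left_diff_distrib)
    then have "0 \<le> y * N" "y * N < 1" unfolding c_def by linarith+
    then show "0 \<le> y" "y * N < 1" using assms by (simp_all add: zero_le_mult_iff)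
  qed
  note m = main[OF this]
  have "(\<Sum>k<N. bernf n (x + real k / real N)) = (\<Sum>k<N. (\<lambda>i::int. bernf n (y + i / N)) (c + 1 * int k))"
    by (simp add: y_def add_divide_distrib algebra_simps)
  also have "\<dots> = (\<Sum>k<N. (\<lambda>i::int. bernf n (y + i / N)) (int k))"
  proof (rule sum_periodic_affine)
    fix i :: int
    have "y + real_of_int (i + int N) / N = y + i / N + 1" using assms by (simp add: field_simps)
    then show "bernf n (y + real_of_int (i + int N) / N) = bernf n (y + i / N)" by (simp only: bernf_add_int Ints_1)
  qed simp
  finally have "(\<Sum>k<N. bernf n (x + real k / real N)) = (\<Sum>k<N. bernf n (y + real k / real N))" by simp
  moreover have "bernf n (real N * x) = bernf n (real N * y)"
    by (rule bernf_cong) (use assms in \<open>simp add: y_def field_simps\<close>)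
  ultimately show ?thesis using m by simp
qed

section \<open>Products of Bernoulli functions\<close>

text \<open>For n > 0 this is the coefficient of s^(m-1) t^(n-1) in F(s) G(s+t), where F(s) is the
  sum of \<open>f j\<close> s^(j-1) and G(x) the sum of \<open>g k\<close> x^(k-1) over k \<ge>
  1.\<close>

definition bern_conv :: "nat \<Rightarrow> nat \<Rightarrow> (nat \<Rightarrow> real) \<Rightarrow> (nat \<Rightarrow> real) \<Rightarrow> real" where
  "bern_conv m n f g = (\<Sum>j\<le>m. real ((m + n - 1 - j) choose (n - 1)) * f j * g (m + n - j))"

text \<open>Difference of the two sides of the product identity. The value 0 at a zero index is what
  differentiating index 1 produces, so the derivative rule has no exception, and it gives the
  recursion on the constants its start.\<close>

definition bern_defect :: "nat \<Rightarrow> nat \<Rightarrow> real \<Rightarrow> real \<Rightarrow> real" where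
  "bern_defect m n u v = (if m = 0 \<or> n = 0 then 0 else
     bern m u * bern n v
     - bern_conv m n (\<lambda>j. bern j (u - v)) (\<lambda>j. bern j v)
     - bern_conv n m (\<lambda>j. (-1) ^ j * bern j (u - v)) (\<lambda>j. bern j u)
     - (-1) ^ (n - 1) * bern (m + n) (u - v))"

lemma bern_conv_deriv1:
  "((\<lambda>u. bern_conv (Suc m) (Suc n) (\<lambda>j. bern j (u - v)) g) has_real_derivative
     bern_conv m (Suc n) (\<lambda>j. bern j (u - v)) g) (at u)"
proof -
  have "((\<lambda>u. bern_conv (Suc m) (Suc n) (\<lambda>j. bern j (u - v)) g) has_real_derivative
     (\<Sum>j\<le>Suc m. real ((Suc m + Suc n - 1 - j) choose n) * (if j = 0 then 0 else bern (j - 1) (u - v)) * g (Suc m + Suc n - j))) (at u)"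
    unfolding bern_conv_def by (auto intro!: derivative_eq_intros sum.cong simp: mult_ac)
  then show ?thesis
    by (subst (asm) sum.atMost_Suc_shift) (simp add: bern_conv_def)
qed

text \<open>Both factors depend on u. Differentiating the first shifts j by one and, through the
  alternating sign, subtracts a binomial from the one of the second; Pascal's rule makes this
  difference the binomial for m.\<close>

lemma bern_conv_deriv2:
  assumes "m > 0"
  shows "((\<lambda>u. bern_conv (Suc n) (Suc m) (\<lambda>j. (-1) ^ j * bern j (u - v)) (\<lambda>j. bern j u)) has_real_derivative
     bern_conv (Suc n) m (\<lambda>j. (-1) ^ j * bern j (u - v)) (\<lambda>j. bern j u)) (at u)"
    (is "(?F has_real_derivative _) _")
proof -
  let ?z = "u - v"
  let ?c = "\<lambda>j. real ((Suc n + Suc m - 1 - j) choose m)"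
  let ?b = "\<lambda>j. bern (Suc n + m - j) u"
  have "(?F has_real_derivative
     (\<Sum>j\<le>Suc n. ?c j * ((-1) ^ j * (if j = 0 then 0 else bern (j - 1) ?z)) * bern (Suc n + Suc m - j) u
       + ?c j * ((-1) ^ j * bern j ?z) * ?b j)) (at u)"
    unfolding bern_conv_def
  proof (rule DERIV_sum)
    fix j assume "j \<in> {..Suc n}"
    then have e: "Suc n + Suc m - j = Suc (Suc n + m - j)" by auto
    show "((\<lambda>u. real ((Suc n + Suc m - 1 - j) choose (Suc m - 1)) * ((-1) ^ j * bern j (u - v)) * bern (Suc n + Suc m - j) u)
      has_real_derivative ?c j * ((-1) ^ j * (if j = 0 then 0 else bern (j - 1) ?z)) * bern (Suc n + Suc m - j) u
       + ?c j * ((-1) ^ j * bern j ?z) * ?b j) (at u)"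
      unfolding e by (rule derivative_eq_intros refl)+ (simp add: mult_ac)
  qed
  also have "(\<Sum>j\<le>Suc n. ?c j * ((-1) ^ j * (if j = 0 then 0 else bern (j - 1) ?z)) * bern (Suc n + Suc m - j) u
       + ?c j * ((-1) ^ j * bern j ?z) * ?b j)
     = (\<Sum>j\<le>n. ?c (Suc j) * ((-1) ^ Suc j * bern j ?z) * ?b j) + (\<Sum>j\<le>Suc n. ?c j * ((-1) ^ j * bern j ?z) * ?b j)"
    unfolding sum.distrib by (subst sum.atMost_Suc_shift) simp
  \<comment> \<open>The sum may be extended to \<open>j = Suc n\<close>: the new binomial is
    \<open>(m - 1) choose m\<close>, which is 0 for m > 0.\<close>
  also have "(\<Sum>j\<le>n. ?c (Suc j) * ((-1) ^ Suc j * bern j ?z) * ?b j)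
     = (\<Sum>j\<le>Suc n. - real ((Suc n + m - 1 - j) choose m) * ((-1) ^ j * bern j ?z) * ?b j)"
    using assms by (simp add: mult_ac)
  also have "\<dots> + (\<Sum>j\<le>Suc n. ?c j * ((-1) ^ j * bern j ?z) * ?b j)
     = (\<Sum>j\<le>Suc n. (?c j - real ((Suc n + m - 1 - j) choose m)) * ((-1) ^ j * bern j ?z) * ?b j)"
    unfolding sum.distrib[symmetric] by (rule sum.cong) (auto simp: algebra_simps)
  also have "\<dots> = bern_conv (Suc n) m (\<lambda>j. (-1) ^ j * bern j ?z) (\<lambda>j. bern j u)"
    unfolding bern_conv_def
  proof (rule sum.cong[OF refl])
    fix j assume "j \<in> {..Suc n}"
    then have "Suc n + Suc m - 1 - j = Suc (Suc n + m - 1 - j)" using assms by auto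
    moreover obtain k where "m = Suc k" using assms by (cases m) auto
    ultimately have "?c j = real ((Suc n + m - 1 - j) choose (m - 1)) + real ((Suc n + m - 1 - j) choose m)"
      by simp
    then show "(?c j - real ((Suc n + m - 1 - j) choose m)) * ((-1) ^ j * bern j ?z) * ?b j =
      real (Suc n + m - 1 - j choose (m - 1)) * ((- 1) ^ j * bern j (u - v)) * bern (Suc n + m - j) u"
      by simp
  qed
  finally show ?thesis .
qed

text \<open>All binomials are 1 here, so the two sums from the product rule cancel except for the
  top term j = \<open>Suc n\<close>.\<close>

lemma bern_conv_deriv2_0:
  "((\<lambda>u. bern_conv (Suc n) (Suc 0) (\<lambda>j. (-1) ^ j * bern j (u - v)) (\<lambda>j. bern j u)) has_real_derivative
     (-1) ^ Suc n * bern (Suc n) (u - v)) (at u)"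
    (is "(?F has_real_derivative _) _")
proof -
  let ?z = "u - v"
  let ?b = "\<lambda>j. bern (Suc n - j) u"
  have "(?F has_real_derivative
     (\<Sum>j\<le>Suc n. ((-1) ^ j * (if j = 0 then 0 else bern (j - 1) ?z)) * bern (Suc n + 1 - j) u
       + ((-1) ^ j * bern j ?z) * ?b j)) (at u)"
    unfolding bern_conv_def
  proof (rule DERIV_sum)
    fix j assume "j \<in> {..Suc n}"
    then have e: "Suc n + Suc 0 - j = Suc (Suc n - j)" "Suc n + 1 - j = Suc (Suc n - j)" by auto
    show "((\<lambda>u. real ((Suc n + Suc 0 - 1 - j) choose (Suc 0 - 1)) * ((-1) ^ j * bern j (u - v)) * bern (Suc n + Suc 0 - j) u)
      has_real_derivative ((-1) ^ j * (if j = 0 then 0 else bern (j - 1) ?z)) * bern (Suc n + 1 - j) u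
       + ((-1) ^ j * bern j ?z) * ?b j) (at u)"
      unfolding e by (rule derivative_eq_intros refl)+ (simp add: mult_ac)
  qed
  also have "(\<Sum>j\<le>Suc n. ((-1) ^ j * (if j = 0 then 0 else bern (j - 1) ?z)) * bern (Suc n + 1 - j) u
       + ((-1) ^ j * bern j ?z) * ?b j)
     = (\<Sum>j\<le>n. ((-1) ^ Suc j * bern j ?z) * ?b j) + (\<Sum>j\<le>Suc n. ((-1) ^ j * bern j ?z) * ?b j)"
    unfolding sum.distrib by (subst sum.atMost_Suc_shift) simp
  also have "\<dots> = (-1) ^ Suc n * bern (Suc n) ?z"
    by (simp add: sum.distrib[symmetric] sum_negf)
  finally show ?thesis .
qed

text \<open>For m > 0 each part lowers its index separately. For m = 0 the product cancels against
  the one-term convolution, and the leftover of \<open>bern_conv_deriv2_0\<close> against the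
  derivative of the last term, in agreement with the value 0.\<close>

lemma bern_defect_deriv:
  "((\<lambda>u. bern_defect (Suc m) n u v) has_real_derivative bern_defect m n u v) (at u)"
proof (cases n)
  case (Suc k)
  let ?z = "u - v"
  have eq: "(\<lambda>u. bern_defect (Suc m) n u v) = (\<lambda>u. bern (Suc m) u * bern n v
     - bern_conv (Suc m) (Suc k) (\<lambda>j. bern j (u - v)) (\<lambda>j. bern j v)
     - bern_conv (Suc k) (Suc m) (\<lambda>j. (-1) ^ j * bern j (u - v)) (\<lambda>j. bern j u)
     - (-1) ^ k * bern (Suc m + n) (u - v))"
    using Suc by (simp add: bern_defect_def)
  show ?thesis
  proof (cases m)
    case 0
    have "((\<lambda>u. bern_defect (Suc m) n u v) has_real_derivative
       bern m u * bern n v - bern_conv m (Suc k) (\<lambda>j. bern j ?z) (\<lambda>j. bern j v)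
       - (-1) ^ Suc k * bern (Suc k) ?z - (-1) ^ k * bern (m + n) ?z) (at u)"
      unfolding eq[unfolded 0] 0
      by (intro DERIV_diff bern_conv_deriv1 bern_conv_deriv2_0) (auto intro!: derivative_eq_intros)
    moreover have "bern_conv 0 (Suc k) (\<lambda>j. bern j ?z) (\<lambda>j. bern j v) = bern n v"
      using Suc by (simp add: bern_conv_def)
    ultimately show ?thesis using 0 Suc by (simp add: bern_defect_def)
  next
    case (Suc l)
    have "((\<lambda>u. bern_defect (Suc m) n u v) has_real_derivative
       bern m u * bern n v - bern_conv m (Suc k) (\<lambda>j. bern j ?z) (\<lambda>j. bern j v)
       - bern_conv (Suc k) m (\<lambda>j. (-1) ^ j * bern j ?z) (\<lambda>j. bern j u)
       - (-1) ^ k * bern (m + n) ?z) (at u)"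
      unfolding eq using Suc
      by (intro DERIV_diff bern_conv_deriv1 bern_conv_deriv2) (auto intro!: derivative_eq_intros)
    then show ?thesis using Suc \<open>n = Suc k\<close> by (simp add: bern_defect_def)
  qed
qed (simp add: bern_defect_def)

text \<open>Written with factorials, the binomial splits off \<open>v ^ n / fact n\<close>; what
  remains is the addition formula for \<open>bern m\<close>.\<close>

lemma bern_conv_powers:
  "bern_conv m (Suc n) (\<lambda>j. bern j z) (\<lambda>j. v ^ (j - 1) / fact (j - 1)) = bern m (z + v) * (v ^ n / fact n)"
proof -
  have "real ((m + Suc n - 1 - j) choose (Suc n - 1)) * bern j z * (v ^ (m + Suc n - j - 1) / fact (m + Suc n - j - 1))
      = (v ^ n / fact n) * (bern j z * (v ^ (m - j) / fact (m - j)))" if "j \<le> m" for j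
  proof -
    have e: "m + Suc n - j - 1 = n + (m - j)" "m + Suc n - 1 - j = n + (m - j)" using that by auto
    have "real ((n + (m - j)) choose n) = fact (n + (m - j)) / (fact n * fact (m - j))"
      by (subst binomial_fact) auto
    then show ?thesis unfolding e by (simp add: power_add field_simps)
  qed
  then have "bern_conv m (Suc n) (\<lambda>j. bern j z) (\<lambda>j. v ^ (j - 1) / fact (j - 1))
     = (v ^ n / fact n) * (\<Sum>j\<le>m. bern j z * (v ^ (m - j) / fact (m - j)))"
    unfolding bern_conv_def sum_distrib_left by (intro sum.cong) auto
  also have "(\<Sum>j\<le>m. bern j z * (v ^ (m - j) / fact (m - j))) = bern m (z + v)"
  proof -
    have "Abs_fps (\<lambda>n. bern n (z + v)) = Abs_fps (\<lambda>n. bern n z) * fps_exp v"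
      using bern_fps_expand[of z] bern_fps_expand[of "z + v"] by (simp add: fps_exp_add_mult mult_ac)
    then have "fps_nth (Abs_fps (\<lambda>n. bern n (z + v))) m = fps_nth (Abs_fps (\<lambda>n. bern n z) * fps_exp v) m"
      by simp
    then show ?thesis by (simp add: fps_mult_nth atLeast0AtMost)
  qed
  finally show ?thesis by (simp add: mult_ac)
qed

text \<open>Exchanging the roles turns z = u - v into v + 1 - u = 1 - z, where reflection supplies
  the signs. Moving v to v + 1 changes the product and the first convolution by the same amount,
  \<open>bern m u\<close> times v^(n-1)/(n-1)!. Hence derivatives in u alone control both
  variables.\<close>

lemma bern_defect_flip: "bern_defect m n u v = bern_defect n m (v + 1) u"
proof (cases "m = 0 \<or> n = 0")
  case False
  then obtain k l where m: "m = Suc k" and n: "n = Suc l" by (metis not0_implies_Suc)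
  let ?z = "u - v"
  have z: "v + 1 - u = 1 - ?z" by simp
  have step: "bern j (v + 1) = bern j v + (if j = 0 then 0 else v ^ (j - 1) / fact (j - 1))" for j
    using bern_add_1[of "j - 1" v] by (cases j) auto
  have "bern_conv m n (\<lambda>j. bern j ?z) (\<lambda>j. bern j (v + 1))
      = bern_conv m n (\<lambda>j. bern j ?z) (\<lambda>j. bern j v) + bern_conv m (Suc l) (\<lambda>j. bern j ?z) (\<lambda>j. v ^ (j - 1) / fact (j - 1))"
    unfolding bern_conv_def step n sum.distrib[symmetric] by (intro sum.cong) (auto simp: algebra_simps)
  also have "\<dots> = bern_conv m n (\<lambda>j. bern j ?z) (\<lambda>j. bern j v) + bern m u * (v ^ l / fact l)"
    unfolding bern_conv_powers by simp
  finally have 1: "bern_conv m n (\<lambda>j. bern j ?z) (\<lambda>j. bern j (v + 1)) =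
     bern_conv m n (\<lambda>j. bern j ?z) (\<lambda>j. bern j v) + bern m u * (v ^ l / fact l)" .
  have 2: "(-1) ^ j * ((-1) ^ j * x) = x" for j and x :: real
    by (simp add: mult.assoc[symmetric] power_mult_distrib[symmetric])
  have 3: "(-1) ^ k * ((-1) ^ (n + m) * x) = (-1) ^ l * x" for x :: real
    unfolding m n by (simp add: power_add mult_ac 2)
  show ?thesis
    using False step[of n] unfolding bern_defect_def z bern_reflect 2 1
    by (simp add: m n algebra_simps) (simp add: power_add mult_ac 2)
qed (auto simp: bern_defect_def)

text \<open>Induction on m + n. By the derivative rule and the flip, the defect at the current
  weight is a constant \<open>e m n\<close>, and one weight higher it is linear in u with slope such
  a constant. Comparing values at that higher weight determines the constants.\<close>

lemma bern_defect_zero: "bern_defect m n u v = 0"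
proof -
  define P where "P = (\<lambda>N. \<forall>m n u v. m + n = N \<longrightarrow> bern_defect m n u v = 0)"
  have "P N" for N
  proof (induction N)
    case (Suc N)
    define e where "e = (\<lambda>m n. bern_defect m n 0 0)"
    have c1: "bern_defect m n u v = bern_defect m n u' v" if "m + n = Suc N" for m n u u' v
    proof (cases m)
      case m: (Suc k)
      then have "bern_defect k n x v = 0" for x using Suc.IH that by (simp add: P_def)
      then have "((\<lambda>u. bern_defect (Suc k) n u v) has_real_derivative 0) (at x)" for x
        using bern_defect_deriv[of k n v x] by simp
      then show ?thesis unfolding m by (rule zero_deriv_imp_const)
    qed (simp add: bern_defect_def)
    have const: "bern_defect m n u v = e m n" if "m + n = Suc N" for m n u v
    proof -
      have "bern_defect m n u v = bern_defect m n 0 v" by (rule c1[OF that])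
      also have "\<dots> = bern_defect n m (v + 1) 0" by (rule bern_defect_flip)
      also have "\<dots> = bern_defect n m (0 + 1) 0" using that by (intro c1) simp
      also have "\<dots> = e m n" unfolding e_def by (rule bern_defect_flip[symmetric])
      finally show ?thesis .
    qed
    have sym: "e n m = e m n" if "m + n = Suc N" for m n
      using const[of n m 1 0] that bern_defect_flip[of m n 0 0] by (simp add: e_def)
    have lin: "bern_defect (Suc k) n (u + 1) v = bern_defect (Suc k) n u v + e k n" if "k + n = Suc N" for k n u v
    proof -
      let ?f = "\<lambda>u. bern_defect (Suc k) n u v - e k n * u"
      have "?f (u + 1) = ?f u"
        by (rule zero_deriv_imp_const)
           (use const[OF that] bern_defect_deriv[of k n v] in \<open>auto intro!: derivative_eq_intros\<close>)
      then show ?thesis by (simp add: algebra_simps)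
    qed
    \<comment> \<open>Two flips move (u, v) to (u + 1, v + 1), so the defect agrees at (0, 0) and
      (1, 1). Going back one variable at a time adds the two slopes, whose sum must therefore
      vanish. Starting from \<open>e 0 (Suc N) = 0\<close>, this kills all constants.\<close>
    have cancel: "e k (Suc l) + e (Suc k) l = 0" if "k + l = N" for k l
    proof -
      let ?D = "bern_defect (Suc k) (Suc l)"
      have "?D 0 0 = ?D 1 1" using bern_defect_flip[of "Suc k" "Suc l" 0 0] bern_defect_flip[of "Suc l" "Suc k" 1 0]
        by simp
      also have "\<dots> = ?D 0 1 + e k (Suc l)" using lin[of k "Suc l" 0 1] that by simp
      also have "?D 0 1 = bern_defect (Suc l) (Suc k) 1 0 + e l (Suc k)"
        using lin[of l "Suc k" 1 0] that bern_defect_flip[of "Suc k" "Suc l" 0 1] by simp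
      also have "bern_defect (Suc l) (Suc k) 1 0 = ?D 0 0"
        using bern_defect_flip[of "Suc k" "Suc l" 0 0] by simp
      finally show ?thesis using sym[of "Suc k" l] that by simp
    qed
    have rec: "e (Suc k) n = 0" if "k + n = N" for k n
      using that
    proof (induction k arbitrary: n)
      case 0
      then show ?case using cancel[of 0 n] by (simp add: e_def bern_defect_def)
    next
      case (Suc k)
      then show ?case using cancel[of "Suc k" n] Suc.IH[of "Suc n"] by simp
    qed
    show ?case unfolding P_def
    proof safe
      fix m n u v assume mn: "m + n = Suc N"
      show "bern_defect m n u v = 0"
      proof (cases m)
        case (Suc k) then show ?thesis using const[OF mn] rec[of k n] mn by simp
      qed (simp add: bern_defect_def)
    qed
  qed (simp add: P_def bern_defect_def)
  then show ?thesis by (simp add: P_def)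
qed

lemma bern_product:
  assumes "m > 0" "n > 0"
  shows "bern m u * bern n v = bern_conv m n (\<lambda>j. bern j (u - v)) (\<lambda>j. bern j v)
     + bern_conv n m (\<lambda>j. (-1) ^ j * bern j (u - v)) (\<lambda>j. bern j u)
     + (-1) ^ (n - 1) * bern (m + n) (u - v)"
  using bern_defect_zero[of m n u v] assms by (simp add: bern_defect_def)

section \<open>Passage from polynomials to periodic functions\<close>

text \<open>The index m + n - j equals 1 only for j = m and n = 1, where the binomial is 1. Thus a
  change of \<open>bern 1\<close> at its jump affects a single term.\<close>

lemma bern_conv_perturb:
  assumes "n > 0"
  shows "bern_conv m n f (\<lambda>j. g j + (if j = 1 then c else 0)) = bern_conv m n f g + (if n = 1 then c * f m else 0)"
proof -
  have "bern_conv m n f (\<lambda>j. g j + (if j = 1 then c else 0)) = bern_conv m n f g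
     + (\<Sum>j\<le>m. if j = m then (if n = 1 then c * f m else 0) else 0)"
    unfolding bern_conv_def sum.distrib[symmetric] using assms
    by (intro sum.cong) (auto simp: algebra_simps)
  then show ?thesis by simp
qed

lemma bern_conv_average:
  "bern_conv m n f h / 2 + bern_conv m n g h / 2 = bern_conv m n (\<lambda>j. (f j + g j) / 2) h"
  unfolding bern_conv_def sum_divide_distrib sum.distrib[symmetric]
  by (intro sum.cong) (auto simp: field_simps)

lemma bernf_unit:
  assumes "0 \<le> x" "x < 1"
  shows "bernf j x = bern j x + (if j = 1 then (if x = 0 then 1/2 else 0) else 0)"
proof (cases "x = 0")
  case True
  then show ?thesis using bern_1[of 0] by (simp add: bernf_int)
qed (use assms in \<open>simp add: bernf_eq_bern\<close>)

text \<open>On the diagonal the products of jumps are averaged from the two sides, which costs the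
  constant \<open>1/4\<close> when both factors jump.\<close>

lemma bernf_product:
  assumes "m > 0" "n > 0"
  shows "bernf m u * bernf n v = bern_conv m n (\<lambda>j. bernf j (u - v)) (\<lambda>j. bernf j v)
     + bern_conv n m (\<lambda>j. bernf j (v - u)) (\<lambda>j. bernf j u)
     + (-1) ^ (n - 1) * bernf (m + n) (u - v)
     - (if m = 1 \<and> n = 1 \<and> u \<in> \<int> \<and> v \<in> \<int> then 1/4 else 0)" (is "?T m n u v")
proof -
  have gt: "?T m n u v" if mn: "m > 0" "n > 0" and uv: "0 \<le> v" "v < u" "u < 1" for m n u v
  proof -
    let ?d = "if v = 0 then 1/2 else 0 :: real"
    have z: "bernf j (u - v) = bern j (u - v)" for j
      by (rule bernf_eq_bern) (use uv in auto)
    have z': "bernf j (v - u) = (-1) ^ j * bern j (u - v)" for j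
      using bernf_minus[of j "u - v"] z[of j] by simp
    have u: "bernf j u = bern j u" for j by (rule bernf_eq_bern) (use uv in auto)
    have v: "bernf j v = bern j v + (if j = 1 then ?d else 0)" for j
      by (rule bernf_unit) (use uv in auto)
    have "u \<notin> \<int>" using uv frac_eq[of u] frac_eq_0_iff[of u] by auto
    then have q: "(if m = 1 \<and> n = 1 \<and> u \<in> \<int> \<and> v \<in> \<int> then 1/4 else 0 :: real) = 0" by simp
    \<comment> \<open>The half jump of the second factor meets \<open>bern m u\<close> in the
      product and \<open>bern m (u - v)\<close> in the convolution. It is nonzero only at v = 0,
      where these agree.\<close>
    have "n = 1 \<Longrightarrow> ?d * bern m u = ?d * bern m (u - v)" by simp
    then show ?thesis unfolding z z' u v q bern_conv_perturb[OF mn(2)]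
      using bern_product[OF mn, of u v] by (simp add: algebra_simps)
  qed
  have flip: "?T n m v u \<Longrightarrow> ?T m n u v" if mn: "m > 0" "n > 0" for m n u v
  proof -
    have "(-1) ^ (m - 1) * bernf (n + m) (v - u) = (-1) ^ (n - 1) * bernf (m + n) (u - v)"
      using bernf_minus[of "m + n" "u - v"] mn by (cases m; cases n) (auto simp: power_add add_ac minus_one_power_iff)
    then show "?T n m v u \<Longrightarrow> ?T m n u v" by (simp add: mult.commute conj_commute conj_left_commute algebra_simps)
  qed
  have eq: "?T m n x x" if mn: "m > 0" "n > 0" and x: "0 \<le> x" "x < 1" for m n x
  proof -
    let ?d = "if x = 0 then 1/2 else 0 :: real"
    let ?g = "\<lambda>j. if j = 1 then 0 else bern j 0"
    have v: "bernf j x = bern j x + (if j = 1 then ?d else 0)" for j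
      by (rule bernf_unit) (use x in auto)
    have g0: "bernf j 0 = ?g j" for j by (simp add: bernf_int)
    \<comment> \<open>Averaging with the reflected sign removes exactly the value at index 1, which
      turns \<open>bern j 0\<close> into \<open>bernf j 0\<close>.\<close>
    have g: "(bern j 0 + (-1) ^ j * bern j 0) / 2 = ?g j" for j
      using bern_1[of 0] bern_odd_0[of j] by (cases "even j") auto
    have g': "((-1) ^ j * bern j 0 + bern j 0) / 2 = ?g j" for j
      using g[of j] by (simp add: add.commute)
    have mx: "(-1) ^ (n - 1) * bern (m + n) 0 / 2 + (-1) ^ (m - 1) * bern (n + m) 0 / 2 = (-1) ^ (n - 1) * bern (m + n) 0"
    proof (cases "odd (m + n)")
      case True
      moreover have "m + n \<noteq> 1" using mn by auto
      ultimately show ?thesis using bern_odd_0[of "m + n"] by (simp add: add.commute)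
    next
      case False
      then have "(-1::real) ^ (m - 1) = (-1) ^ (n - 1)" using mn by (auto simp: minus_one_power_iff)
      then show ?thesis by (simp add: add.commute)
    qed
    have "bern m x * bern n x = (bern m x * bern n x) / 2 + (bern n x * bern m x) / 2" by simp
    also have "\<dots> = bern_conv m n (\<lambda>j. bern j 0) (\<lambda>j. bern j x) / 2 + bern_conv m n (\<lambda>j. (-1) ^ j * bern j 0) (\<lambda>j. bern j x) / 2
      + (bern_conv n m (\<lambda>j. (-1) ^ j * bern j 0) (\<lambda>j. bern j x) / 2 + bern_conv n m (\<lambda>j. bern j 0) (\<lambda>j. bern j x) / 2)
      + ((-1) ^ (n - 1) * bern (m + n) 0 / 2 + (-1) ^ (m - 1) * bern (n + m) 0 / 2)"
      using bern_product[OF mn, of x x] bern_product[OF mn(2,1), of x x] by (simp add: add_divide_distrib)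
    also have "\<dots> = bern_conv m n ?g (\<lambda>j. bern j x) + bern_conv n m ?g (\<lambda>j. bern j x) + (-1) ^ (n - 1) * bern (m + n) 0"
      unfolding bern_conv_average mx g g' ..
    finally have main: "bern m x * bern n x = \<dots>" .
    have int: "x \<in> \<int> \<longleftrightarrow> x = 0" using x frac_eq[of x] frac_eq_0_iff[of x] by auto
    have mn1: "m + n \<noteq> 1" using mn by auto
    \<comment> \<open>A single half jump reproduces the perturbation of the convolution. When both
      factors jump at x = 0, the left side is 0 while the polynomial product is 1/4, hence the
      correction.\<close>
    have "(bern m x + (if m = 1 then ?d else 0)) * (bern n x + (if n = 1 then ?d else 0)) =
      bern m x * bern n x + (if n = 1 then ?d * ?g m else 0) + (if m = 1 then ?d * ?g n else 0)
      - (if m = 1 \<and> n = 1 \<and> x \<in> \<int> \<and> x \<in> \<int> then 1/4 else 0)"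
      using bern_1[of 0] by (auto simp: algebra_simps int)
    then show ?thesis using mn1
      unfolding v diff_self g0 bern_conv_perturb[OF mn(1)] bern_conv_perturb[OF mn(2)] main
      by simp
  qed
  let ?u = "frac u" and ?v = "frac v"
  have T: "?T m n ?u ?v"
  proof (cases "?u" "?v" rule: linorder_cases)
    case less
    have "?T n m ?v ?u" by (rule gt) (use assms less in \<open>auto simp: frac_lt_1\<close>)
    then show ?thesis by (rule flip[OF assms])
  next
    case equal
    show ?thesis unfolding equal by (rule eq) (use assms in \<open>auto simp: frac_lt_1\<close>)
  next
    case greater
    then show ?thesis by (intro gt) (use assms in \<open>auto simp: frac_lt_1\<close>)
  qed
  have "bernf j (?u - ?v) = bernf j (u - v)" "bernf j (?v - ?u) = bernf j (v - u)" for j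
    by (auto intro!: bernf_cong simp: frac_def)
  moreover have "?u \<in> \<int> \<longleftrightarrow> u \<in> \<int>" "?v \<in> \<int> \<longleftrightarrow> v \<in> \<int>"
    by (metis Ints_0 frac_eq_0_iff frac_frac)+
  ultimately show ?thesis using T by simp
qed

section \<open>Reciprocity for generalized Dedekind sums\<close>

text \<open>The power of d is the one for which the multiplication theorem, applied to the sum over
  w, leaves just \<open>d ^ j\<close> beside index m + n - j.\<close>

definition dedekind_sum :: "nat \<Rightarrow> nat \<Rightarrow> nat \<Rightarrow> nat \<Rightarrow> nat \<Rightarrow> real" where
  "dedekind_sum m n d a b =
     real d ^ (m + n - 1) * (\<Sum>w<d. bernf m (real (a * w) / d) * bernf n (real (b * w) / d))"

text \<open>The share of a single divisor d in \<open>bernoulli_R m n q a b\<close>, without its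
  Moebius weight and without the factor m! n!.\<close>

definition recip_term :: "nat \<Rightarrow> nat \<Rightarrow> nat \<Rightarrow> nat \<Rightarrow> nat \<Rightarrow> real" where
  "recip_term m n d a b = real b ^ (n - 1) *
     (\<Sum>j\<le>m. real ((m + n - 1 - j) choose (n - 1)) * ((-1) ^ j * real a ^ (m - j)) *
        (\<Sum>l=1..b. bernf j (real (a * l) / b) * (real d ^ j * bernf (m + n - j) (real (d * l) / b))))"

lemma bernf_mult_diff:
  assumes "N > 0"
  shows "real N ^ n * (\<Sum>k<N. bernf n (x - real k / N)) = real N * bernf n (N * x)"
proof -
  have "(\<Sum>k<N. bernf n (x - real k / N)) = (-1) ^ n * (\<Sum>k<N. bernf n (- x + real k / N))"
    unfolding sum_distrib_left
  proof (rule sum.cong[OF refl])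
    fix k
    show "bernf n (x - real k / N) = (-1) ^ n * bernf n (- x + real k / N)"
      using bernf_minus[of n "- x + real k / N"] by simp
  qed
  then have "real N ^ n * (\<Sum>k<N. bernf n (x - real k / N)) = (-1) ^ n * (real N * bernf n (N * (- x)))"
    using bernf_mult[OF assms, of n "- x"] by (simp add: mult_ac)
  also have "bernf n (N * (- x)) = (-1) ^ n * bernf n (N * x)"
    using bernf_minus[of n "N * x"] by simp
  finally show ?thesis by (simp add: power_mult_distrib[symmetric] mult.assoc[symmetric])
qed

text \<open>The prefactor is the same for every j \<le> m, so it can stand outside a sum over j; the
  surplus power \<open>N ^ (m - j)\<close> is the one that appears in
  \<open>recip_term\<close>.\<close>

lemma bernf_mult_diff':
  assumes "N > 0" "j \<le> m" "m > 0"
  shows "real N ^ (m - 1) * (\<Sum>k<N. bernf j (x - real k / N)) = real N ^ (m - j) * bernf j (N * x)"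
proof -
  have "real N ^ j * real N ^ (m - j) = real N * real N ^ (m - 1)"
    using assms by (simp add: power_add[symmetric] power_Suc[symmetric] del: power_Suc)
  then have "real N * (real N ^ (m - 1) * (\<Sum>k<N. bernf j (x - real k / N)))
      = real N ^ (m - j) * (real N ^ j * (\<Sum>k<N. bernf j (x - real k / N)))"
    by (simp only: mult.assoc[symmetric] \<open>real N ^ j * real N ^ (m - j) = _\<close>[symmetric])
       (simp only: mult_ac)
  also have "\<dots> = real N * (real N ^ (m - j) * bernf j (N * x))"
    unfolding bernf_mult_diff[OF assms(1)] by simp
  finally have "real N * (real N ^ (m - 1) * (\<Sum>k<N. bernf j (x - real k / N)))
      = real N * (real N ^ (m - j) * bernf j (N * x))" .
  then show ?thesis using assms(1) by simp
qed

lemma bernf_mult_add':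
  assumes "N > 0" "j \<le> m" "m > 0"
  shows "real N ^ (m - 1) * (\<Sum>k<N. bernf j (real k / N - x)) = real N ^ (m - j) * bernf j (- (N * x))"
proof -
  have "(\<Sum>k<N. bernf j (real k / N - x)) = (-1) ^ j * (\<Sum>k<N. bernf j (x - real k / N))"
    unfolding sum_distrib_left
    by (rule sum.cong[OF refl], subst bernf_minus[symmetric]) simp
  then show ?thesis using bernf_mult_diff'[OF assms, of x] by (simp add: bernf_minus mult_ac)
qed

lemma bernf_frac_periodic:
  assumes "N > 0"
  shows "bernf n (real_of_int (c * (x + int N)) / N) = bernf n (real_of_int (c * x) / N)"
proof -
  have "real_of_int (c * (x + int N)) / N = real_of_int (c * x) / N + of_int c"
    using assms by (simp add: field_simps)
  then show ?thesis by simp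
qed

text \<open>The substitution l -> -l moves the minus sign to the first factor, where parity gives
  \<open>(-1) ^ i\<close>; periodicity then shifts the range from 0..b-1 to 1..b.\<close>

lemma bernf_sum_reflect:
  assumes "b > 0"
  shows "(\<Sum>l<b. bernf i (real (a * l) / b) * bernf j (- (real (d * l) / b)))
    = (-1) ^ i * (\<Sum>l=1..b. bernf i (real (a * l) / b) * bernf j (real (d * l) / b))"
proof -
  let ?f = "\<lambda>x::int. bernf i (real_of_int (int a * x) / b) * bernf j (real_of_int (- int d * x) / b)"
  let ?g = "\<lambda>x::int. bernf i (real_of_int (int a * x) / b) * bernf j (real_of_int (int d * x) / b)"
  have pf: "?f (x + int b) = ?f x" and pg: "?g (x + int b) = ?g x" for x
    using assms by (simp_all only: bernf_frac_periodic)
  have "(\<Sum>l<b. bernf i (real (a * l) / b) * bernf j (- (real (d * l) / b))) = (\<Sum>l<b. ?f (int l))"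
    by simp
  also have "\<dots> = (\<Sum>l<b. ?f (0 + (-1) * int l))"
    by (rule sum_periodic_affine[symmetric, where f = ?f and N = b]) (use pf in auto)
  also have "\<dots> = (\<Sum>l<b. (-1) ^ i * ?g (int l))"
    by (rule sum.cong) (auto simp: bernf_minus)
  also have "\<dots> = (-1) ^ i * (\<Sum>l<b. ?g (0 + int l))" by (simp add: sum_distrib_left)
  also have "(\<Sum>l<b. ?g (0 + int l)) = (\<Sum>l<b. ?g (0 + 1 + int l))"
    by (rule sum_periodic_shift_one[symmetric, where f = ?g and N = b, OF pg])
  also have "\<dots> = (\<Sum>l<b. ?g (int (Suc l)))" by (simp add: add_ac)
  also have "\<dots> = (\<Sum>l=1..b. ?g (int l))"
    by (rule sum.reindex_bij_witness[of _ "\<lambda>l. l - 1" Suc]) auto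
  finally show ?thesis by simp
qed

text \<open>In each term of the convolution k occurs only in the first factor and w only in the
  second. Both sums collapse by the multiplication theorem, and only the sum over l
  survives.\<close>

lemma sum_bern_conv_recip_term:
  assumes "m > 0" "n > 0" "a > 0" "b > 0" "d > 0"
  shows "real d ^ (m + n - 1) * (real a ^ (m - 1) * real b ^ (n - 1)) *
     (\<Sum>w<d. \<Sum>k<a. \<Sum>l<b. bern_conv m n (\<lambda>j. bernf j (real l / b - real k / a)) (\<lambda>j. bernf j (real w / d - real l / b)))
     = recip_term m n d a b"
proof -
  let ?C = "\<lambda>j. real ((m + n - 1 - j) choose (n - 1))"
  let ?A = "\<lambda>j l. \<Sum>k<a. bernf j (real l / b - real k / a)"
  let ?B = "\<lambda>j l. \<Sum>w<d. bernf j (real w / d - real l / b)"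
  have factor: "x * (y * z) * (\<Sum>j\<le>m. ?C j * (\<Sum>l<b. A j l * B (m + n - j) l))
      = z * (\<Sum>j\<le>m. ?C j * (\<Sum>l<b. (y * A j l) * (x * B (m + n - j) l)))" for x y z :: real and A B
    by (simp add: sum_distrib_left mult_ac)
  have "(\<Sum>w<d. \<Sum>k<a. \<Sum>l<b. bern_conv m n (\<lambda>j. bernf j (real l / b - real k / a)) (\<lambda>j. bernf j (real w / d - real l / b)))
    = (\<Sum>w<d. \<Sum>k<a. \<Sum>l<b. \<Sum>j\<le>m. ?C j * bernf j (real l / b - real k / a) * bernf (m + n - j) (real w / d - real l / b))"
    by (simp add: bern_conv_def)
  also have "\<dots> = (\<Sum>w<d. \<Sum>k<a. \<Sum>j\<le>m. \<Sum>l<b. ?C j * bernf j (real l / b - real k / a) * bernf (m + n - j) (real w / d - real l / b))"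
    by (intro sum.cong[OF refl]) (rule sum.swap)
  also have "\<dots> = (\<Sum>w<d. \<Sum>j\<le>m. \<Sum>k<a. \<Sum>l<b. ?C j * bernf j (real l / b - real k / a) * bernf (m + n - j) (real w / d - real l / b))"
    by (intro sum.cong[OF refl]) (rule sum.swap)
  also have "\<dots> = (\<Sum>j\<le>m. \<Sum>w<d. \<Sum>k<a. \<Sum>l<b. ?C j * bernf j (real l / b - real k / a) * bernf (m + n - j) (real w / d - real l / b))"
    by (rule sum.swap)
  also have "\<dots> = (\<Sum>j\<le>m. \<Sum>w<d. \<Sum>l<b. \<Sum>k<a. ?C j * bernf j (real l / b - real k / a) * bernf (m + n - j) (real w / d - real l / b))"
    by (intro sum.cong[OF refl]) (rule sum.swap)
  also have "\<dots> = (\<Sum>j\<le>m. \<Sum>l<b. \<Sum>w<d. \<Sum>k<a. ?C j * bernf j (real l / b - real k / a) * bernf (m + n - j) (real w / d - real l / b))"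
    by (intro sum.cong[OF refl]) (rule sum.swap)
  also have "\<dots> = (\<Sum>j\<le>m. ?C j * (\<Sum>l<b. ?A j l * ?B (m + n - j) l))"
    by (simp add: sum_distrib_left sum_distrib_right mult_ac)
  finally have "real d ^ (m + n - 1) * (real a ^ (m - 1) * real b ^ (n - 1)) *
     (\<Sum>w<d. \<Sum>k<a. \<Sum>l<b. bern_conv m n (\<lambda>j. bernf j (real l / b - real k / a)) (\<lambda>j. bernf j (real w / d - real l / b)))
    = real b ^ (n - 1) * (\<Sum>j\<le>m. ?C j * (\<Sum>l<b. (real a ^ (m - 1) * ?A j l) * (real d ^ (m + n - 1) * ?B (m + n - j) l)))"
    by (simp only: factor[where A = ?A and B = ?B])
  also have "\<dots> = recip_term m n d a b"
    unfolding recip_term_def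
  proof (rule arg_cong[where f = "\<lambda>x. real b ^ (n - 1) * x"], rule sum.cong[OF refl])
    fix j assume j: "j \<in> {..m}"
    have "(\<Sum>l<b. (real a ^ (m - 1) * ?A j l) * (real d ^ (m + n - 1) * ?B (m + n - j) l))
      = (\<Sum>l<b. (real a ^ (m - j) * bernf j (a * (real l / b))) * (real d ^ (m + n - (m + n - j)) * bernf (m + n - j) (- (d * (real l / b)))))"
      using assms j by (intro sum.cong[OF refl] arg_cong2[where f = "(*)"] bernf_mult_diff' bernf_mult_add') auto
    also have "\<dots> = real a ^ (m - j) * real d ^ j * (\<Sum>l<b. bernf j (real (a * l) / b) * bernf (m + n - j) (- (real (d * l) / b)))"
      using j by (simp add: sum_distrib_left mult_ac)
    also have "\<dots> = (-1) ^ j * real a ^ (m - j) * (\<Sum>l=1..b. bernf j (real (a * l) / b) * (real d ^ j * bernf (m + n - j) (real (d * l) / b)))"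
      unfolding bernf_sum_reflect[OF assms(4)] by (simp add: sum_distrib_left mult_ac)
    finally show "?C j * (\<Sum>l<b. (real a ^ (m - 1) * ?A j l) * (real d ^ (m + n - 1) * ?B (m + n - j) l))
      = ?C j * ((-1) ^ j * real a ^ (m - j)) * (\<Sum>l=1..b. bernf j (real (a * l) / b) * (real d ^ j * bernf (m + n - j) (real (d * l) / b)))"
      by simp
  qed
  finally show ?thesis .
qed

lemma sum_periodic_mult:
  fixes f :: "int \<Rightarrow> 'a::comm_semiring_1"
  assumes "\<And>x. f (x + int N) = f x"
  shows "(\<Sum>k<g * N. f (int k)) = of_nat g * (\<Sum>k<N. f (int k))"
proof -
  have "(\<Sum>k<g * N. f (int k)) = (\<Sum>i<g. \<Sum>k\<in>{i * N..<i * N + N}. f (int k))"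
    by (rule sum.nat_group[symmetric])
  also have "\<dots> = (\<Sum>i<g. \<Sum>k<N. f (int k))"
  proof (rule sum.cong[OF refl])
    fix i
    have "(\<Sum>k\<in>{i * N..<i * N + N}. f (int k)) = (\<Sum>k<N. f (int k + int N * int i))"
      by (rule sum.reindex_bij_witness[of _ "\<lambda>k. k + i * N" "\<lambda>k. k - i * N"]) (auto simp: of_nat_diff mult_ac)
    then show "(\<Sum>k\<in>{i * N..<i * N + N}. f (int k)) = (\<Sum>k<N. f (int k))"
      by (simp add: periodic_mult[of f N, OF assms])
  qed
  finally show ?thesis by simp
qed

text \<open>With g = gcd a b, the points a l/b run g times through the multiples of g/b modulo 1,
  and the multiplication theorem sums one such run.\<close>

lemma sum_bernf_multiples:
  assumes "a > 0" "b > 0"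
  shows "real b ^ n * (\<Sum>l<b. bernf n (real a * (real l / b))) = real (gcd a b) ^ n * real b * bernf n 0"
proof -
  define g where "g = gcd a b"
  define a' where "a' = a div g"
  define b' where "b' = b div g"
  have g: "g > 0" using assms by (simp add: g_def)
  have ab: "a = g * a'" "b = g * b'" by (simp_all add: a'_def b'_def g_def)
  have b': "b' > 0" using ab assms by (cases b') auto
  have cop: "coprime (int a') (int b')"
    using assms unfolding a'_def b'_def g_def coprime_int_iff by (intro div_gcd_coprime) auto
  let ?f = "\<lambda>x::int. bernf n (real_of_int (1 * x) / b')"
  let ?h = "\<lambda>x::int. bernf n (real_of_int (int a' * x) / b')"
  have "(\<Sum>l<b. bernf n (real a * (real l / b))) = (\<Sum>l<g * b'. ?h (int l))"
    using g unfolding ab by (intro sum.cong) auto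
  also have "\<dots> = real g * (\<Sum>l<b'. ?h (int l))"
    using b' by (intro sum_periodic_mult bernf_frac_periodic)
  also have "(\<Sum>l<b'. ?h (int l)) = (\<Sum>l<b'. ?f (0 + int a' * int l))" by simp
  also have "\<dots> = (\<Sum>l<b'. ?f (int l))"
    using b' cop by (intro sum_periodic_affine bernf_frac_periodic)
  finally have "real b ^ n * (\<Sum>l<b. bernf n (real a * (real l / b)))
     = real g ^ n * real g * (real b' ^ n * (\<Sum>l<b'. bernf n (0 + real l / b')))"
    by (simp add: ab power_mult_distrib mult_ac)
  also have "\<dots> = real g ^ n * real b * bernf n 0"
    unfolding bernf_mult[OF b'] by (simp add: ab mult_ac)
  finally show ?thesis by (simp add: g_def)
qed

text \<open>If w/d - k/a is an integer then d divides a w, hence w by coprimality; so w = 0, and the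
  ranges force k = l = 0. A single triple contributes.\<close>

lemma sum_common_integers:
  assumes "a > 0" "b > 0" "d > 0" "coprime a d"
  shows "(\<Sum>w<d. \<Sum>k<a. \<Sum>l<b. if real w / d - real k / a \<in> \<int> \<and> real w / d - real l / b \<in> \<int> then c else 0) = (c::real)"
proof -
  have red: "r = 0" if "real r / real N \<in> \<int>" "r < N" for r N
  proof -
    have "0 \<le> real r / N" "real r / N < 1" using that(2) by auto
    then have "frac (real r / N) = real r / N" by (simp add: frac_eq)
    then show ?thesis using that frac_eq_0_iff[of "real r / N"] by auto
  qed
  have iff: "real w / d - real k / a \<in> \<int> \<and> real w / d - real l / b \<in> \<int> \<longleftrightarrow> w = 0 \<and> k = 0 \<and> l = 0"
    if "w < d" "k < a" "l < b" for w k l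
  proof
    assume asm: "real w / d - real k / a \<in> \<int> \<and> real w / d - real l / b \<in> \<int>"
    then obtain i where "real w / d - real k / a = of_int i" by (auto elim: Ints_cases)
    then have "real (a * w) = real_of_int (int d * (a * i + k))" using assms by (simp add: field_simps)
    then have "int (a * w) = int d * (a * i + k)" by (metis of_int_eq_iff of_int_of_nat_eq)
    then have "d dvd a * w" by (metis dvd_triv_left int_dvd_int_iff)
    then have "d dvd w" using assms by (metis coprime_commute coprime_dvd_mult_right_iff)
    then have w: "w = 0" using that by (auto dest: dvd_imp_le)
    then have "real k / a \<in> \<int>" "real l / b \<in> \<int>" using asm minus_in_Ints_iff[of "real k / a"] minus_in_Ints_iff[of "real l / b"] by auto
    then show "w = 0 \<and> k = 0 \<and> l = 0" using w red that by blast
  qed auto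
  have "(\<Sum>w<d. \<Sum>k<a. \<Sum>l<b. if real w / d - real k / a \<in> \<int> \<and> real w / d - real l / b \<in> \<int> then c else 0)
     = (\<Sum>w<d. \<Sum>k<a. \<Sum>l<b. if l = 0 then (if k = 0 then (if w = 0 then c else 0) else 0) else 0)"
    by (intro sum.cong refl) (auto simp: iff)
  also have "\<dots> = c" using assms by (simp add: sum.delta)
  finally show ?thesis .
qed

theorem dedekind_reciprocity:
  assumes "m > 0" "n > 0" "a > 0" "b > 0" "d > 0" "coprime a d"
  shows "dedekind_sum m n d a b = recip_term m n d a b + recip_term n m d b a
    + (-1) ^ (n - 1) * real (gcd a b) ^ (m + n) * bern (m + n) 0 * real d ^ (m + n) / (real a ^ n * real b ^ m)
    - (if m = 1 \<and> n = 1 then real d / 4 else 0)"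
proof -
  let ?K = "real d ^ (m + n - 1) * (real a ^ (m - 1) * real b ^ (n - 1))"
  let ?u = "\<lambda>w k. real w / d - real k / a" and ?v = "\<lambda>w l. real w / d - real l / b"
  have u: "?u w k - ?v w l = real l / b - real k / a" "?v w l - ?u w k = real k / a - real l / b" for w k l
    by auto
  have mult: "bernf i (real (c * w) / d) = real c ^ (i - 1) * (\<Sum>k<c. bernf i (real w / d - real k / c))"
    if "i > 0" "c > 0" for i c w
    using bernf_mult_diff'[of c i i "real w / d"] that by simp
  have "dedekind_sum m n d a b = ?K * (\<Sum>w<d. \<Sum>k<a. \<Sum>l<b. bernf m (?u w k) * bernf n (?v w l))"
    unfolding dedekind_sum_def mult[OF assms(1,3)] mult[OF assms(2,4)]
    by (simp add: sum_product[symmetric] sum_distrib_left mult_ac)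
  also have "\<dots> = ?K * (\<Sum>w<d. \<Sum>k<a. \<Sum>l<b. bern_conv m n (\<lambda>j. bernf j (real l / b - real k / a)) (\<lambda>j. bernf j (?v w l)))
     + ?K * (\<Sum>w<d. \<Sum>k<a. \<Sum>l<b. bern_conv n m (\<lambda>j. bernf j (real k / a - real l / b)) (\<lambda>j. bernf j (?u w k)))
     + ?K * (\<Sum>w<d. \<Sum>k<a. \<Sum>l<b. (-1) ^ (n - 1) * bernf (m + n) (real l / b - real k / a))
     - ?K * (\<Sum>w<d. \<Sum>k<a. \<Sum>l<b. if m = 1 \<and> n = 1 \<and> ?u w k \<in> \<int> \<and> ?v w l \<in> \<int> then 1/4 else 0)"
    unfolding bernf_product[OF assms(1,2)] u by (simp only: sum.distrib sum_subtractf distrib_left right_diff_distrib)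
  also have "?K * (\<Sum>w<d. \<Sum>k<a. \<Sum>l<b. bern_conv m n (\<lambda>j. bernf j (real l / b - real k / a)) (\<lambda>j. bernf j (?v w l))) = recip_term m n d a b"
    by (rule sum_bern_conv_recip_term) (use assms in auto)
  also have "?K * (\<Sum>w<d. \<Sum>k<a. \<Sum>l<b. bern_conv n m (\<lambda>j. bernf j (real k / a - real l / b)) (\<lambda>j. bernf j (?u w k)))
     = real d ^ (n + m - 1) * (real b ^ (n - 1) * real a ^ (m - 1)) *
       (\<Sum>w<d. \<Sum>l<b. \<Sum>k<a. bern_conv n m (\<lambda>j. bernf j (real k / a - real l / b)) (\<lambda>j. bernf j (?u w k)))"
    by (subst (2) sum.swap) (simp only: mult_ac add.commute)
  also have "\<dots> = recip_term n m d b a"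
    by (rule sum_bern_conv_recip_term) (use assms in auto)
  \<comment> \<open>The summand is free of w, which supplies the last factor d. Summing over k and
    then over l produces the gcd, and the powers of a and b not absorbed by the prefactor are
    \<open>a ^ n * b ^ m\<close>.\<close>
  also have "?K * (\<Sum>w<d. \<Sum>k<a. \<Sum>l<b. (-1) ^ (n - 1) * bernf (m + n) (real l / b - real k / a))
     = (-1) ^ (n - 1) * real (gcd a b) ^ (m + n) * bern (m + n) 0 * real d ^ (m + n) / (real a ^ n * real b ^ m)"
  proof -
    let ?N = "m + n"
    let ?S = "\<Sum>k<a. \<Sum>l<b. bernf ?N (real l / b - real k / a)"
    let ?U = "\<Sum>l<b. bernf ?N (real a * (real l / b))"
    have "real a ^ ?N * ?S = (\<Sum>l<b. real a ^ ?N * (\<Sum>k<a. bernf ?N (real l / b - real k / a)))"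
      by (subst sum.swap) (simp only: sum_distrib_left)
    also have "\<dots> = (\<Sum>l<b. real a * bernf ?N (real a * (real l / b)))"
      by (simp only: bernf_mult_diff[OF assms(3)])
    also have "\<dots> = real a * ?U" by (rule sum_distrib_left[symmetric])
    finally have "real a ^ ?N * ?S = real a * ?U" .
    then have "real b ^ ?N * (real a ^ ?N * ?S) = real a * (real b ^ ?N * ?U)" by simp
    also have "\<dots> = real a * real b * (real (gcd a b) ^ ?N * bern ?N 0)"
      unfolding sum_bernf_multiples[OF assms(3,4)] using assms by (simp add: bernf_int)
    finally have "real b ^ ?N * (real a ^ ?N * ?S) = real a * real b * (real (gcd a b) ^ ?N * bern ?N 0)" .
    moreover have "real b ^ ?N = real b * real b ^ m * real b ^ (n - 1)" "real a ^ ?N = real a * real a ^ n * real a ^ (m - 1)"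
      using assms by (simp_all add: power_add[symmetric] power_Suc[symmetric] add.commute del: power_Suc)
    ultimately have "real a * real b * ((real a ^ n * real b ^ m) * (real a ^ (m - 1) * real b ^ (n - 1) * ?S))
      = real a * real b * (real (gcd a b) ^ ?N * bern ?N 0)" by (simp add: mult_ac)
    then have "(real a ^ n * real b ^ m) * (real a ^ (m - 1) * real b ^ (n - 1) * ?S) = real (gcd a b) ^ ?N * bern ?N 0"
      using assms by simp
    then have S: "real a ^ (m - 1) * real b ^ (n - 1) * ?S = real (gcd a b) ^ ?N * bern ?N 0 / (real a ^ n * real b ^ m)"
      using assms by (simp add: eq_divide_eq mult_ac)
    have "real d ^ ?N = real d ^ (?N - 1) * real d" using assms by (metis add_gr_0 power_minus_mult)
    moreover have "?K * (\<Sum>w<d. \<Sum>k<a. \<Sum>l<b. (-1) ^ (n - 1) * bernf ?N (real l / b - real k / a))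
       = (-1) ^ (n - 1) * (real d ^ (?N - 1) * real d) * (real a ^ (m - 1) * real b ^ (n - 1) * ?S)"
      by (simp add: sum_distrib_left[symmetric] mult_ac)
    ultimately show ?thesis unfolding S by simp
  qed
  also have "?K * (\<Sum>w<d. \<Sum>k<a. \<Sum>l<b. if m = 1 \<and> n = 1 \<and> ?u w k \<in> \<int> \<and> ?v w l \<in> \<int> then 1/4 else 0)
     = (if m = 1 \<and> n = 1 then real d / 4 else 0)"
    using sum_common_integers[OF assms(3-6), of "1/4"] by auto
  finally show ?thesis .
qed

section \<open>Fourier series of the Bernoulli functions\<close>

text \<open>The two terms of frequency \<open>Suc k\<close> and \<open>- Suc k\<close> in the series
  of e^(2 pi i k x) / (2 pi i k)^m. The phase m pi/2 makes differentiation lower m without sign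
  cases.\<close>

definition fser :: "nat \<Rightarrow> nat \<Rightarrow> real \<Rightarrow> real" where
  "fser m k x = 2 * cos (2 * pi * real (Suc k) * x - real m * pi / 2) / (2 * pi * real (Suc k)) ^ m"

lemma dirichlet_kernel:
  "sin (pi * x) * (1 + (\<Sum>k<N. 2 * cos (2 * pi * real (Suc k) * x))) = sin ((2 * real N + 1) * pi * x)"
proof (induction N)
  case (Suc N)
  have "sin (pi * x) * (2 * cos (2 * pi * real (Suc N) * x))
      = sin (pi * x + 2 * pi * real (Suc N) * x) - sin (2 * pi * real (Suc N) * x - pi * x)"
    by (simp add: sin_add sin_diff)
  also have "pi * x + 2 * pi * real (Suc N) * x = (2 * real (Suc N) + 1) * pi * x" by (simp add: algebra_simps)
  also have "2 * pi * real (Suc N) * x - pi * x = (2 * real N + 1) * pi * x" by (simp add: algebra_simps)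
  finally show ?case using Suc by (simp add: distrib_left)
qed simp

lemma fser_0: "fser 0 k x = 2 * cos (2 * pi * real (Suc k) * x)"
  by (simp add: fser_def)

lemma fser_deriv: "(fser (Suc m) k has_real_derivative fser m k x) (at x)"
proof -
  let ?c = "2 * pi * real (Suc k)"
  have "?c * x - real (Suc m) * pi / 2 = (?c * x - real m * pi / 2) - pi / 2"
    by (simp add: distrib_right add_divide_distrib)
  then have e: "sin (?c * x - real (Suc m) * pi / 2) = - cos (?c * x - real m * pi / 2)"
    by (simp only: sin_diff[of _ "pi / 2"] cos_pi_half sin_pi_half mult_zero_right mult_1_right diff_0)
  have nz: "?c \<noteq> 0" by simp
  have cancel: "2 * (- (- y) * c) / c ^ Suc m = 2 * y / c ^ m" if "c \<noteq> 0" for c y :: real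
    using that by simp
  have "((\<lambda>x. 2 * cos (?c * x - real (Suc m) * pi / 2) / ?c ^ Suc m) has_real_derivative
     2 * (- sin (?c * x - real (Suc m) * pi / 2) * ?c) / ?c ^ Suc m) (at x)"
    by (intro DERIV_cdivide DERIV_cmult) (auto intro!: derivative_eq_intros)
  also have "2 * (- sin (?c * x - real (Suc m) * pi / 2) * ?c) / ?c ^ Suc m = fser m k x"
    unfolding e fser_def by (rule cancel[OF nz])
  finally show ?thesis by (simp add: fser_def[abs_def])
qed

lemma sin_pi_ge:
  assumes "0 < \<delta>" "\<delta> \<le> x" "x \<le> 1 - \<delta>"
  shows "sin (pi * \<delta>) \<le> sin (pi * x)"
proof -
  have main: "sin (pi * \<delta>) \<le> sin (pi * y)" if "\<delta> \<le> y" "y \<le> 1/2" for y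
  proof (rule sin_monotone_2pi_le)
    have "0 \<le> pi * \<delta>" using assms by simp
    then show "- (pi / 2) \<le> pi * \<delta>" using pi_ge_zero by linarith
    show "pi * \<delta> \<le> pi * y" using that by (intro mult_left_mono) auto
    show "pi * y \<le> pi / 2" using mult_left_mono[of y "1/2" pi] that by simp
  qed
  show ?thesis
  proof (cases "x \<le> 1/2")
    case True
    then show ?thesis using main[of x] assms by blast
  next
    case False
    have "pi * (1 - x) = pi - pi * x" by (simp add: right_diff_distrib)
    then have "sin (pi * (1 - x)) = sin (pi * x)" by (simp only: sin_pi_minus)
    moreover have "\<delta> \<le> 1 - x" "1 - x \<le> 1/2" using assms False by auto
    ultimately show ?thesis using main[of "1 - x"] by simp
  qed
qed

text \<open>The derivative of the error R is the Dirichlet kernel sin(M pi y)/sin(pi y) with M = 2N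
  + 1. One integration by parts suggests \<open>h\<close>, for which R + h has derivative of size
  1/M. Since R and h vanish at 1/2, R + h gives the first constant, and the size of h the
  second.\<close>

lemma fser_1_partial_sum_bound:
  assumes "0 < \<delta>" "\<delta> \<le> x" "x \<le> 1 - \<delta>"
  shows "\<bar>(\<Sum>k<N. fser 1 k x) + bern 1 x\<bar> \<le> (1 / sin (pi * \<delta>) ^ 2 + 1 / (pi * sin (pi * \<delta>))) / (2 * real N + 1)"
proof -
  define M where "M = 2 * real N + 1"
  define s where "s = sin (pi * \<delta>)"
  define R where "R = (\<lambda>x. (\<Sum>k<N. fser 1 k x) + bern 1 x)"
  define h where "h = (\<lambda>x. cos (M * pi * x) / (M * pi * sin (pi * x)))"
  have M: "M > 0" by (simp add: M_def)
  have s: "s > 0" unfolding s_def using assms by (intro sin_gt_zero) auto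
  have ge: "s \<le> sin (pi * y)" if "y \<in> {\<delta>..1 - \<delta>}" for y
    using sin_pi_ge[of \<delta> y] that assms by (simp add: s_def)
  have derivR: "(R has_real_derivative sin (M * pi * y) / sin (pi * y)) (at y within A)" if y: "y \<in> {\<delta>..1 - \<delta>}" for y A
  proof -
    have "sin (pi * y) > 0" using ge[OF y] s by linarith
    then have "(\<Sum>k<N. fser 0 k y) + 1 = sin (M * pi * y) / sin (pi * y)"
      using dirichlet_kernel[of y N] by (simp add: fser_0 M_def field_simps)
    moreover have "(R has_real_derivative (\<Sum>k<N. fser 0 k y) + 1) (at y)"
      unfolding R_def using fser_deriv[of 0] by (intro DERIV_add DERIV_sum) (auto intro!: derivative_eq_intros)
    ultimately show ?thesis by (metis has_field_derivative_at_within)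
  qed
  have derivh: "(h has_real_derivative - (sin (M * pi * y) / sin (pi * y)) - cos (M * pi * y) * cos (pi * y) / (M * sin (pi * y) ^ 2)) (at y within A)"
    if y: "y \<in> {\<delta>..1 - \<delta>}" for y A
  proof -
    have sy: "sin (pi * y) > 0" using ge[OF y] s by linarith
    have "(h has_real_derivative (- sin (M * pi * y) * (M * pi) * (M * pi * sin (pi * y)) - cos (M * pi * y) * (M * pi * (cos (pi * y) * pi)))
        / ((M * pi * sin (pi * y)) * (M * pi * sin (pi * y)))) (at y within A)"
      unfolding h_def using sy M by (auto intro!: derivative_eq_intros)
    also have "(- sin (M * pi * y) * (M * pi) * (M * pi * sin (pi * y)) - cos (M * pi * y) * (M * pi * (cos (pi * y) * pi)))
        / ((M * pi * sin (pi * y)) * (M * pi * sin (pi * y))) =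
      - (sin (M * pi * y) / sin (pi * y)) - cos (M * pi * y) * cos (pi * y) / (M * sin (pi * y) ^ 2)"
      using sy M by (simp add: divide_simps power2_eq_square) (simp add: algebra_simps)
    finally show ?thesis .
  qed
  have "norm ((R x + h x) - (R (1/2) + h (1/2))) \<le> 1 / (M * s ^ 2) * norm (x - 1/2)"
  proof (rule field_differentiable_bound[where S = "{\<delta>..1 - \<delta>}"])
    fix y assume y: "y \<in> {\<delta>..1 - \<delta>}"
    show "((\<lambda>x. R x + h x) has_field_derivative - (cos (M * pi * y) * cos (pi * y) / (M * sin (pi * y) ^ 2))) (at y within {\<delta>..1 - \<delta>})"
      using DERIV_add[OF derivR[OF y] derivh[OF y]] by simp
    have "\<bar>cos (M * pi * y) * cos (pi * y)\<bar> \<le> 1 * 1" unfolding abs_mult by (intro mult_mono) auto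
    moreover have "M * s ^ 2 \<le> M * sin (pi * y) ^ 2" using ge[OF y] s M by (intro mult_left_mono power_mono) auto
    ultimately show "norm (- (cos (M * pi * y) * cos (pi * y) / (M * sin (pi * y) ^ 2))) \<le> 1 / (M * s ^ 2)"
      using M s ge[OF y] by (auto simp: abs_mult intro!: frac_le)
  qed (use assms in auto)
  moreover have "R (1/2) = 0"
  proof -
    have "fser 1 k (1/2) = 0" for k
    proof -
      have "cos (pi * real (Suc k) - pi / 2) = sin (pi * real (Suc k))" by (simp add: cos_diff)
      also have "\<dots> = 0" using sin_npi2[of "Suc k"] by (simp add: mult.commute)
      finally show ?thesis by (simp add: fser_def)
    qed
    then show ?thesis using bern_1[of "1/2"] by (simp add: R_def)
  qed
  moreover have "h (1/2) = 0"
  proof -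
    have "cos (M * pi * (1/2)) = cos (real N * pi + pi / 2)" by (simp add: M_def algebra_simps)
    also have "\<dots> = 0" by (simp add: cos_add)
    finally show ?thesis by (simp add: h_def)
  qed
  ultimately have "\<bar>R x + h x\<bar> \<le> 1 / (M * s ^ 2) * \<bar>x - 1/2\<bar>" by simp
  also have "\<dots> \<le> 1 / (M * s ^ 2) * 1" using assms M by (intro mult_left_mono) auto
  finally have Rh: "\<bar>R x + h x\<bar> \<le> 1 / (M * s ^ 2)" by simp
  have "\<bar>h x\<bar> \<le> 1 / (M * (pi * s))"
  proof -
    have "M * (pi * s) \<le> M * (pi * sin (pi * x))" using ge[of x] assms M by (intro mult_left_mono) auto
    moreover have "sin (pi * x) > 0" using ge[of x] assms s by auto
    ultimately show ?thesis unfolding h_def abs_divide using M s by (intro frac_le) (auto simp: abs_mult mult_ac)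
  qed
  then have "\<bar>R x\<bar> \<le> 1 / (M * s ^ 2) + 1 / (M * (pi * s))" using Rh by linarith
  also have "\<dots> = (1 / s ^ 2 + 1 / (pi * s)) / M" using M s by (simp add: field_simps)
  finally show ?thesis by (simp add: R_def M_def s_def)
qed

lemma fser_1_uniform_limit:
  assumes "0 < \<delta>"
  shows "uniform_limit {\<delta>..1 - \<delta>} (\<lambda>N x. \<Sum>k<N. fser 1 k x) (\<lambda>x. - bern 1 x) sequentially"
proof (rule uniform_limitI)
  fix e :: real assume "e > 0"
  let ?C = "1 / sin (pi * \<delta>) ^ 2 + 1 / (pi * sin (pi * \<delta>))"
  have "(\<lambda>N. ?C / (2 * real N + 1)) \<longlonglongrightarrow> 0"
  proof -
    have "(\<lambda>N. ?C * inverse (real (Suc (2 * N)))) \<longlonglongrightarrow> 0"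
      by (intro tendsto_mult_right_zero filterlim_compose[OF LIMSEQ_inverse_real_of_nat] mult_nat_left_at_top) simp
    then show ?thesis by (simp add: divide_inverse add.commute)
  qed
  then have "\<forall>\<^sub>F N in sequentially. ?C / (2 * real N + 1) < e"
    using \<open>e > 0\<close> by (rule order_tendstoD)
  then show "\<forall>\<^sub>F N in sequentially. \<forall>x\<in>{\<delta>..1 - \<delta>}. dist (\<Sum>k<N. fser 1 k x) (- bern 1 x) < e"
  proof eventually_elim
    case (elim N)
    show ?case
    proof
      fix x assume "x \<in> {\<delta>..1 - \<delta>}"
      then have "\<bar>(\<Sum>k<N. fser 1 k x) + bern 1 x\<bar> \<le> ?C / (2 * real N + 1)"
        using fser_1_partial_sum_bound[of \<delta> x N] assms by auto
      then show "dist (\<Sum>k<N. fser 1 k x) (- bern 1 x) < e" using elim by (simp add: dist_real_def)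
    qed
  qed
qed

lemma fser_uniformly_convergent:
  assumes "m \<ge> 2"
  shows "uniformly_convergent_on A (\<lambda>N x. \<Sum>k<N. fser m k x)"
proof (rule Weierstrass_m_test')
  show "norm (fser m k x) \<le> inverse (real (Suc k) ^ 2)" for k x
  proof -
    let ?c = "2 * pi * real (Suc k)"
    have "2 * 1 * real (Suc k) \<le> ?c" using pi_gt3 by (intro mult_right_mono mult_left_mono) auto
    then have c: "1 \<le> ?c" "2 * real (Suc k) \<le> ?c" by auto
    have "?c ^ 2 \<le> ?c ^ m" using assms c by (intro power_increasing) auto
    moreover have "(2 * real (Suc k)) ^ 2 \<le> ?c ^ 2" using c by (intro power_mono) auto
    moreover have "2 * real (Suc k) ^ 2 \<le> (2 * real (Suc k)) ^ 2" unfolding power_mult_distrib by simp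
    ultimately have d: "2 * real (Suc k) ^ 2 \<le> ?c ^ m" by linarith
    have "norm (fser m k x) = 2 * \<bar>cos (?c * x - real m * pi / 2)\<bar> / ?c ^ m"
      by (simp add: fser_def abs_mult power_abs)
    also have "\<dots> \<le> 2 * 1 / (2 * real (Suc k) ^ 2)"
      using d by (intro frac_le mult_left_mono) auto
    finally show ?thesis by (simp add: field_simps)
  qed
  show "summable (\<lambda>k. inverse (real (Suc k) ^ 2))"
    using inverse_power_summable[of 2, where ?'a = real] by (subst summable_Suc_iff) auto
qed

lemma fser_summable: "m \<ge> 2 \<Longrightarrow> summable (\<lambda>k. fser m k x)"
  using uniformly_convergent_imp_convergent[OF fser_uniformly_convergent[of m UNIV], of x]
  by (simp add: summable_iff_convergent)

lemma fser_suminf_continuous: "m \<ge> 2 \<Longrightarrow> continuous_on A (\<lambda>x. \<Sum>k. fser m k x)"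
proof (rule uniform_limit_theorem)
  assume "m \<ge> 2"
  show "uniform_limit A (\<lambda>N x. \<Sum>k<N. fser m k x) (\<lambda>x. \<Sum>k. fser m k x) sequentially"
    using fser_uniformly_convergent[OF \<open>m \<ge> 2\<close>, of A]
    by (simp add: uniformly_convergent_uniform_limit_iff suminf_eq_lim)
  show "\<forall>\<^sub>F N in sequentially. continuous_on A (\<lambda>x. \<Sum>k<N. fser m k x)"
    unfolding fser_def by (intro always_eventually allI continuous_intros) auto
qed simp

lemma fser_periodic: "fser m k (x + of_int j) = fser m k x"
proof -
  have e: "2 * pi * real (Suc k) * (x + of_int j) - real m * pi / 2
      = 2 * pi * real (Suc k) * x - real m * pi / 2 + 2 * pi * of_int (int (Suc k) * j)"
    by (simp add: algebra_simps)
  show ?thesis unfolding fser_def e cos_add sin_int_2pin cos_int_2pin by simp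
qed

text \<open>Termwise differentiation needs uniform convergence of the derived series near x only.
  For m = 1 this comes from the bound on compact subintervals of (0, 1), since no summable majorant
  is available there.\<close>

lemma fser_suminf_deriv:
  assumes "m > 0" "0 < x" "x < 1"
  shows "((\<lambda>x. \<Sum>k. fser (Suc m) k x) has_real_derivative (\<Sum>k. fser m k x)) (at x)"
proof -
  define \<delta> where "\<delta> = min x (1 - x) / 2"
  have \<delta>: "\<delta> > 0" "\<delta> < x" "x < 1 - \<delta>" using assms by (auto simp: \<delta>_def min_def field_simps)
  have "uniformly_convergent_on {\<delta>..1 - \<delta>} (\<lambda>N x. \<Sum>k<N. fser m k x)"
  proof (cases "m = 1")
    case True
    then show ?thesis using fser_1_uniform_limit[OF \<delta>(1)] by (auto simp: uniformly_convergent_on_def)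
  qed (use assms fser_uniformly_convergent[of m] in auto)
  then show ?thesis
    by (rule has_field_derivative_series'(2)[rotated 2, where ?x0.0 = x])
       (use \<delta> assms in \<open>auto intro: fser_deriv has_field_derivative_at_within fser_summable\<close>)
qed

text \<open>Integrating the series at level \<open>m\<close> determines level \<open>m + 1\<close> up to a constant, and
  periodicity at level \<open>m + 2\<close> forces the constant to vanish.\<close>

lemma fser_suminf_step:
  assumes "m > 0" and IH: "\<And>x. 0 < x \<Longrightarrow> x < 1 \<Longrightarrow> (\<Sum>k. fser m k x) = - bern m x"
    and x: "0 \<le> x" "x \<le> 1"
  shows "(\<Sum>k. fser (Suc m) k x) = - bern (Suc m) x"
proof -
  define D where "D = (\<lambda>m x. (\<Sum>k. fser m k x) + bern m x)"
  define c where "c = D (Suc m) 0"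
  have cont: "continuous_on {0..1} (D i)" if "i \<ge> 2" for i
    unfolding D_def using that by (intro continuous_intros fser_suminf_continuous)
  have deriv: "(D (Suc i) has_real_derivative D i y) (at y)" if "i > 0" "0 < y" "y < 1" for i y
    unfolding D_def using that by (intro DERIV_add fser_suminf_deriv bern_has_deriv)
  have "D m y = 0" if "0 < y" "y < 1" for y using IH[OF that] by (simp add: D_def)
  then have const: "D (Suc m) y = c" if "0 \<le> y" "y \<le> 1" for y
    unfolding c_def using deriv[of m] that assms(1) cont[of "Suc m"]
    by (intro DERIV_isconst2[of 0 1]) auto
  have "(\<lambda>y. D (Suc (Suc m)) y - c * y) 1 = (\<lambda>y. D (Suc (Suc m)) y - c * y) 0"
  proof (rule DERIV_isconst_end[where f = "\<lambda>y. D (Suc (Suc m)) y - c * y"])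
    fix y :: real assume y: "0 < y" "y < 1"
    show "((\<lambda>y. D (Suc (Suc m)) y - c * y) has_real_derivative 0) (at y)"
      using deriv[of "Suc m" y] const[of y] y by (auto intro!: derivative_eq_intros)
  qed (auto intro!: continuous_intros cont)
  moreover have "D (Suc (Suc m)) 1 = D (Suc (Suc m)) 0"
    using fser_periodic[of "Suc (Suc m)" _ 0 1] by (simp add: D_def bern_at_1)
  ultimately have "c = 0" by simp
  then show ?thesis using const[OF x] by (simp add: D_def)
qed

lemma fser_sums_unit:
  assumes "m > 0" "0 < x" "x < 1"
  shows "(\<lambda>k. fser m k x) sums (- bern m x)"
proof -
  have one: "(\<lambda>k. fser 1 k y) sums (- bern 1 y)" if "0 < y" "y < 1" for y
  proof -
    define \<delta> where "\<delta> = min y (1 - y)"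
    have \<delta>: "\<delta> > 0" "y \<in> {\<delta>..1 - \<delta>}" using that by (auto simp: \<delta>_def min_def)
    show ?thesis unfolding sums_def
      by (rule tendsto_uniform_limitI[OF fser_1_uniform_limit[OF \<delta>(1)] \<delta>(2)])
  qed
  have "(\<Sum>k. fser (Suc i) k y) = - bern (Suc i) y" if "0 < y" "y < 1" for i y
    using that
  proof (induction i arbitrary: y)
    case 0 then show ?case using one[of y] by (simp add: sums_iff)
  next
    case (Suc i) show ?case by (rule fser_suminf_step) (use Suc in auto)
  qed
  from this[OF assms(2,3), of "m - 1"] have "(\<Sum>k. fser m k x) = - bern m x" using assms by simp
  then show ?thesis using one[OF assms(2,3)] fser_summable[of m x] assms(1)
    by (cases "m = 1") (auto simp: sums_iff)
qed

text \<open>Periodicity reduces to [0, 1). At 0 every term with m = 1 vanishes, matching the value 0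
  at the jump; for m \<ge> 2 continuity carries the interior formula to the endpoint.\<close>

lemma fser_sums:
  assumes "m > 0"
  shows "(\<lambda>k. fser m k x) sums (- bernf m x)"
proof -
  have "(\<lambda>k. fser m k (frac x)) sums (- bernf m (frac x))"
  proof (cases "frac x = 0")
    case False
    then have x: "0 < frac x" "frac x < 1" using frac_ge_0[of x] frac_lt_1[of x] by linarith+
    show ?thesis using fser_sums_unit[OF assms x] bernf_eq_bern[OF x, of m] by simp
  next
    case True
    show ?thesis
    proof (cases "m = 1")
      case True
      have "fser 1 k 0 = 0" for k by (simp add: fser_def)
      then show ?thesis unfolding True \<open>frac x = 0\<close> using bernf_int[of 0 1] by simp
    next
      case False
      then obtain i where i: "m = Suc i" "i > 0" using assms by (cases m) auto
      have "(\<Sum>k. fser i k y) = - bern i y" if "0 < y" "y < 1" for y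
        using fser_sums_unit[OF i(2) that] by (simp add: sums_iff)
      then have "(\<Sum>k. fser m k 0) = - bern m 0"
        unfolding i by (intro fser_suminf_step) (use i in auto)
      then show ?thesis unfolding \<open>frac x = 0\<close> using fser_summable[of m 0] False assms
        by (simp add: sums_iff bernf_int)
    qed
  qed
  moreover have "fser m k (frac x) = fser m k x" for k
    using fser_periodic[of m k x "- \<lfloor>x\<rfloor>"] by (simp add: frac_def)
  ultimately show ?thesis by simp
qed

text \<open>The factor \<open>\<i> ^ m\<close> is cis(m pi/2) and absorbs the phase of
  \<open>fser\<close>. Opposite frequencies stay paired, since for m = 1 convergence is only
  conditional.\<close>

lemma bernf_fourier:
  assumes "m > 0"
  shows "(\<lambda>k. (cis (2 * pi * (real (Suc k) * x)) + (-1) ^ m * cis (- (2 * pi * (real (Suc k) * x)))) / of_nat (Suc k) ^ m)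
    sums (- ((2 * pi * \<i>) ^ m * of_real (bernf m x)))"
proof -
  have "(cis (2 * pi * (real (Suc k) * x)) + (-1) ^ m * cis (- (2 * pi * (real (Suc k) * x)))) / of_nat (Suc k) ^ m
      = (2 * pi * \<i>) ^ m * of_real (fser m k x)" for k
  proof -
    define t where "t = 2 * pi * (real (Suc k) * x)"
    define s where "s = real m * pi / 2"
    have "\<i> ^ m = cis s"
      using Complex.DeMoivre[of "pi / 2" m] by (simp add: s_def)
    moreover have "cis (2 * s) = (-1) ^ m"
      using Complex.DeMoivre[of pi m] by (simp add: s_def)
    ultimately have "\<i> ^ m * (2 * of_real (cos (t - s))) = cis t + (-1) ^ m * cis (- t)"
    proof -
      have "2 * of_real (cos (t - s)) = cis (t - s) + cis (s - t)"
        by (simp add: complex_eq_iff cos_diff sin_diff)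
      then have "cis s * (2 * of_real (cos (t - s))) = cis t + cis (2 * s) * cis (- t)"
        by (simp add: distrib_left cis_mult)
      then show ?thesis using \<open>\<i> ^ m = cis s\<close> \<open>cis (2 * s) = (-1) ^ m\<close> by simp
    qed
    moreover have "fser m k x = 2 * cos (t - s) / (2 * pi * real (Suc k)) ^ m"
      by (simp add: fser_def t_def s_def mult_ac)
    ultimately show ?thesis unfolding t_def[symmetric]
      by (simp add: power_mult_distrib del: of_nat_Suc flip: \<open>\<i> ^ m * _ = _\<close>)
  qed
  moreover have "(\<lambda>k. (2 * pi * \<i>) ^ m * of_real (fser m k x)) sums ((2 * pi * \<i>) ^ m * of_real (- bernf m x))"
    by (intro sums_mult sums_of_real fser_sums assms)
  ultimately show ?thesis by simp
qed

section \<open>Orthogonality of Dirichlet characters\<close>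

lemma cis_2pi_int: "cis (2 * pi * of_int k) = 1"
  by (simp add: complex_eq_iff)

lemma sum_cis_multiples:
  assumes "N > 0"
  shows "(\<Sum>t<N. cis (2 * pi * (of_int (k * int t) / real N))) = (if int N dvd k then of_nat N else 0)"
proof -
  define w where "w = cis (2 * pi * (of_int k / real N))"
  have pow: "cis (2 * pi * (of_int (k * int t) / real N)) = w ^ t" for t
    unfolding w_def Complex.DeMoivre by (simp add: mult_ac)
  have wN: "w ^ N = 1"
    unfolding w_def Complex.DeMoivre using assms cis_2pi_int[of k] by (simp add: mult_ac)
  have "w = 1 \<longleftrightarrow> int N dvd k"
  proof
    assume "w = 1"
    then have "cos (2 * pi * (of_int k / real N)) = 1" by (simp add: w_def complex_eq_iff)
    then obtain j :: int where "2 * pi * (of_int k / real N) = of_int j * 2 * pi"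
      using cos_one_2pi_int by blast
    then have "of_int k = real_of_int (int N * j)" using assms by (simp add: field_simps)
    then show "int N dvd k" by (metis dvd_triv_left of_int_eq_iff)
  next
    assume "int N dvd k"
    then obtain j where "k = int N * j" by blast
    then show "w = 1" using cis_2pi_int[of j] assms by (simp add: w_def)
  qed
  then show ?thesis
    unfolding pow using geometric_sum[of w N] wN by auto
qed

lemma dirichlet_characterD:
  assumes "dirichlet_character q \<psi>"
  shows "\<psi> (x * y) = \<psi> x * \<psi> y" "\<psi> (x + int q) = \<psi> x" "\<psi> x = 0 \<longleftrightarrow> \<not> coprime x (int q)"
    "\<psi> 1 = 1" "[x = y] (mod int q) \<Longrightarrow> \<psi> x = \<psi> y"
proof -
  show m: "\<psi> (x * y) = \<psi> x * \<psi> y" for x y using assms by (auto simp: dirichlet_character_def)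
  show p: "\<psi> (x + int q) = \<psi> x" for x using assms by (auto simp: dirichlet_character_def)
  show z: "\<psi> x = 0 \<longleftrightarrow> \<not> coprime x (int q)" for x using assms by (auto simp: dirichlet_character_def)
  show "\<psi> 1 = 1" using m[of 1 1] z[of 1] by simp
  show "[x = y] (mod int q) \<Longrightarrow> \<psi> x = \<psi> y" by (rule periodic_cong[of \<psi> q, OF p])
qed

lemma euler_theorem_int:
  assumes "coprime x (int q)" "q > 0"
  shows "[x ^ totient q = 1] (mod int q)"
proof -
  have x: "int (nat (x mod int q)) = x mod int q" using assms by simp
  have "coprime (nat (x mod int q)) q"
    using assms by (subst coprime_int_iff[symmetric], subst x) (simp add: coprime_mod_left_iff)
  from euler_theorem[OF this] have "[int (nat (x mod int q)) ^ totient q = 1] (mod int q)"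
    by (metis cong_int_iff of_nat_1 of_nat_power)
  then show ?thesis unfolding x by (simp add: cong_def power_mod)
qed

lemma dirichlet_character_norm:
  assumes "dirichlet_character q \<psi>" "coprime x (int q)" "q > 0"
  shows "\<psi> x * cnj (\<psi> x) = 1"
proof -
  note D = dirichlet_characterD[OF assms(1)]
  have pow: "\<psi> (x ^ k) = \<psi> x ^ k" for k by (induction k) (simp_all add: D)
  have "\<psi> x ^ totient q = 1" using D(5)[OF euler_theorem_int[OF assms(2,3)]] by (simp add: pow D(4))
  then have "norm (\<psi> x) = 1" using power_eq_1_iff[of "\<psi> x" "totient q"] assms(3) by simp
  then show ?thesis by (simp add: complex_norm_square[symmetric])
qed

lemma dirichlet_character_cnj:
  "dirichlet_character q \<psi> \<Longrightarrow> dirichlet_character q (\<lambda>x. cnj (\<psi> x))"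
  by (simp add: dirichlet_character_def)

lemma dirichlet_character_mult:
  "dirichlet_character q \<psi> \<Longrightarrow> dirichlet_character q \<omega> \<Longrightarrow> dirichlet_character q (\<lambda>x. \<psi> x * \<omega> x)"
  by (auto simp: dirichlet_character_def)

lemma coprime_add_self: "coprime (x + m) m \<longleftrightarrow> coprime x m" for x m :: int
  by (simp add: coprime_iff_gcd_eq_1)

lemma dirichlet_character_principal: "dirichlet_character q (\<lambda>x. if coprime x (int q) then 1 else 0)"
  by (auto simp: dirichlet_character_def coprime_add_self)

text \<open>Projecting onto the eigenspaces of one translation at a time keeps the two points separated
  by some component.\<close>

lemma joint_eigenfunction_separates:
  assumes "q > 0" "coprime x (int q)" "\<not> [x = y] (mod int q)" "finite A" "\<And>g. g \<in> A \<Longrightarrow> coprime g (int q)"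
  shows "\<exists>h::int \<Rightarrow> complex. (\<forall>t. h (t + int q) = h t) \<and> (\<forall>t. \<not> coprime t (int q) \<longrightarrow> h t = 0) \<and>
    h x \<noteq> h y \<and> (\<forall>g\<in>A. \<exists>z. \<forall>t. h (g * t) = z * h t)"
  using assms(4,5)
proof (induction A rule: finite_induct)
  case empty
  define h :: "int \<Rightarrow> complex" where "h = (\<lambda>t. if [t = x] (mod int q) then 1 else 0)"
  have "h (t + int q) = h t" for t unfolding h_def cong_def mod_add_self2 ..
  moreover have "h t = 0" if "\<not> coprime t (int q)" for t
    using assms(2) cong_imp_coprime[OF cong_sym, of t x "int q"] that by (auto simp: h_def)
  moreover have "h x \<noteq> h y"
    using assms(3) cong_sym[of y x "int q"] by (auto simp: h_def)
  ultimately show ?case by blast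
next
  case (insert g A)
  have "\<And>g. g \<in> A \<Longrightarrow> coprime g (int q)" using insert.prems by blast
  from insert.IH[OF this]
  obtain h :: "int \<Rightarrow> complex" where h: "\<And>t. h (t + int q) = h t" "\<And>t. \<not> coprime t (int q) \<Longrightarrow> h t = 0"
    "h x \<noteq> h y" "\<And>g. g \<in> A \<Longrightarrow> \<exists>z. \<forall>t. h (g * t) = z * h t" by blast
  define N where "N = totient q"
  have N: "N > 0" using assms(1) by (simp add: N_def)
  define w where "w = (\<lambda>c::nat. cis (2 * pi * (real c / real N)))"
  have wN: "w c ^ N = 1" for c
    unfolding w_def Complex.DeMoivre using N cis_2pi_int[of "int c"] by (simp add: mult_ac)
  \<comment> \<open>Up to the factor 1/N, \<open>H c\<close> is the projection of h to the functions
    that t -> g t multiplies by \<open>cnj (w c)\<close>. Euler's theorem makes N iterations of this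
    translation trivial, so Nth roots of unity suffice.\<close>
  define H where "H = (\<lambda>c t. \<Sum>k<N. w c ^ k * h (g ^ k * t))"
  have hN: "h (g ^ N * t) = h t" for t
  proof (rule periodic_cong[of h q, OF h(1)])
    show "[g ^ N * t = t] (mod int q)"
      using cong_scalar_right[OF euler_theorem_int[of g q], of t] insert.prems[of g] assms(1) by (simp add: N_def)
  qed
  have eig: "H c (g * t) = cnj (w c) * H c t" for c t
  proof -
    have "w c * H c (g * t) = (\<Sum>k<N. w c ^ Suc k * h (g ^ Suc k * t))"
      by (simp add: H_def sum_distrib_left mult_ac)
    also have "\<dots> - H c t = (\<Sum>k<N. w c ^ Suc k * h (g ^ Suc k * t) - w c ^ k * h (g ^ k * t))"
      unfolding H_def by (simp add: sum_subtractf)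
    also have "\<dots> = w c ^ N * h (g ^ N * t) - w c ^ 0 * h (g ^ 0 * t)"
      by (rule sum_lessThan_telescope)
    also have "\<dots> = 0" by (simp add: hN wN)
    finally have "w c * H c (g * t) = H c t" by simp
    moreover have "cnj (w c) * w c = 1" by (simp add: w_def cis_cnj cis_mult)
    ultimately show ?thesis by (simp add: mult.assoc[symmetric] flip: \<open>w c * H c (g * t) = H c t\<close>)
  qed
  have total: "(\<Sum>c<N. H c t) = of_nat N * h t" for t
  proof -
    have "(\<Sum>c<N. H c t) = (\<Sum>k<N. (\<Sum>c<N. w c ^ k) * h (g ^ k * t))"
      unfolding H_def by (subst sum.swap) (simp add: sum_distrib_right)
    also have "\<dots> = (\<Sum>k<N. if k = 0 then of_nat N * h t else 0)"
    proof (rule sum.cong[OF refl])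
      fix k assume "k \<in> {..<N}"
      have "w c ^ k = cis (2 * pi * (of_int (int k * int c) / real N))" for c
        unfolding w_def Complex.DeMoivre by (simp add: mult_ac)
      then have "(\<Sum>c<N. w c ^ k) = (if int N dvd int k then of_nat N else 0)"
        using sum_cis_multiples[OF N, of "int k"] by simp
      also have "int N dvd int k \<longleftrightarrow> k = 0" using \<open>k \<in> {..<N}\<close> by (auto dest: dvd_imp_le)
      finally show "(\<Sum>c<N. w c ^ k) * h (g ^ k * t) = (if k = 0 then of_nat N * h t else 0)" by simp
    qed
    also have "\<dots> = of_nat N * h t" using N by simp
    finally show ?thesis .
  qed
  \<comment> \<open>The components add up to N h, so they cannot all take equal values at x and
    y.\<close>
  have "\<exists>c. H c x \<noteq> H c y"
  proof (rule ccontr)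
    assume "\<nexists>c. H c x \<noteq> H c y"
    then have "of_nat N * h x = of_nat N * h y" unfolding total[symmetric] by simp
    then show False using h(3) N by simp
  qed
  then obtain c where c: "H c x \<noteq> H c y" ..
  have "H c (t + int q) = H c t" for t
  proof -
    have "h (g ^ k * (t + int q)) = h (g ^ k * t)" for k
      using periodic_mult[of h q "g ^ k * t" "g ^ k", OF h(1)] by (simp add: distrib_left mult.commute)
    then show ?thesis by (simp add: H_def)
  qed
  moreover have "H c t = 0" if "\<not> coprime t (int q)" for t
    unfolding H_def using that by (intro sum.neutral ballI) (simp add: h(2))
  \<comment> \<open>Translations commute, so projecting for g preserves the eigenvalues already
    achieved for A.\<close>
  moreover have "\<exists>z. \<forall>t. H c (f * t) = z * H c t" if "f \<in> insert g A" for f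
  proof (cases "f = g")
    case False
    then have "f \<in> A" using that by blast
    then obtain z where z: "\<And>t. h (f * t) = z * h t" using h(4)[of f] by blast
    have "h (g ^ k * (f * t)) = z * h (g ^ k * t)" for k t
      using z[of "g ^ k * t"] by (simp add: mult.left_commute)
    then have "H c (f * t) = z * H c t" for t
      unfolding H_def sum_distrib_left by (intro sum.cong refl) (simp add: mult.left_commute)
    then show ?thesis by blast
  qed (use eig in blast)
  ultimately show ?case using c by blast
qed

text \<open>An eigenfunction h of all unit translations satisfies h(g t) h(1) = h(g) h(t), so h /
  h(1) is a character. If h(1) were 0, h would vanish on all units and could not separate x from
  y.\<close>

lemma dirichlet_character_separates:
  assumes "q > 0" "coprime x (int q)" "coprime y (int q)" "\<not> [x = y] (mod int q)"
  shows "\<exists>\<psi>. dirichlet_character q \<psi> \<and> \<psi> x \<noteq> \<psi> y"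
proof -
  define A where "A = {g \<in> {0..<int q}. coprime g (int q)}"
  have "finite A" "\<And>g. g \<in> A \<Longrightarrow> coprime g (int q)"
    unfolding A_def by (rule finite_subset[of _ "{0..<int q}"]) auto
  from joint_eigenfunction_separates[OF assms(1,2,4) this]
  obtain h :: "int \<Rightarrow> complex" where h: "\<And>t. h (t + int q) = h t" "\<And>t. \<not> coprime t (int q) \<Longrightarrow> h t = 0"
    "h x \<noteq> h y" "\<And>g. g \<in> A \<Longrightarrow> \<exists>z. \<forall>t. h (g * t) = z * h t" by blast
  note per = periodic_cong[of h q, OF h(1)]
  have eig: "\<exists>z. \<forall>t. h (g * t) = z * h t" if "coprime g (int q)" for g
  proof -
    have "coprime (g mod int q) (int q)" using that assms(1) by (simp add: coprime_mod_left_iff)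
    then have "g mod int q \<in> A" using assms(1) by (simp add: A_def)
    then obtain z where z: "\<And>t. h (g mod int q * t) = z * h t" using h(4) by blast
    have "h (g * t) = z * h t" for t
      unfolding z[symmetric] by (rule per) (simp add: cong_def mod_mult_left_eq)
    then show ?thesis by blast
  qed
  have h1: "h 1 \<noteq> 0"
  proof
    assume "h 1 = 0"
    then have "h t = 0" if "coprime t (int q)" for t
      using eig[OF that] by (metis mult.right_neutral mult_zero_right)
    then show False using h(3) assms(2,3) by simp
  qed
  have mult: "h (s * t) * h 1 = h s * h t" for s t
  proof (cases "coprime s (int q)")
    case True
    then obtain z where z: "\<And>t. h (s * t) = z * h t" using eig by blast
    have "h s = z * h 1" using z[of 1] by simp
    then show ?thesis using z by simp
  qed (simp add: h(2))
  have nz: "h t \<noteq> 0" if t: "coprime t (int q)" for t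
  proof -
    obtain u where "[t * u = 1] (mod int q)" using t cong_solve_coprime_int by blast
    then have "h (t * u) = h 1" by (rule per)
    then show ?thesis using mult[of t u] h1 by auto
  qed
  have "dirichlet_character q (\<lambda>t. h t / h 1)"
    unfolding dirichlet_character_def
  proof (intro conjI allI)
    fix s t
    have "h (s * t) = h s * h t / h 1" using mult[of s t] h1 by (simp add: nonzero_eq_divide_eq)
    then show "h (s * t) / h 1 = h s / h 1 * (h t / h 1)" by simp
    show "h (t + int q) / h 1 = h t / h 1" by (simp only: h(1))
    show "h t / h 1 \<noteq> 0 \<longleftrightarrow> coprime t (int q)" using nz[of t] h(2)[of t] h1 by auto
  qed
  moreover have "h x / h 1 \<noteq> h y / h 1" using h(3) h1 by simp
  ultimately show ?thesis by blast
qed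

lemma sum_coprime_totient:
  assumes "q > 0"
  shows "(\<Sum>r<q. if coprime (int r) (int q) then 1 else 0) = (of_nat (totient q) :: 'a::comm_semiring_1)"
proof -
  let ?f = "\<lambda>x::int. if coprime x (int q) then 1 else 0 :: 'a"
  have "(\<Sum>r<q. ?f (0 + int r)) = (\<Sum>r<q. ?f (0 + 1 + int r))"
    by (rule sum_periodic_shift_one[symmetric, where f = ?f]) (simp add: coprime_add_self)
  also have "\<dots> = (\<Sum>r\<in>{0<..q}. if coprime r q then 1 else 0)"
    by (rule sum.reindex_bij_witness[of _ "\<lambda>r. r - 1" Suc]) (auto simp: of_nat_diff simp flip: coprime_int_iff)
  also have "\<dots> = of_nat (totient q)"
    by (simp add: totient_def totatives_def sum.If_cases Int_def)
  finally show ?thesis by simp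
qed

lemma dirichlet_character_sum_args:
  assumes "q > 0" "dirichlet_character q \<psi>"
  shows "(\<Sum>r<q. \<psi> (int r)) = (if \<psi> = (\<lambda>x. if coprime x (int q) then 1 else 0) then of_nat (totient q) else 0)"
proof (cases "\<psi> = (\<lambda>x. if coprime x (int q) then 1 else 0)")
  case True
  then show ?thesis using sum_coprime_totient[OF assms(1)] by simp
next
  case False
  note D = dirichlet_characterD[OF assms(2)]
  obtain g where "\<psi> g \<noteq> (if coprime g (int q) then 1 else 0)" using False by (auto simp: fun_eq_iff)
  then have g: "coprime g (int q)" "\<psi> g \<noteq> 1" using D(3)[of g] by (auto split: if_splits)
  have "\<psi> g * (\<Sum>r<q. \<psi> (int r)) = (\<Sum>r<q. \<psi> (0 + g * int r))" by (simp add: sum_distrib_left D(1))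
  also have "\<dots> = (\<Sum>r<q. \<psi> (int r))" by (rule sum_periodic_affine[of \<psi>, OF D(2) g(1)])
  finally show ?thesis using g False by simp
qed

text \<open>Off the diagonal, twisting by a separating character multiplies the sum by a number
  other than 1. On the diagonal it is the number of characters, which is found by summing the values
  at all residues in both orders.\<close>

lemma dirichlet_character_orthogonality:
  assumes "q > 0"
  shows "(\<Sum>\<psi> | dirichlet_character q \<psi>. \<psi> x * cnj (\<psi> y)) =
    (if coprime x (int q) \<and> [x = y] (mod int q) then of_nat (totient q) else 0)"
proof -
  let ?X = "{\<psi>. dirichlet_character q \<psi>}"
  let ?F = "\<lambda>x y. \<Sum>\<psi>\<in>?X. \<psi> x * cnj (\<psi> y)"
  have fin: "finite ?X" using assms by (rule finite_dirichlet_characters)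
  have off: "?F x y = 0" if xy: "coprime x (int q)" "coprime y (int q)" "\<not> [x = y] (mod int q)" for x y
  proof -
    obtain \<omega> where \<omega>: "dirichlet_character q \<omega>" "\<omega> x \<noteq> \<omega> y"
      using dirichlet_character_separates[OF assms xy] by blast
    have cancel: "cnj (\<omega> t) * (\<omega> t * \<psi> t) = \<psi> t" "\<omega> t * (cnj (\<omega> t) * \<psi> t) = \<psi> t"
      if "dirichlet_character q \<psi>" for \<psi> t
    proof -
      have "\<omega> t * cnj (\<omega> t) * \<psi> t = \<psi> t"
        using dirichlet_character_norm[OF \<omega>(1) _ assms, of t] dirichlet_characterD(3)[OF that, of t] by (cases "coprime t (int q)") auto
      then show "cnj (\<omega> t) * (\<omega> t * \<psi> t) = \<psi> t" "\<omega> t * (cnj (\<omega> t) * \<psi> t) = \<psi> t" by (simp_all add: mult_ac)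
    qed
    \<comment> \<open>Multiplication by \<omega> permutes the characters, with multiplication by its
      conjugate as inverse.\<close>
    have "?F x y = (\<Sum>\<psi>\<in>?X. (\<omega> x * \<psi> x) * cnj (\<omega> y * \<psi> y))"
    proof (rule sum.reindex_bij_witness[of _ "\<lambda>\<psi> t. \<omega> t * \<psi> t" "\<lambda>\<psi> t. cnj (\<omega> t) * \<psi> t"])
      fix \<psi> assume "\<psi> \<in> ?X"
      then have \<psi>: "dirichlet_character q \<psi>" by simp
      show "(\<lambda>t. \<omega> t * (cnj (\<omega> t) * \<psi> t)) = \<psi>" "(\<lambda>t. cnj (\<omega> t) * (\<omega> t * \<psi> t)) = \<psi>"
        "\<omega> x * (cnj (\<omega> x) * \<psi> x) * cnj (\<omega> y * (cnj (\<omega> y) * \<psi> y)) = \<psi> x * cnj (\<psi> y)"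
        by (simp_all only: cancel[OF \<psi>])
      show "(\<lambda>t. \<omega> t * \<psi> t) \<in> ?X" "(\<lambda>t. cnj (\<omega> t) * \<psi> t) \<in> ?X"
        using \<psi> \<omega>(1) by (simp_all add: dirichlet_character_mult dirichlet_character_cnj)
    qed
    also have "\<dots> = (\<omega> x * cnj (\<omega> y)) * ?F x y" by (simp add: sum_distrib_left mult_ac)
    finally have "(1 - \<omega> x * cnj (\<omega> y)) * ?F x y = 0" by (simp add: algebra_simps)
    moreover have "\<omega> x * cnj (\<omega> y) \<noteq> 1"
    proof
      assume "\<omega> x * cnj (\<omega> y) = 1"
      then have "\<omega> x * cnj (\<omega> y) * \<omega> y = \<omega> y" by simp
      then show False using dirichlet_character_norm[OF \<omega>(1) xy(2) assms] \<omega>(2) by (simp add: mult_ac)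
    qed
    ultimately show ?thesis by simp
  qed
  have diag: "?F x y = of_nat (card ?X)" if "coprime x (int q)" "[x = y] (mod int q)" for x y
  proof -
    have "\<psi> x * cnj (\<psi> y) = 1" if "\<psi> \<in> ?X" for \<psi>
      using dirichlet_character_norm[of q \<psi> x] dirichlet_characterD(5)[of q \<psi> x y] that
        \<open>coprime x (int q)\<close> \<open>[x = y] (mod int q)\<close> assms by simp
    then show ?thesis by simp
  qed
  have zero: "?F x y = 0" if "\<not> coprime x (int q) \<or> \<not> coprime y (int q)" for x y
    using that dirichlet_characterD(3) by (intro sum.neutral) auto
  have all: "?F x y = (if coprime x (int q) \<and> [x = y] (mod int q) then of_nat (card ?X) else 0)" for x y
    using off[of x y] diag[of x y] zero[of x y] cong_imp_coprime[of x y "int q"] by auto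
  have card: "of_nat (card ?X) = (of_nat (totient q) :: complex)"
  proof -
    \<comment> \<open>The residue of 1 is written \<open>1 mod q\<close> because it is 0 when q =
      1.\<close>
    have "(\<Sum>r<q. ?F (int r) 1) = (\<Sum>r<q. if r = 1 mod q then of_nat (card ?X) else 0)"
    proof (rule sum.cong[OF refl])
      fix r assume r: "r \<in> {..<q}"
      have "[int r = 1] (mod int q) \<longleftrightarrow> r = 1 mod q"
        using r cong_int_iff[of r 1 q] by (auto simp: cong_def)
      moreover have "coprime (int r) (int q)" if "[int r = 1] (mod int q)"
        using that cong_imp_coprime[of 1 "int r" "int q"] by (simp add: cong_sym_eq)
      ultimately show "?F (int r) 1 = (if r = 1 mod q then of_nat (card ?X) else 0)" unfolding all by auto
    qed
    also have "\<dots> = of_nat (card ?X)" using assms by simp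
    finally have "of_nat (card ?X) = (\<Sum>r<q. \<Sum>\<psi>\<in>?X. \<psi> (int r))"
      by (simp add: dirichlet_characterD(4))
    also have "\<dots> = (\<Sum>\<psi>\<in>?X. \<Sum>r<q. \<psi> (int r))" by (rule sum.swap)
    also have "\<dots> = (\<Sum>\<psi>\<in>?X. if \<psi> = (\<lambda>x. if coprime x (int q) then 1 else 0) then of_nat (totient q) else 0)"
      by (intro sum.cong refl dirichlet_character_sum_args assms) simp
    also have "\<dots> = of_nat (totient q)"
      using fin dirichlet_character_principal by simp
    finally show ?thesis .
  qed
  show ?thesis using all[of x y] by (simp only: card)
qed

section \<open>Moebius sums\<close>

lemma prime_factorization_prod_primes:
  assumes "finite S" "\<And>p. p \<in> S \<Longrightarrow> prime (p::nat)"
  shows "prime_factorization (\<Prod>S) = mset_set S"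
proof -
  have "\<Prod>S = prod_mset (mset_set S)" by (simp add: prod_unfold_prod_mset)
  moreover have "\<And>p. p \<in># mset_set S \<Longrightarrow> prime p" using assms by simp
  ultimately show ?thesis by (simp only: prime_factorization_prod_mset_primes)
qed

lemma prod_prime_factors_squarefree:
  assumes "squarefree (n::nat)" shows "\<Prod>(prime_factors n) = n"
proof -
  have n: "n \<noteq> 0" using assms by (intro notI) simp
  then have "(\<Prod>p\<in>prime_factors n. p ^ multiplicity p n) = n" using prime_factorization_nat[of n] by (simp add: neq0_conv)
  moreover have "(\<Prod>p\<in>prime_factors n. p ^ multiplicity p n) = \<Prod>(prime_factors n)"
    using assms n by (intro prod.cong) (auto simp: squarefree_factorial_semiring')
  ultimately show ?thesis by simp
qed

text \<open>Expanding the product gives one term for each set S of prime divisors. The map from S to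
  its product is a bijection to the squarefree divisors, the only ones where
  \<open>moebius_mu\<close> is nonzero.\<close>

lemma sum_moebius_divisors:
  fixes f :: "nat \<Rightarrow> real"
  assumes "q > 0" "f 1 = 1" "\<And>x y. f (x * y) = f x * f y"
  shows "(\<Sum>e | e dvd q. moebius_mu e * f e) = (\<Prod>p | prime p \<and> p dvd q. 1 - f p)"
proof -
  let ?P = "prime_factors q"
  have P: "{p. prime p \<and> p dvd q} = ?P" using assms(1) by (auto simp: prime_factors_dvd)
  have fprod: "f (\<Prod>S) = (\<Prod>p\<in>S. f p)" if "finite S" for S
    using that by (induction S rule: finite_induct) (auto simp: assms assms(2)[unfolded One_nat_def])
  have pf: "prime_factors (\<Prod>S) = S" "squarefree (\<Prod>S)" "\<Prod>S dvd q" if S: "S \<subseteq> ?P" for S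
  proof -
    have fin: "finite S" using S finite_subset by blast
    have "\<And>p. p \<in> S \<Longrightarrow> prime p" using S by auto
    from prime_factorization_prod_primes[OF fin this]
    have m: "prime_factorization (\<Prod>S) = mset_set S" by blast
    show "prime_factors (\<Prod>S) = S" using m fin by simp
    have "mset_set S \<subseteq># mset_set ?P" using S by (simp add: subset_imp_msubset_mset_set)
    also have "\<dots> \<subseteq># prime_factorization q" by (rule mset_set_set_mset_msubset)
    finally have sub: "prime_factorization (\<Prod>S) \<subseteq># prime_factorization q" unfolding m .
    have "0 \<notin> S" using S by auto
    then have nz: "\<Prod>S \<noteq> 0" using fin by simp
    show "\<Prod>S dvd q" using sub nz assms(1) by (simp add: prime_factorization_subset_iff_dvd)
    have "multiplicity p (\<Prod>S) = 1" if "p \<in> prime_factors (\<Prod>S)" for p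
    proof -
      have "prime p" using that by auto
      then have "multiplicity p (\<Prod>S) = count (prime_factorization (\<Prod>S)) p" by (simp add: count_prime_factorization_prime)
      then show ?thesis using that fin unfolding m by simp
    qed
    then show "squarefree (\<Prod>S)" using nz by (simp add: squarefree_factorial_semiring')
  qed
  have "(\<Prod>p | prime p \<and> p dvd q. 1 - f p) = (\<Prod>p\<in>?P. (- f p) + 1)" unfolding P by simp
  also have "\<dots> = (\<Sum>S\<in>Pow ?P. (\<Prod>p\<in>S. - f p) * (\<Prod>p\<in>?P - S. 1))" by (rule prod_add) simp
  also have "\<dots> = (\<Sum>S\<in>Pow ?P. moebius_mu (\<Prod>S) * f (\<Prod>S))"
  proof (rule sum.cong[OF refl])
    fix S assume "S \<in> Pow ?P"
    then have S: "S \<subseteq> ?P" and fin: "finite S" using finite_subset[of S ?P] by auto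
    show "(\<Prod>p\<in>S. - f p) * (\<Prod>p\<in>?P - S. 1) = moebius_mu (\<Prod>S) * f (\<Prod>S)"
      using pf(1,2)[OF S] by (simp add: prod_uminus fprod[OF fin] moebius_mu_def)
  qed
  also have "\<dots> = (\<Sum>e | e dvd q \<and> squarefree e. moebius_mu e * f e)"
  proof (rule sum.reindex_bij_witness[of _ prime_factors "\<lambda>S. \<Prod>S"])
    fix e assume e: "e \<in> {e. e dvd q \<and> squarefree e}"
    then show "\<Prod>(prime_factors e) = e" by (simp add: prod_prime_factors_squarefree)
    show "prime_factors e \<in> Pow ?P" using e assms(1) dvd_prime_factors[of q e] by auto
  next
    fix S assume "S \<in> Pow ?P"
    then show "prime_factors (\<Prod>S) = S" "\<Prod>S \<in> {e. e dvd q \<and> squarefree e}" using pf[of S] by auto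
  qed simp
  also have "\<dots> = (\<Sum>e | e dvd q. moebius_mu e * f e)"
    using assms(1) by (intro sum.mono_neutral_left) (auto simp: moebius_mu_def)
  finally show ?thesis by simp
qed

lemma sum_moebius:
  assumes "q > 0"
  shows "(\<Sum>e | e dvd q. moebius_mu e) = (if q = 1 then 1 else 0)"
proof -
  have "(\<Sum>e | e dvd q. moebius_mu e) = (\<Prod>p | prime p \<and> p dvd q. 0)"
    using sum_moebius_divisors[OF assms, of "\<lambda>_. 1"] by simp
  also have "\<dots> = (if {p. prime p \<and> p dvd q} = {} then 1 else 0)"
  proof -
    have "finite {p. prime p \<and> p dvd q}" using assms by (intro finite_subset[OF _ finite_divisors_nat[of q]]) auto
    then show ?thesis by (cases "{p. prime p \<and> p dvd q} = {}") (simp_all only: prod.empty if_True if_False prod_zero_iff, auto)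
  qed
  also have "{p. prime p \<and> p dvd q} = {} \<longleftrightarrow> q = 1"
    using prime_factor_nat[of q] by auto
  finally show ?thesis .
qed

lemma sum_divisors_flip:
  assumes "(q::nat) > 0"
  shows "(\<Sum>d | d dvd q. f (q div d) d) = (\<Sum>e | e dvd q. f e (q div e))"
  by (rule sum.reindex_bij_witness[of _ "\<lambda>d. q div d" "\<lambda>d. q div d"]) (use assms in auto)

lemma sum_moebius_power:
  assumes "q > 0"
  shows "(\<Sum>d | d dvd q. moebius_mu (q div d) * real d ^ N)
    = real q ^ N * (\<Prod>p | prime p \<and> p dvd q. 1 - inverse (real p ^ N))"
proof -
  have "(\<Sum>d | d dvd q. moebius_mu (q div d) * real d ^ N) = (\<Sum>e | e dvd q. moebius_mu e * real (q div e) ^ N)"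
    by (rule sum_divisors_flip[OF assms])
  also have "\<dots> = (\<Sum>e | e dvd q. real q ^ N * (moebius_mu e * inverse (real e ^ N)))"
    using assms by (intro sum.cong refl) (auto simp: real_of_nat_div power_divide field_simps dest: dvd_pos_nat)
  also have "\<dots> = real q ^ N * (\<Prod>p | prime p \<and> p dvd q. 1 - inverse (real p ^ N))"
    unfolding sum_distrib_left[symmetric]
    using sum_moebius_divisors[OF assms, of "\<lambda>e. inverse (real e ^ N)"]
    by (simp add: power_mult_distrib)
  finally show ?thesis .
qed

lemma sum_moebius_jordan:
  assumes "q > 0"
  shows "of_real (\<Sum>d | d dvd q. moebius_mu (q div d) * real d ^ N) = jordan_J (of_nat N) q"
proof -
  have "complex_of_nat k powr of_nat N = of_nat k ^ N \<and> complex_of_nat k powr - of_nat N = inverse (of_nat k ^ N)" if "k > 0" for k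
    using that by (simp add: powr_minus powr_nat')
  moreover have "p > 0" if "prime p" for p :: nat using that by (rule prime_gt_0_nat)
  ultimately show ?thesis
    unfolding sum_moebius_power[OF assms] jordan_J_def using assms by simp
qed

lemma sum_moebius_totient:
  assumes "q > 0"
  shows "(\<Sum>d | d dvd q. moebius_mu (q div d) * real d) = real (totient q)"
proof -
  have "{p. prime p \<and> p dvd q} = prime_factors q" using assms by (auto simp: prime_factors_dvd)
  then show ?thesis using sum_moebius_power[OF assms, of 1] totient_formula2[of q] by (simp add: divide_inverse)
qed

text \<open>The coprimality indicator is the sum of \<open>moebius_mu e\<close> over e dividing
  gcd(t, q). Interchanging the sums leaves the multiples t = e s, and d = q/e is the length of the
  remaining sum.\<close>

lemma sum_coprime_moebius:
  fixes F :: "int \<Rightarrow> complex"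
  assumes "q > 0"
  shows "(\<Sum>t<q. if coprime (int t) (int q) then F (int t) else 0) =
    (\<Sum>d | d dvd q. of_real (moebius_mu (q div d)) * (\<Sum>s<d. F (int (q div d * s))))"
proof -
  have "(if coprime (int t) (int q) then F (int t) else 0) =
      (\<Sum>e | e dvd q. if e dvd t then of_real (moebius_mu e) * F (int t) else 0)" for t
  proof -
    have g: "gcd t q > 0" using assms by simp
    have "(\<Sum>e | e dvd q. if e dvd t then of_real (moebius_mu e) * F (int t) else 0)
      = (\<Sum>e \<in> {e \<in> {e. e dvd q}. e dvd t}. of_real (moebius_mu e) * F (int t))"
      using assms by (intro sum.inter_filter[symmetric] finite_divisors_nat)
    also have "{e \<in> {e. e dvd q}. e dvd t} = {e. e dvd gcd t q}" by auto
    also have "(\<Sum>e | e dvd gcd t q. of_real (moebius_mu e) * F (int t)) = of_real (\<Sum>e | e dvd gcd t q. moebius_mu e) * F (int t)"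
      by (simp add: sum_distrib_right)
    finally have "(\<Sum>e | e dvd q. if e dvd t then of_real (moebius_mu e) * F (int t) else 0)
      = of_real (\<Sum>e | e dvd gcd t q. moebius_mu e) * F (int t)" .
    then show ?thesis unfolding sum_moebius[OF g] by (simp add: coprime_iff_gcd_eq_1 del: One_nat_def)
  qed
  then have "(\<Sum>t<q. if coprime (int t) (int q) then F (int t) else 0)
     = (\<Sum>e | e dvd q. \<Sum>t<q. if e dvd t then of_real (moebius_mu e) * F (int t) else 0)"
    by (simp only:) (rule sum.swap)
  also have "\<dots> = (\<Sum>e | e dvd q. of_real (moebius_mu e) * (\<Sum>s<q div e. F (int (e * s))))"
  proof (rule sum.cong[OF refl])
    fix e assume "e \<in> {e. e dvd q}"
    then have e: "e dvd q" "e > 0" using assms by (auto intro: dvd_pos_nat)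
    have "(\<Sum>t<q. if e dvd t then of_real (moebius_mu e) * F (int t) else 0)
      = (\<Sum>t | t < q \<and> e dvd t. of_real (moebius_mu e) * F (int t))"
      using sum.inter_filter[of "{..<q}" "\<lambda>t. of_real (moebius_mu e) * F (int t)" "\<lambda>t. e dvd t"]
      by (simp only: finite_lessThan lessThan_iff mem_Collect_eq)
    also have "\<dots> = (\<Sum>s<q div e. of_real (moebius_mu e) * F (int (e * s)))"
    proof (rule sum.reindex_bij_witness[of _ "\<lambda>s. e * s" "\<lambda>t. t div e"])
      obtain c where c: "q = e * c" using e by blast
      fix t assume "t \<in> {t. t < q \<and> e dvd t}"
      then obtain r where r: "t = e * r" "e * r < q" by blast
      then show "e * (t div e) = t" "of_real (moebius_mu e) * F (int (e * (t div e))) = of_real (moebius_mu e) * F (int t)"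
        using e by simp_all
      show "t div e \<in> {..<q div e}" using r c e by simp
    next
      obtain c where c: "q = e * c" using e by blast
      fix s assume "s \<in> {..<q div e}"
      then show "e * s div e = s" "e * s \<in> {t. t < q \<and> e dvd t}" using e c by simp_all
    qed
    finally show "(\<Sum>t<q. if e dvd t then of_real (moebius_mu e) * F (int t) else 0)
      = of_real (moebius_mu e) * (\<Sum>s<q div e. F (int (e * s)))"
      by (simp add: sum_distrib_left)
  qed
  also have "\<dots> = (\<Sum>d | d dvd q. of_real (moebius_mu (q div d)) * (\<Sum>s<d. F (int (q div d * s))))"
    by (rule sum_divisors_flip[OF assms, symmetric])
  finally show ?thesis .
qed

section \<open>Values of L-functions as finite sums\<close>

text \<open>The sum of \<open>k powi (- m)\<close> over the nonzero integers \<open>k\<close> congruent to \<open>r\<close> modulo \<open>q\<close>, expressed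
  through the finite Fourier transform of the Bernoulli function.\<close>

definition residue_sum :: "nat \<Rightarrow> nat \<Rightarrow> int \<Rightarrow> complex" where
  "residue_sum m q r = - ((2 * pi * \<i>) ^ m / of_nat q) *
     (\<Sum>s<q. cis (2 * pi * (of_int (- r * int s) / q)) * of_real (bernf m (real s / q)))"

text \<open>The two-sided series of \<psi>(k) / k^m over nonzero integers k, grouped by residues:
  twice the L-value for matching parity, 0 otherwise.\<close>

definition char_sum :: "nat \<Rightarrow> nat \<Rightarrow> (int \<Rightarrow> complex) \<Rightarrow> complex" where
  "char_sum m q \<psi> = (\<Sum>r<q. \<psi> (int r) * residue_sum m q (int r))"

lemma sum_periodic_scale:
  fixes f :: "int \<Rightarrow> 'a::comm_monoid_add"
  assumes "\<And>x. f (x + int N) = f x" and "coprime c (int N)"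
  shows "(\<Sum>k<N. f (c * int k)) = (\<Sum>k<N. f (int k))"
  using sum_periodic_affine[of f N c 0] assms by simp

lemma cis_frac_periodic:
  assumes "N > 0"
  shows "cis (2 * pi * (of_int (c * (x + int N)) / N)) = cis (2 * pi * (of_int (c * x) / N))"
proof -
  have "2 * pi * (of_int (c * (x + int N)) / N) = 2 * pi * (of_int (c * x) / N) + 2 * pi * of_int c"
    using assms by (simp add: field_simps)
  then show ?thesis by (simp only: cis_mult[symmetric] cis_2pi_int mult_1_right)
qed

lemma residue_sum_periodic:
  assumes "q > 0"
  shows "residue_sum m q (r + int q) = residue_sum m q r"
proof -
  have "cis (2 * pi * (of_int (- (r + int q) * int s) / q)) = cis (2 * pi * (of_int (- r * int s) / q))" for s
  proof -
    have "- x * int s = - int s * x" for x by simp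
    then show ?thesis by (simp only: cis_frac_periodic[OF assms])
  qed
  then show ?thesis by (simp only: residue_sum_def)
qed

lemma residue_sum_minus:
  assumes "q > 0"
  shows "residue_sum m q (- r) = (-1) ^ m * residue_sum m q r"
proof -
  define f where "f = (\<lambda>s. cis (2 * pi * (of_int (- r * s) / q)) * complex_of_real (bernf m (of_int (1 * s) / q)))"
  have per: "f (s + int q) = f s" for s
    unfolding f_def by (simp only: cis_frac_periodic[OF assms] bernf_frac_periodic[OF assms])
  have "(\<Sum>s<q. cis (2 * pi * (of_int (- (- r) * int s) / q)) * of_real (bernf m (real s / q)))
     = (\<Sum>s<q. (-1) ^ m * f ((-1) * int s))"
    using bernf_minus[of m] by (intro sum.cong refl) (simp add: f_def)
  also have "\<dots> = (-1) ^ m * (\<Sum>s<q. f (int s))"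
    unfolding sum_distrib_left[symmetric] using sum_periodic_scale[of f q "-1", OF per] by simp
  finally show ?thesis by (simp add: residue_sum_def f_def)
qed

lemma periodic_fourier_inversion:
  fixes \<psi> :: "int \<Rightarrow> complex"
  assumes "q > 0" "\<And>x. \<psi> (x + int q) = \<psi> x"
  shows "(\<Sum>s<q. (\<Sum>r<q. \<psi> (int r) * cis (2 * pi * (of_int (- int r * int s) / q))) * cis (2 * pi * (of_int (k * int s) / q)))
    = of_nat q * \<psi> k"
proof -
  have "(\<Sum>s<q. (\<Sum>r<q. \<psi> (int r) * cis (2 * pi * (of_int (- int r * int s) / q))) * cis (2 * pi * (of_int (k * int s) / q)))
    = (\<Sum>s<q. \<Sum>r<q. \<psi> (int r) * cis (2 * pi * (of_int ((k - int r) * int s) / q)))"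
    unfolding sum_distrib_right mult.assoc[of _ "cis _" "cis _"] cis_mult
    by (intro sum.cong refl arg_cong2[where f = "(*)"] arg_cong[where f = cis])
       (simp add: algebra_simps diff_divide_distrib)
  also have "\<dots> = (\<Sum>r<q. \<psi> (int r) * (\<Sum>s<q. cis (2 * pi * (of_int ((k - int r) * int s) / q))))"
    by (subst sum.swap) (simp add: sum_distrib_left)
  also have "\<dots> = (\<Sum>r<q. if r = nat (k mod int q) then of_nat q * \<psi> k else 0)"
  proof (rule sum.cong[OF refl])
    fix r assume "r \<in> {..<q}"
    then have "int q dvd k - int r \<longleftrightarrow> r = nat (k mod int q)"
      using assms(1) by (auto simp: mod_eq_dvd_iff[symmetric])
    moreover have "\<psi> (int r) = \<psi> k" if "int q dvd k - int r"
      using that by (intro periodic_cong[of \<psi> q, OF assms(2)]) (simp add: cong_sym_eq cong_iff_dvd_diff dvd_diff_commute)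
    ultimately show "\<psi> (int r) * (\<Sum>s<q. cis (2 * pi * (of_int ((k - int r) * int s) / q)))
      = (if r = nat (k mod int q) then of_nat q * \<psi> k else 0)"
      unfolding sum_cis_multiples[OF assms(1)] by auto
  qed
  also have "\<dots> = of_nat q * \<psi> k" using assms(1) by (simp add: nat_less_iff)
  finally show ?thesis .
qed

text \<open>Fourier inversion modulo q writes \<psi>(k) as a finite combination of exponentials,
  each giving a Fourier series of \<open>bernf m\<close> at some s/q. Finitely many convergent
  series add in their natural order. For m = 1 the parity condition excludes the principal
  character, whose value at -1 is 1.\<close>

lemma dirichlet_L_eq_char_sum:
  assumes "q > 0" "m > 0" "dirichlet_character q \<psi>" "\<psi> (-1) = (-1) ^ m"
  shows "2 * dirichlet_L (of_nat m) \<psi> = char_sum m q \<psi>"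
proof -
  note D = dirichlet_characterD[OF assms(3)]
  define F where "F = (\<lambda>s::nat. \<Sum>r<q. \<psi> (int r) * cis (2 * pi * (of_int (- int r * int s) / q)))"
  define E where "E = (\<lambda>k s. cis (2 * pi * (of_int (k * int s) / q)))"
  have inv: "(\<Sum>s<q. F s * E k s) = of_nat q * \<psi> k" for k
    unfolding F_def E_def by (rule periodic_fourier_inversion[where \<psi> = \<psi>, OF assms(1) D(2)])
  have "(\<lambda>k. \<Sum>s<q. F s / of_nat q * ((E (int (Suc k)) s + (-1) ^ m * E (- int (Suc k)) s) / of_nat (Suc k) ^ m))
     sums (\<Sum>s<q. F s / of_nat q * (- ((2 * pi * \<i>) ^ m * of_real (bernf m (real s / q)))))"
  proof (intro sums_sum sums_mult)
    fix s
    show "(\<lambda>k. (E (int (Suc k)) s + (-1) ^ m * E (- int (Suc k)) s) / of_nat (Suc k) ^ m) sums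
      (- ((2 * pi * \<i>) ^ m * of_real (bernf m (real s / q))))"
      using bernf_fourier[OF assms(2), of "real s / q"] by (simp add: E_def del: of_nat_Suc)
  qed
  moreover have "(\<Sum>s<q. F s / of_nat q * ((E (int (Suc k)) s + (-1) ^ m * E (- int (Suc k)) s) / of_nat (Suc k) ^ m))
     = 2 * (\<psi> (int (Suc k)) * of_nat (Suc k) powr (- of_nat m))" for k
  proof -
    let ?k = "int (Suc k)"
    have "\<psi> (- ?k) = (-1) ^ m * \<psi> ?k" using D(1)[of "-1" ?k] assms(4) by simp
    \<comment> \<open>By parity the terms of k and -k are equal, which is the source of the factor
      2.\<close>
    then have sym: "(-1) ^ m * \<psi> (- ?k) = \<psi> ?k" by (simp add: mult.assoc[symmetric] power_mult_distrib[symmetric])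
    have "(\<Sum>s<q. F s / of_nat q * ((E ?k s + (-1) ^ m * E (- ?k) s) / of_nat (Suc k) ^ m))
      = ((\<Sum>s<q. F s * E ?k s) + (-1) ^ m * (\<Sum>s<q. F s * E (- ?k) s)) / (of_nat q * of_nat (Suc k) ^ m)"
      unfolding sum_distrib_left sum.distrib[symmetric] sum_divide_distrib
      by (intro sum.cong refl) (simp add: add_divide_distrib distrib_left mult_ac del: of_nat_Suc)
    also have "\<dots> = (\<psi> ?k + (-1) ^ m * \<psi> (- ?k)) / of_nat (Suc k) ^ m"
      unfolding inv using assms(1) by (simp add: field_simps del: of_nat_Suc)
    also have "\<dots> = 2 * (\<psi> ?k * of_nat (Suc k) powr (- of_nat m))"
      unfolding sym powr_minus by (simp add: powr_nat' divide_inverse del: of_nat_Suc)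
    finally show ?thesis .
  qed
  moreover have "(\<Sum>s<q. F s / of_nat q * (- ((2 * pi * \<i>) ^ m * of_real (bernf m (real s / q))))) = char_sum m q \<psi>"
  proof -
    have "char_sum m q \<psi> = (\<Sum>r<q. \<Sum>s<q. \<psi> (int r) * cis (2 * pi * (of_int (- int r * int s) / q)) / of_nat q *
        (- ((2 * pi * \<i>) ^ m * of_real (bernf m (real s / q)))))"
      unfolding char_sum_def residue_sum_def sum_distrib_left by (intro sum.cong refl) simp
    also have "\<dots> = (\<Sum>s<q. \<Sum>r<q. \<psi> (int r) * cis (2 * pi * (of_int (- int r * int s) / q)) / of_nat q *
        (- ((2 * pi * \<i>) ^ m * of_real (bernf m (real s / q)))))" by (rule sum.swap)
    also have "\<dots> = (\<Sum>s<q. F s / of_nat q * (- ((2 * pi * \<i>) ^ m * of_real (bernf m (real s / q)))))"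
      unfolding F_def sum_divide_distrib sum_distrib_right ..
    finally show ?thesis ..
  qed
  ultimately have "(\<lambda>k. 2 * (\<psi> (int (Suc k)) * of_nat (Suc k) powr (- of_nat m))) sums char_sum m q \<psi>" by simp
  from sums_divide[OF this, of 2]
  have "(\<lambda>k. \<psi> (int (Suc k)) * of_nat (Suc k) powr (- of_nat m)) sums (char_sum m q \<psi> / 2)" by simp
  then show ?thesis by (simp add: dirichlet_L_def sums_unique[symmetric] del: of_nat_Suc)
qed

lemma char_sum_wrong_parity:
  assumes "q > 0" "dirichlet_character q \<psi>" "\<psi> (-1) \<noteq> (-1) ^ m"
  shows "char_sum m q \<psi> = 0"
proof -
  note D = dirichlet_characterD[OF assms(2)]
  have "\<psi> (-1) * \<psi> (-1) = 1" using D(1)[of "-1" "-1"] D(4) by simp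
  then have "\<psi> (-1) = 1 \<or> \<psi> (-1) = -1" by (simp add: square_eq_1_iff)
  then have neg: "\<psi> (-1) * (-1) ^ m = -1" using assms(3) by (cases "even m") auto
  have "char_sum m q \<psi> = (\<Sum>r<q. \<psi> ((-1) * int r) * residue_sum m q ((-1) * int r))"
    unfolding char_sum_def
    by (rule sum_periodic_scale[symmetric, where f = "\<lambda>r. \<psi> r * residue_sum m q r"])
       (simp_all add: D(2) residue_sum_periodic[OF assms(1)])
  also have "\<dots> = (\<psi> (-1) * (-1) ^ m) * char_sum m q \<psi>"
    unfolding char_sum_def sum_distrib_left D(1) using residue_sum_minus[OF assms(1)] by (intro sum.cong) auto
  finally show ?thesis unfolding neg by simp
qed

lemma cong_scaled_iff:
  assumes "coprime c (int q)" "t < q" "u < q"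
  shows "[c * int t = c * int u] (mod int q) \<longleftrightarrow> t = u"
  using assms by (auto simp: cong_mult_lcancel cong_int_iff cong_less_modulus_unique_nat)

text \<open>Orthogonality leaves the pairs with a r congruent to b s. The substitutions r = b t and
  s = a u turn this into t = u, so b ends up with index m and a with index n.\<close>

lemma sum_char_sums:
  assumes "q > 0" "coprime a (int q)" "coprime b (int q)"
  shows "(\<Sum>\<psi> | dirichlet_character q \<psi>. \<psi> a * cnj (\<psi> b) * char_sum m q \<psi> * char_sum n q (\<lambda>k. cnj (\<psi> k)))
    = of_nat (totient q) * (\<Sum>t<q. if coprime (int t) (int q) then residue_sum m q (b * int t) * residue_sum n q (a * int t) else 0)"
proof -
  let ?X = "{\<psi>. dirichlet_character q \<psi>}"
  let ?P = "residue_sum m q" and ?Q = "residue_sum n q"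
  define K where "K = (\<lambda>x y. if coprime x (int q) \<and> [x = y] (mod int q) then of_nat (totient q) else 0 :: complex)"
  have Kper: "K (x + int q * i) (y + int q * j) = K x y" for x y i j
  proof -
    have "[x + int q * i = x] (mod int q)" "[y + int q * j = y] (mod int q)" by (simp_all add: cong_def)
    then show ?thesis unfolding K_def
      by (metis cong_imp_coprime cong_sym cong_trans)
  qed
  have "(\<Sum>\<psi>\<in>?X. \<psi> a * cnj (\<psi> b) * char_sum m q \<psi> * char_sum n q (\<lambda>k. cnj (\<psi> k)))
    = (\<Sum>\<psi>\<in>?X. \<Sum>r<q. \<Sum>s<q. ?P (int r) * ?Q (int s) * (\<psi> (a * int r) * cnj (\<psi> (b * int s))))"
  proof (rule sum.cong[OF refl])
    fix \<psi> assume "\<psi> \<in> ?X"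
    then have "\<psi> (x * y) = \<psi> x * \<psi> y" for x y by (simp add: dirichlet_characterD)
    then show "\<psi> a * cnj (\<psi> b) * char_sum m q \<psi> * char_sum n q (\<lambda>k. cnj (\<psi> k))
      = (\<Sum>r<q. \<Sum>s<q. ?P (int r) * ?Q (int s) * (\<psi> (a * int r) * cnj (\<psi> (b * int s))))"
      by (simp add: char_sum_def sum_distrib_left sum_distrib_right mult_ac)
  qed
  also have "\<dots> = (\<Sum>r<q. \<Sum>\<psi>\<in>?X. \<Sum>s<q. ?P (int r) * ?Q (int s) * (\<psi> (a * int r) * cnj (\<psi> (b * int s))))"
    by (rule sum.swap)
  also have "\<dots> = (\<Sum>r<q. \<Sum>s<q. \<Sum>\<psi>\<in>?X. ?P (int r) * ?Q (int s) * (\<psi> (a * int r) * cnj (\<psi> (b * int s))))"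
    by (intro sum.cong refl sum.swap)
  also have "\<dots> = (\<Sum>r<q. \<Sum>s<q. ?P (int r) * ?Q (int s) * K (a * int r) (b * int s))"
    unfolding K_def dirichlet_character_orthogonality[OF assms(1), symmetric] by (simp add: sum_distrib_left)
  also have "\<dots> = (\<Sum>r<q. \<Sum>u<q. ?P (int r) * ?Q (a * int u) * K (a * int r) (b * (a * int u)))"
  proof (rule sum.cong[OF refl])
    fix r
    show "(\<Sum>s<q. ?P (int r) * ?Q (int s) * K (a * int r) (b * int s)) = (\<Sum>u<q. ?P (int r) * ?Q (a * int u) * K (a * int r) (b * (a * int u)))"
    proof (rule sum_periodic_scale[symmetric, where f = "\<lambda>s. ?P (int r) * ?Q s * K (a * int r) (b * s)"])
      fix x
      show "?P (int r) * ?Q (x + int q) * K (a * int r) (b * (x + int q)) = ?P (int r) * ?Q x * K (a * int r) (b * x)"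
        using Kper[of "a * int r" 0 "b * x" b] by (simp add: residue_sum_periodic[OF assms(1)] algebra_simps)
    qed (rule assms(2))
  qed
  also have "\<dots> = (\<Sum>t<q. \<Sum>u<q. ?P (b * int t) * ?Q (a * int u) * K (a * (b * int t)) (b * (a * int u)))"
  proof (rule sum_periodic_scale[symmetric, where f = "\<lambda>r. \<Sum>u<q. ?P r * ?Q (a * int u) * K (a * r) (b * (a * int u))"])
    fix x
    have "K (a * (x + int q)) y = K (a * x) y" for y
      using Kper[of "a * x" a y 0] by (simp add: algebra_simps)
    then show "(\<Sum>u<q. ?P (x + int q) * ?Q (a * int u) * K (a * (x + int q)) (b * (a * int u)))
       = (\<Sum>u<q. ?P x * ?Q (a * int u) * K (a * x) (b * (a * int u)))"
      by (simp add: residue_sum_periodic[OF assms(1)])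
  qed (rule assms(3))
  also have "\<dots> = (\<Sum>t<q. \<Sum>u<q. if u = t then (if coprime (int t) (int q) then of_nat (totient q) * (?P (b * int t) * ?Q (a * int t)) else 0) else 0)"
  proof (intro sum.cong refl)
    fix t u assume tu: "t \<in> {..<q}" "u \<in> {..<q}"
    have "[a * (b * int t) = b * (a * int u)] (mod int q) \<longleftrightarrow> t = u"
      using cong_scaled_iff[of "a * b" q t u] assms tu by (simp add: mult_ac)
    moreover have "coprime (a * (b * int t)) (int q) \<longleftrightarrow> coprime (int t) (int q)"
      using assms by simp
    ultimately show "?P (b * int t) * ?Q (a * int u) * K (a * (b * int t)) (b * (a * int u)) =
      (if u = t then (if coprime (int t) (int q) then of_nat (totient q) * (?P (b * int t) * ?Q (a * int t)) else 0) else 0)"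
      unfolding K_def by auto
  qed
  also have "\<dots> = (\<Sum>t<q. if coprime (int t) (int q) then of_nat (totient q) * (?P (b * int t) * ?Q (a * int t)) else 0)"
    by (intro sum.cong refl) (simp add: sum.delta)
  finally show ?thesis by (simp add: sum_distrib_left if_distrib[of "\<lambda>x. of_nat (totient q) * x"] cong: if_cong)
qed

lemma dirichlet_V_eq:
  assumes "q > 0" "m > 0" "n > 0" "coprime a (int q)" "coprime b (int q)" "(-1) ^ m = ((-1) ^ n :: complex)"
  shows "4 * dirichlet_V q m n a b =
    of_nat (totient q) * (\<Sum>t<q. if coprime (int t) (int q) then residue_sum m q (b * int t) * residue_sum n q (a * int t) else 0)"
proof -
  let ?X = "{\<psi>. dirichlet_character q \<psi>}"
  have "4 * dirichlet_V q m n a b = (\<Sum>\<psi> | dirichlet_character q \<psi> \<and> \<psi> (-1) = (-1) ^ m.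
     \<psi> a * cnj (\<psi> b) * char_sum m q \<psi> * char_sum n q (\<lambda>k. cnj (\<psi> k)))"
    unfolding dirichlet_V_def sum_distrib_left
  proof (rule sum.cong)
    fix \<psi> assume "\<psi> \<in> {\<psi>. dirichlet_character q \<psi> \<and> \<psi> (- 1) = (- 1) ^ m}"
    then have \<psi>: "dirichlet_character q \<psi>" "\<psi> (-1) = (-1) ^ m" by auto
    have 1: "2 * dirichlet_L (of_nat m) \<psi> = char_sum m q \<psi>"
      by (rule dirichlet_L_eq_char_sum[OF assms(1,2) \<psi>])
    have 2: "2 * dirichlet_L (of_nat n) (\<lambda>k. cnj (\<psi> k)) = char_sum n q (\<lambda>k. cnj (\<psi> k))"
      using \<psi> assms(6) by (intro dirichlet_L_eq_char_sum assms dirichlet_character_cnj) auto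
    show "4 * (\<psi> a * cnj (\<psi> b) * dirichlet_L (of_nat m) \<psi> * dirichlet_L (of_nat n) (\<lambda>k. cnj (\<psi> k))) =
      \<psi> a * cnj (\<psi> b) * char_sum m q \<psi> * char_sum n q (\<lambda>k. cnj (\<psi> k))"
      unfolding 1[symmetric] 2[symmetric] by simp
  qed (use assms(6) in auto)
  also have "\<dots> = (\<Sum>\<psi>\<in>?X. \<psi> a * cnj (\<psi> b) * char_sum m q \<psi> * char_sum n q (\<lambda>k. cnj (\<psi> k)))"
    by (rule sum.mono_neutral_left)
       (auto simp: char_sum_wrong_parity[OF assms(1)] finite_dirichlet_characters[OF assms(1)])
  also have "\<dots> = of_nat (totient q) * (\<Sum>t<q. if coprime (int t) (int q) then residue_sum m q (b * int t) * residue_sum n q (a * int t) else 0)"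
    by (rule sum_char_sums[OF assms(1,4,5)])
  finally show ?thesis .
qed

section \<open>Reduction to Dedekind sums\<close>

text \<open>The integers congruent to e r modulo e d are e times those congruent to r modulo d. On
  the finite side, s is split modulo d and the multiplication theorem sums the shifts by
  k/e.\<close>

lemma residue_sum_scale:
  assumes "d > 0" "e > 0"
  shows "of_nat e ^ m * residue_sum m (e * d) (int (e * r)) = residue_sum m d (int r)"
proof -
  let ?q = "e * d"
  let ?c = "\<lambda>s. cis (2 * pi * (of_int (- int r * int s) / d))"
  have "(\<Sum>s<?q. cis (2 * pi * (of_int (- int (e * r) * int s) / real ?q)) * of_real (bernf m (real s / real ?q)))
    = (\<Sum>s<?q. ?c s * of_real (bernf m (real s / real ?q)))"
    using assms by (intro sum.cong refl) (simp add: mult_ac)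
  also have "\<dots> = (\<Sum>k<e. \<Sum>s\<in>{k * d..<k * d + d}. ?c s * of_real (bernf m (real s / real ?q)))"
    by (rule sum.nat_group[symmetric])
  also have "\<dots> = (\<Sum>k<e. \<Sum>s<d. ?c s * of_real (bernf m (real s / real ?q + real k / e)))"
  proof (rule sum.cong[OF refl])
    fix k
    have "(\<Sum>s\<in>{k * d..<k * d + d}. ?c s * of_real (bernf m (real s / real ?q)))
      = (\<Sum>s<d. ?c (s + k * d) * of_real (bernf m (real (s + k * d) / real ?q)))"
      by (rule sum.reindex_bij_witness[of _ "\<lambda>s. s + k * d" "\<lambda>s. s - k * d"]) auto
    also have "\<dots> = (\<Sum>s<d. ?c s * of_real (bernf m (real s / real ?q + real k / e)))"
    proof (intro sum.cong refl arg_cong2[where f = "(*)"])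
      fix s
      show "?c (s + k * d) = ?c s"
        by (rule periodic_cong[of "\<lambda>x. cis (2 * pi * (of_int (- int r * x) / d))" d "int (s + k * d)" "int s", OF cis_frac_periodic[OF assms(1)]])
           (simp add: cong_def)
      have "real (s + k * d) / real ?q = real s / real ?q + real k / e"
        using assms by (simp add: field_simps)
      then show "complex_of_real (bernf m (real (s + k * d) / real ?q)) = of_real (bernf m (real s / real ?q + real k / e))"
        by simp
    qed
    finally show "(\<Sum>s\<in>{k * d..<k * d + d}. ?c s * of_real (bernf m (real s / real ?q)))
      = (\<Sum>s<d. ?c s * of_real (bernf m (real s / real ?q + real k / e)))" .
  qed
  also have "\<dots> = (\<Sum>s<d. ?c s * of_real (\<Sum>k<e. bernf m (real s / real ?q + real k / e)))"
    by (subst sum.swap) (simp add: sum_distrib_left)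
  finally have "of_nat e ^ m * (\<Sum>s<?q. cis (2 * pi * (of_int (- int (e * r) * int s) / real ?q)) * of_real (bernf m (real s / real ?q)))
    = (\<Sum>s<d. ?c s * of_real (real e ^ m * (\<Sum>k<e. bernf m (real s / real ?q + real k / e))))"
    by (simp add: sum_distrib_left mult_ac)
  also have "\<dots> = (\<Sum>s<d. ?c s * of_real (real e * bernf m (real s / d)))"
    unfolding bernf_mult[OF assms(2)] using assms by simp
  also have "\<dots> = of_nat e * (\<Sum>s<d. ?c s * of_real (bernf m (real s / d)))"
    by (simp add: sum_distrib_left mult_ac)
  finally have *: "of_nat e ^ m * (\<Sum>s<?q. cis (2 * pi * (of_int (- int (e * r) * int s) / real ?q)) * of_real (bernf m (real s / real ?q)))
    = of_nat e * (\<Sum>s<d. ?c s * of_real (bernf m (real s / d)))" .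
  have "of_nat e ^ m * residue_sum m ?q (int (e * r)) = - ((2 * pi * \<i>) ^ m / of_nat ?q) *
    (of_nat e ^ m * (\<Sum>s<?q. cis (2 * pi * (of_int (- int (e * r) * int s) / real ?q)) * of_real (bernf m (real s / real ?q))))"
    by (simp only: residue_sum_def mult.left_commute)
  also have "\<dots> = residue_sum m d (int r)"
    unfolding * residue_sum_def using assms by simp
  finally show ?thesis .
qed

text \<open>Summing the exponentials over s leaves the pairs with b u + a v divisible by d. Scaling
  u by a and v by -b makes this u = v, and the minus sign gives \<open>(-1) ^ n\<close> by
  parity.\<close>

lemma sum_residue_sums_dedekind:
  assumes "d > 0" "coprime a d" "coprime b d" "m > 0" "n > 0"
  shows "of_nat d ^ (m + n) * (\<Sum>s<d. residue_sum m d (int b * int s) * residue_sum n d (int a * int s))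
    = (2 * pi * \<i>) ^ (m + n) * (-1) ^ n * of_real (dedekind_sum m n d a b)"
proof -
  define g where "g = (\<lambda>i x. complex_of_real (bernf i (of_int (1 * x) / d)))"
  have gper: "g i (x + int d) = g i x" for i x
    unfolding g_def by (simp only: bernf_frac_periodic[OF assms(1)])
  define c where "c = (\<lambda>x. cis (2 * pi * (of_int x / d)))"
  define \<kappa> where "\<kappa> = (\<lambda>x. if int d dvd x then of_nat d else 0 :: complex)"
  have \<kappa>per: "\<kappa> (x + int d * j) = \<kappa> x" for x j
    unfolding \<kappa>_def by (metis dvd_add_left_iff dvd_triv_left)
  have sum_c: "(\<Sum>s<d. c (- x * int s)) = \<kappa> x" for x
    using sum_cis_multiples[OF assms(1), of "- x"] by (simp add: c_def \<kappa>_def)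
  have cop: "coprime (int a) (int d)" "coprime (int b) (int d)" using assms by auto
  have rs: "residue_sum i d (x * int s) = - ((2 * pi * \<i>) ^ i / of_nat d) * (\<Sum>u<d. c (- (x * int u) * int s) * g i (int u))" for i x s
    unfolding residue_sum_def g_def c_def by (simp add: mult_ac)
  have factor: "(- (A / D) * X) * (- (B / D) * Y) = A * B / D ^ 2 * (X * Y)" for A B D X Y :: complex
    by (simp add: power2_eq_square)
  have "(\<Sum>s<d. residue_sum m d (int b * int s) * residue_sum n d (int a * int s))
     = (2 * pi * \<i>) ^ (m + n) / of_nat d ^ 2 * (\<Sum>s<d. (\<Sum>u<d. c (- (int b * int u) * int s) * g m (int u)) * (\<Sum>v<d. c (- (int a * int v) * int s) * g n (int v)))"
    unfolding rs factor power_add by (rule sum_distrib_left[symmetric])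
  also have "(\<Sum>s<d. (\<Sum>u<d. c (- (int b * int u) * int s) * g m (int u)) * (\<Sum>v<d. c (- (int a * int v) * int s) * g n (int v)))
     = (\<Sum>s<d. \<Sum>u<d. \<Sum>v<d. g m (int u) * g n (int v) * c (- (int b * int u + int a * int v) * int s))"
    unfolding sum_product
  proof (intro sum.cong refl)
    fix s u v
    have "c (- (int b * int u) * int s) * c (- (int a * int v) * int s) = c (- (int b * int u + int a * int v) * int s)"
      unfolding c_def cis_mult by (rule arg_cong[where f = cis]) (simp add: algebra_simps diff_divide_distrib)
    then show "c (- (int b * int u) * int s) * g m (int u) * (c (- (int a * int v) * int s) * g n (int v))
       = g m (int u) * g n (int v) * c (- (int b * int u + int a * int v) * int s)"
      by (simp add: mult_ac)
  qed
  also have "\<dots> = (\<Sum>u<d. \<Sum>s<d. \<Sum>v<d. g m (int u) * g n (int v) * c (- (int b * int u + int a * int v) * int s))"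
    by (rule sum.swap)
  also have "\<dots> = (\<Sum>u<d. \<Sum>v<d. \<Sum>s<d. g m (int u) * g n (int v) * c (- (int b * int u + int a * int v) * int s))"
    by (rule sum.cong[OF refl], rule sum.swap)
  also have "\<dots> = (\<Sum>u<d. \<Sum>v<d. g m (int u) * g n (int v) * \<kappa> (int b * int u + int a * int v))"
    unfolding sum_distrib_left[symmetric] sum_c ..
  also have "\<dots> = (\<Sum>u<d. \<Sum>v<d. g m (int u) * g n (- int b * int v) * \<kappa> (int b * int u + int a * (- int b * int v)))"
  proof (rule sum.cong[OF refl])
    fix u
    show "(\<Sum>v<d. g m (int u) * g n (int v) * \<kappa> (int b * int u + int a * int v))
      = (\<Sum>v<d. g m (int u) * g n (- int b * int v) * \<kappa> (int b * int u + int a * (- int b * int v)))"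
    proof (rule sum_periodic_scale[symmetric, where f = "\<lambda>v. g m (int u) * g n v * \<kappa> (int b * int u + int a * v)"])
      fix x
      show "g m (int u) * g n (x + int d) * \<kappa> (int b * int u + int a * (x + int d)) = g m (int u) * g n x * \<kappa> (int b * int u + int a * x)"
        using \<kappa>per[of "int b * int u + int a * x" "int a"] by (simp add: gper algebra_simps)
    qed (use cop in simp)
  qed
  also have "\<dots> = (\<Sum>u<d. \<Sum>v<d. g m (int a * int u) * g n (- int b * int v) * \<kappa> (int b * (int a * int u) + int a * (- int b * int v)))"
  proof (rule sum_periodic_scale[symmetric, where f = "\<lambda>u. \<Sum>v<d. g m u * g n (- int b * int v) * \<kappa> (int b * u + int a * (- int b * int v))"])
    fix x
    have "\<kappa> (int b * (x + int d) + y) = \<kappa> (int b * x + y)" for y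
      using \<kappa>per[of "int b * x + y" "int b"] by (simp add: algebra_simps)
    then show "(\<Sum>v<d. g m (x + int d) * g n (- int b * int v) * \<kappa> (int b * (x + int d) + int a * (- int b * int v)))
       = (\<Sum>v<d. g m x * g n (- int b * int v) * \<kappa> (int b * x + int a * (- int b * int v)))"
      by (simp only: gper)
  qed (use cop in simp)
  also have "\<dots> = (\<Sum>u<d. \<Sum>v<d. if v = u then of_nat d * ((-1) ^ n * (g m (int a * int u) * g n (int b * int u))) else 0)"
  proof (intro sum.cong refl)
    fix u v assume uv: "u \<in> {..<d}" "v \<in> {..<d}"
    have "int b * (int a * int u) + int a * (- int b * int v) = int (a * b) * int u - int (a * b) * int v"
      by (simp add: algebra_simps)
    then have "int d dvd int b * (int a * int u) + int a * (- int b * int v) \<longleftrightarrow> [int (a * b) * int u = int (a * b) * int v] (mod int d)"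
      by (simp only: cong_iff_dvd_diff)
    also have "\<dots> \<longleftrightarrow> u = v" using uv cop by (intro cong_scaled_iff) auto
    finally have "\<kappa> (int b * (int a * int u) + int a * (- int b * int v)) = (if v = u then of_nat d else 0)"
      unfolding \<kappa>_def by auto
    moreover have "g n (- int b * int v) = (-1) ^ n * g n (int b * int v)"
      unfolding g_def using bernf_minus[of n "real_of_int (1 * (int b * int v)) / d"] by simp
    ultimately show "g m (int a * int u) * g n (- int b * int v) * \<kappa> (int b * (int a * int u) + int a * (- int b * int v))
      = (if v = u then of_nat d * ((-1) ^ n * (g m (int a * int u) * g n (int b * int u))) else 0)" by simp
  qed
  also have "\<dots> = of_nat d * (-1) ^ n * (\<Sum>u<d. g m (int a * int u) * g n (int b * int u))"
    by (simp add: sum.delta sum_distrib_left mult_ac)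
  also have "(\<Sum>u<d. g m (int a * int u) * g n (int b * int u)) = of_real (\<Sum>w<d. bernf m (real (a * w) / d) * bernf n (real (b * w) / d))"
    by (simp add: g_def)
  finally have "of_nat d ^ (m + n) * (\<Sum>s<d. residue_sum m d (int b * int s) * residue_sum n d (int a * int s))
     = (2 * pi * \<i>) ^ (m + n) * (-1) ^ n * ((of_nat d ^ (m + n) * of_nat d / of_nat d ^ 2) * of_real (\<Sum>w<d. bernf m (real (a * w) / d) * bernf n (real (b * w) / d)))"
    by simp
  \<comment> \<open>Each residue sum carries 1/d and the orthogonality of exponentials returns one
    d, so the total power is m + n - 1, as in \<open>dedekind_sum\<close>.\<close>
  also have "of_nat d ^ (m + n) * of_nat d / of_nat d ^ 2 = complex_of_real (real d ^ (m + n - 1))"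
  proof -
    have "complex_of_nat d ^ (m + n) = of_nat d ^ (m + n - 1) * of_nat d"
      using assms(4) by (metis add_gr_0 power_minus_mult)
    then show ?thesis using assms(1) by (simp add: power2_eq_square)
  qed
  finally show ?thesis by (simp add: dedekind_sum_def)
qed

lemma dedekind_sum_parity:
  assumes "d > 0" "(-1) ^ m \<noteq> ((-1) ^ n :: real)"
  shows "dedekind_sum m n d a b = 0"
proof -
  define f where "f = (\<lambda>w::int. bernf m (of_int (int a * w) / d) * bernf n (of_int (int b * w) / d))"
  have per: "f (w + int d) = f w" for w
    unfolding f_def by (simp only: bernf_frac_periodic[OF assms(1)])
  have sign: "(-1) ^ m * (-1) ^ n = (-1::real)" using assms(2) by (cases "even m"; cases "even n") auto
  have "f (- w) = ((-1) ^ m * (-1) ^ n) * f w" for w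
    by (simp add: f_def bernf_minus)
  then have neg: "f (- w) = - f w" for w by (simp add: sign)
  have "(\<Sum>w<d. f (int w)) = (\<Sum>w<d. f ((-1) * int w))"
    using sum_periodic_scale[of f d "-1", OF per] by simp
  also have "\<dots> = - (\<Sum>w<d. f (int w))"
    by (simp add: neg sum_negf)
  finally have "(\<Sum>w<d. f (int w)) = 0" by simp
  then show ?thesis by (simp add: dedekind_sum_def f_def)
qed

lemma dirichlet_V_dedekind:
  assumes "q > 0" "m > 0" "n > 0" "coprime a q" "coprime b q"
  shows "4 * dirichlet_V q m n (int a) (int b) =
    of_nat (totient q) * (2 * pi * \<i>) ^ (m + n) * (-1) ^ n / of_nat q ^ (m + n) *
    of_real (\<Sum>d | d dvd q. moebius_mu (q div d) * dedekind_sum m n d a b)"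
proof (cases "(-1) ^ m = ((-1) ^ n :: complex)")
  case False
  then have ne: "(-1) ^ m \<noteq> ((-1) ^ n :: real)"
    by (cases "even m"; cases "even n") auto
  have "dedekind_sum m n d a b = 0" if "d dvd q" for d
    by (rule dedekind_sum_parity[OF dvd_pos_nat[OF assms(1) that] ne])
  moreover have "dirichlet_V q m n (int a) (int b) = 0" using False by (simp add: dirichlet_V_def)
  ultimately show ?thesis by simp
next
  case True
  define F where "F = (\<lambda>x. residue_sum m q (int b * x) * residue_sum n q (int a * x))"
  have "4 * dirichlet_V q m n (int a) (int b) =
    of_nat (totient q) * (\<Sum>t<q. if coprime (int t) (int q) then F (int t) else 0)"
    unfolding F_def using assms True by (intro dirichlet_V_eq) auto
  also have "(\<Sum>t<q. if coprime (int t) (int q) then F (int t) else 0)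
    = (\<Sum>d | d dvd q. of_real (moebius_mu (q div d)) * (\<Sum>s<d. F (int (q div d * s))))"
    by (rule sum_coprime_moebius[OF assms(1)])
  also have "\<dots> = (\<Sum>d | d dvd q. (2 * pi * \<i>) ^ (m + n) * (-1) ^ n / of_nat q ^ (m + n) *
      of_real (moebius_mu (q div d) * dedekind_sum m n d a b))"
  proof (rule sum.cong[OF refl])
    fix d assume "d \<in> {d. d dvd q}"
    then have "d dvd q" by simp
    then obtain e where "q = d * e" ..
    then have q: "q = e * d" by simp
    then have de: "d > 0" "e > 0" using assms(1) by auto
    have cop: "coprime a d" "coprime b d" using assms(4,5) unfolding q by auto
    \<comment> \<open>At multiples of e = q/d both residue sums descend to the modulus d, so each
      divisor contributes a Dedekind sum of its own modulus with the common denominator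
      \<open>q ^ (m + n)\<close>.\<close>
    have "of_nat e ^ (m + n) * F (int (e * s)) = residue_sum m d (int b * int s) * residue_sum n d (int a * int s)" for s
    proof -
      have "of_nat e ^ (m + n) * F (int (e * s)) =
        (of_nat e ^ m * residue_sum m (e * d) (int (e * (b * s)))) * (of_nat e ^ n * residue_sum n (e * d) (int (e * (a * s))))"
        unfolding F_def q by (simp add: power_add mult_ac)
      then show ?thesis unfolding residue_sum_scale[OF de] by simp
    qed
    then have "of_nat e ^ (m + n) * (\<Sum>s<d. F (int (e * s))) = (\<Sum>s<d. residue_sum m d (int b * int s) * residue_sum n d (int a * int s))"
      by (simp only: sum_distrib_left)
    then have "of_nat q ^ (m + n) * (\<Sum>s<d. F (int (e * s)))
      = of_nat d ^ (m + n) * (\<Sum>s<d. residue_sum m d (int b * int s) * residue_sum n d (int a * int s))"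
      unfolding q by (simp add: power_mult_distrib mult_ac)
    also have "\<dots> = (2 * pi * \<i>) ^ (m + n) * (-1) ^ n * of_real (dedekind_sum m n d a b)"
      by (rule sum_residue_sums_dedekind[OF de(1) cop assms(2,3)])
    finally have "(\<Sum>s<d. F (int (e * s))) = (2 * pi * \<i>) ^ (m + n) * (-1) ^ n * of_real (dedekind_sum m n d a b) / of_nat q ^ (m + n)"
      using assms(1) by (simp only: eq_divide_eq of_nat_eq_0_iff power_eq_0_iff) (simp only: mult.commute, simp)
    moreover have "q div d = e" unfolding q using de by simp
    ultimately show "of_real (moebius_mu (q div d)) * (\<Sum>s<d. F (int (q div d * s)))
      = (2 * pi * \<i>) ^ (m + n) * (-1) ^ n / of_nat q ^ (m + n) * of_real (moebius_mu (q div d) * dedekind_sum m n d a b)"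
      by (simp only: of_real_mult times_divide_eq_left times_divide_eq_right mult_ac)
  qed
  also have "\<dots> = (2 * pi * \<i>) ^ (m + n) * (-1) ^ n / of_nat q ^ (m + n) *
      of_real (\<Sum>d | d dvd q. moebius_mu (q div d) * dedekind_sum m n d a b)"
    unfolding sum_distrib_left[symmetric] of_real_sum ..
  finally show ?thesis by simp
qed

text \<open>Restoring the factorials of the Bernoulli functions turns n (m choose j) / (m + n - j)
  into m! n! times the binomial of the convolution; the rest is interchanging sums.\<close>

lemma bernoulli_R_recip_term:
  assumes "m > 0" "n > 0"
  shows "bernoulli_R m n q a b = fact m * fact n * (\<Sum>d | d dvd q. moebius_mu (q div d) * recip_term m n d a b)"
proof -
  let ?c = "\<lambda>j. real ((m + n - 1 - j) choose (n - 1)) * ((-1) ^ j * real a ^ (m - j))"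
  let ?t = "\<lambda>j l d. bernf j (real (a * l) / b) * (moebius_mu (q div d) * (real d ^ j * bernf (m + n - j) (real (d * l) / b)))"
  have bfun: "bernoulli_fun i x = fact i * bernf i x" for i x by (simp add: bernf_def)
  have coeff: "real n * (real (m choose j) / real (m + n - j)) * (fact j * fact (m + n - j))
      = fact m * fact n * real ((m + n - 1 - j) choose (n - 1))" if "j \<le> m" for j
  proof -
    obtain k where n: "n = Suc k" using assms by (cases n) auto
    obtain i where m: "m = j + i" using le_Suc_ex[OF \<open>j \<le> m\<close>] by blast
    have idx: "m + n - j = Suc (k + i)" "m + n - 1 - j = k + i" "n - 1 = k" by (simp_all add: m n)
    have b1: "real (m choose j) = fact m / (fact j * fact i)" using binomial_fact[OF that] by (simp add: m)
    have b2: "real ((k + i) choose k) = fact (k + i) / (fact k * fact i)"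
      by (subst binomial_fact) auto
    have f1: "fact n = real n * fact k" by (simp add: n)
    have f2: "fact (Suc (k + i)) = real (Suc (k + i)) * fact (k + i)" by simp
    have "N * (M / (J * I) / S) * (J * (S * K)) = M * (N * L) * (K / (L * I))"
      if "J \<noteq> 0" "S \<noteq> 0" "L \<noteq> 0" for N M J I S K L :: real
      using that by (simp add: field_simps)
    then show ?thesis unfolding idx b1 b2 f1 f2 by simp
  qed
  have pull1: "y * (\<Sum>j\<le>m. x * X j) = x * (y * (\<Sum>j\<le>m. X j))" for x y :: real and X
    by (simp add: sum_distrib_left mult_ac)
  have pull2: "(\<Sum>l=1..b. \<Sum>d | d dvd q. x * X l d) = x * (\<Sum>l=1..b. \<Sum>d | d dvd q. X l d)" for x :: real and X
    by (simp add: sum_distrib_left)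
  have regroup: "x * (y * (z / w)) * (u * v) = x * (y / w) * u * z * v" for x y z w u v :: real
    by (simp add: mult_ac)
  have "bernoulli_R m n q a b = real b ^ (n - 1) * (\<Sum>j\<le>m. real n * (real (m choose j) * ((-1) ^ j * real a ^ (m - j) / real (m + n - j))) *
      (\<Sum>l=1..b. \<Sum>d | d dvd q. (fact j * fact (m + n - j)) * ?t j l d))"
    unfolding bernoulli_R_def bfun atLeast0AtMost by (simp add: sum_distrib_left mult_ac)
  also have "\<dots> = real b ^ (n - 1) * (\<Sum>j\<le>m. fact m * fact n * (?c j * (\<Sum>l=1..b. \<Sum>d | d dvd q. ?t j l d)))"
  proof (intro arg_cong[where f = "\<lambda>x. real b ^ (n - 1) * x"] sum.cong refl)
    fix j assume "j \<in> {..m}"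
    then have j: "j \<le> m" by simp
    have "real n * (real (m choose j) * ((-1) ^ j * real a ^ (m - j) / real (m + n - j))) *
      (\<Sum>l=1..b. \<Sum>d | d dvd q. (fact j * fact (m + n - j)) * ?t j l d)
      = (real n * (real (m choose j) / real (m + n - j)) * (fact j * fact (m + n - j))) * ((-1) ^ j * real a ^ (m - j)) *
      (\<Sum>l=1..b. \<Sum>d | d dvd q. ?t j l d)"
      by (simp only: pull2 regroup)
    then show "real n * (real (m choose j) * ((-1) ^ j * real a ^ (m - j) / real (m + n - j))) *
      (\<Sum>l=1..b. \<Sum>d | d dvd q. (fact j * fact (m + n - j)) * ?t j l d)
      = fact m * fact n * (?c j * (\<Sum>l=1..b. \<Sum>d | d dvd q. ?t j l d))"
      unfolding coeff[OF j] by (simp only: mult_ac)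
  qed
  also have "\<dots> = fact m * fact n * (real b ^ (n - 1) * (\<Sum>j\<le>m. ?c j * (\<Sum>l=1..b. \<Sum>d | d dvd q. ?t j l d)))"
    by (rule pull1)
  also have "real b ^ (n - 1) * (\<Sum>j\<le>m. ?c j * (\<Sum>l=1..b. \<Sum>d | d dvd q. ?t j l d))
    = (\<Sum>d | d dvd q. moebius_mu (q div d) * recip_term m n d a b)"
  proof -
    have "(\<Sum>j\<le>m. ?c j * (\<Sum>l=1..b. \<Sum>d | d dvd q. ?t j l d)) = (\<Sum>j\<le>m. \<Sum>d | d dvd q. \<Sum>l=1..b. ?c j * ?t j l d)"
      unfolding sum_distrib_left by (rule sum.cong[OF refl], rule sum.swap)
    also have "\<dots> = (\<Sum>d | d dvd q. \<Sum>j\<le>m. \<Sum>l=1..b. ?c j * ?t j l d)" by (rule sum.swap)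
    finally have "real b ^ (n - 1) * (\<Sum>j\<le>m. ?c j * (\<Sum>l=1..b. \<Sum>d | d dvd q. ?t j l d))
      = (\<Sum>d | d dvd q. real b ^ (n - 1) * (\<Sum>j\<le>m. \<Sum>l=1..b. ?c j * ?t j l d))"
      by (simp only: sum_distrib_left)
    also have "\<dots> = (\<Sum>d | d dvd q. moebius_mu (q div d) * recip_term m n d a b)"
      unfolding recip_term_def
    proof (rule sum.cong[OF refl])
      fix d
      show "real b ^ (n - 1) * (\<Sum>j\<le>m. \<Sum>l=1..b. ?c j * ?t j l d) = moebius_mu (q div d) * (real b ^ (n - 1) *
        (\<Sum>j\<le>m. ?c j * (\<Sum>l=1..b. bernf j (real (a * l) / b) * (real d ^ j * bernf (m + n - j) (real (d * l) / b)))))"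
        unfolding sum_distrib_left by (intro sum.cong refl) (simp only: mult_ac)
    qed
    finally show ?thesis .
  qed
  finally show ?thesis .
qed

text \<open>Reciprocity is summed over the divisors: Moebius inversion turns
  \<open>d ^ (m + n)\<close> into Jordan's function of q and the linear correction into the
  totient.\<close>

lemma sum_moebius_dedekind:
  assumes "q > 0" "m > 0" "n > 0" "a > 0" "b > 0" "coprime a q"
  shows "complex_of_real (fact m * fact n * (\<Sum>d | d dvd q. moebius_mu (q div d) * dedekind_sum m n d a b))
    = of_real (bernoulli_R m n q a b) + of_real (bernoulli_R n m q b a) + const_C1 m n q a b"
proof -
  let ?\<mu> = "\<lambda>d. moebius_mu (q div d)"
  let ?S = "\<lambda>f. \<Sum>d | d dvd q. ?\<mu> d * f d"
  define k where "k = (-1) ^ (n - 1) * real (gcd a b) ^ (m + n) * bern (m + n) 0 / (real a ^ n * real b ^ m)"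
  define \<epsilon> where "\<epsilon> = (if m = 1 \<and> n = 1 then 1 / 4 else 0 :: real)"
  have pull: "(\<Sum>d | d dvd q. ?\<mu> d * (c * f d)) = c * ?S f" for c f
    by (simp add: sum_distrib_left mult_ac)
  have "?S (\<lambda>d. dedekind_sum m n d a b) = ?S (\<lambda>d. recip_term m n d a b + recip_term n m d b a + k * real d ^ (m + n) - \<epsilon> * real d)"
  proof (rule sum.cong[OF refl])
    fix d assume "d \<in> {d. d dvd q}"
    then have "d dvd q" by simp
    note d = this dvd_pos_nat[OF assms(1) this]
    have "coprime a d" by (rule coprime_divisors[OF dvd_refl d(1) assms(6)])
    from dedekind_reciprocity[OF assms(2-5) d(2) this]
    show "?\<mu> d * dedekind_sum m n d a b = ?\<mu> d * (recip_term m n d a b + recip_term n m d b a + k * real d ^ (m + n) - \<epsilon> * real d)"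
      by (simp add: k_def \<epsilon>_def)
  qed
  also have "\<dots> = ?S (\<lambda>d. recip_term m n d a b) + ?S (\<lambda>d. recip_term n m d b a) + k * ?S (\<lambda>d. real d ^ (m + n)) - \<epsilon> * ?S real"
    by (simp only: distrib_left right_diff_distrib sum.distrib sum_subtractf pull)
  \<comment> \<open>The factor m! n! disappears in front of \<epsilon>, which is nonzero only for m
    = n = 1.\<close>
  finally have S: "fact m * fact n * ?S (\<lambda>d. dedekind_sum m n d a b)
    = bernoulli_R m n q a b + bernoulli_R n m q b a + fact m * fact n * k * ?S (\<lambda>d. real d ^ (m + n)) - \<epsilon> * ?S real"
    unfolding bernoulli_R_recip_term[OF assms(2,3)] bernoulli_R_recip_term[OF assms(3,2)]
    by (simp add: distrib_left right_diff_distrib mult_ac \<epsilon>_def)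
  have "complex_of_real (fact m * fact n * k * ?S (\<lambda>d. real d ^ (m + n)) - \<epsilon> * ?S real) = const_C1 m n q a b"
    unfolding of_real_diff of_real_mult sum_moebius_jordan[OF assms(1)] sum_moebius_totient[OF assms(1)]
    by (simp add: const_C1_def k_def \<epsilon>_def bern_def bernoulli_number_def mult_ac)
  then show ?thesis unfolding S by simp
qed

text \<open>The principal branch gives exp(i pi (m - n)/2) = i^m (-i)^n, exactly the power of i and
  the sign left over from the two L-values.\<close>

lemma minus_one_powr_half_diff:
  "(-1) powr ((of_nat m - of_nat n) / 2) = \<i> ^ (m + n) * (-1 :: complex) ^ n"
proof -
  have i: "\<i> = exp (\<i> * pi / 2)" by (simp add: exp_eq_polar cis_conv_exp[symmetric] complex_eq_iff)
  have "(-1) powr ((of_nat m - of_nat n) / 2) = exp ((of_nat m - of_nat n) / 2 * (\<i> * pi))"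
    by (simp add: powr_def)
  also have "(of_nat m - of_nat n) / 2 * (\<i> * pi) = of_nat m * (\<i> * pi / 2) + of_nat n * (- (\<i> * pi / 2))"
    by (simp add: field_simps)
  also have "exp \<dots> = \<i> ^ m * (- \<i>) ^ n"
    unfolding exp_add exp_of_nat_mult exp_minus i[symmetric] by simp
  also have "\<dots> = \<i> ^ (m + n) * (-1) ^ n"
    unfolding power_add by (subst power_minus) simp
  finally show ?thesis .
qed

theorem theorem2p1:
  fixes q m n a b :: nat
  assumes "q > 0" and "m > 0" and "n > 0" and "a > 0" and "b > 0"
    and "coprime a q" and "coprime b q"
  shows "dirichlet_V q m n (int a) (int b) =
    (-1) powr ((of_nat m - of_nat n) / 2) * of_real (2 * pi) ^ (m + n) * of_nat (totient q) /
      (4 * of_nat q ^ (m + n) * fact m * fact n) *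
    (of_real (bernoulli_R m n q a b) + of_real (bernoulli_R n m q b a) + const_C1 m n q a b)"
proof -
  let ?S = "complex_of_real (\<Sum>d | d dvd q. moebius_mu (q div d) * dedekind_sum m n d a b)"
  have "of_real (bernoulli_R m n q a b) + of_real (bernoulli_R n m q b a) + const_C1 m n q a b
    = fact m * fact n * ?S"
    unfolding sum_moebius_dedekind[OF assms(1-6), symmetric] by simp
  moreover have "dirichlet_V q m n (int a) (int b) =
    of_nat (totient q) * (2 * pi * \<i>) ^ (m + n) * (-1) ^ n / of_nat q ^ (m + n) * ?S / 4"
    using arg_cong[OF dirichlet_V_dedekind[OF assms(1-3,6,7)], of "\<lambda>x. x / 4"]
    by (simp del: of_real_sum)
  ultimately show ?thesis
    unfolding minus_one_powr_half_diff using assms(1) by (simp add: power_mult_distrib mult_ac)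
qed

end
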